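(* In the model with gas fees described in the context (with $\gamma>0$, $\delta\ge0$, $\bar\gamma=\gamma+\delta$), define for $P>0$, $x\ge0$ $$ \bar A(P,x)=\frac{A_+(P,x+\bar\gamma)+A_-(P,-x-\bar\gamma)}{2}\ge0, $$ where arbitrageurs' profits, excluding the gas fees paid to validators, are $$ A_+(P,z)=\Big[P\{x^*(Pe^{-z})-x^*(Pe^{-\gamma})\}+e^{+\gamma}\{y^*(Pe^{-z})-y^*(Pe^{-\gamma})\}-g_+\Big]\mathbb{I}_{\{z>+\bar\gamma\}}\ge0, $$ $$ A_-(P,z)=\Big[e^{+\gamma}P\{x^*(Pe^{-z})-x^*(Pe^{+\gamma})\}+\{y^*(Pe^{-z})-y^*(Pe^{+\gamma})\}-g_-\Big]\mathbb{I}_{\{z<-\bar\gamma\}}\ge0, $$ with $$ g_+=P\{x^*(Pe^{-\gamma-\delta})-x^*(Pe^{-\gamma})\}+e^{+\gamma}\{y^*(Pe^{-\gamma-\delta})-y^*(Pe^{-\gamma})\}\ge0, $$ $$ g_-=e^{+\gamma}P\{x^*(Pe^{+\gamma+\delta})-x^*(Pe^{+\gamma})\}+\{y^*(Pe^{+\gamma+\delta})-y^*(Pe^{+\gamma})\}\ge0. $$ Assume that, for each $P>0$, $\bar A(P,\cdot)$ is continuously differentiable, and that there exist $A_0$ and $c$ (possibly depending on $P$) such that $\partial_x\bar A(P,x)\le A_0e^{cx}$ for all $x\ge0$. Consider the fast block regime where $\lambda\to\infty$. Then $$ \overline{\mathsf{ARB}}=\frac{\sigma^2P}{2}\times\frac{y^{*\prime}(Pe^{-\gamma-\delta})+e^{+\gamma+\delta}\cdot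 y^{*\prime}(Pe^{+\gamma+\delta})}{2}\times(1-e^{-\delta})\times\frac{\sqrt{2\lambda}}{\sigma}\times\mathsf{P}_{\mathsf{trade}}+o\big(\sqrt{\lambda^{-1}}\big). $$
   Context: Model. Fix $\sigma,\gamma>0$, $\delta\ge0$, $\bar\gamma=\gamma+\delta$, and for each $\lambda>0$ consider the following. The external price satisfies $dP_t/P_t=\mu\,dt+\sigma\,dB_t$ with $\mu=\frac12\sigma^2$, $P_0=P>0$, $B$ a standard Brownian motion. Arbitrageurs arrive at the arrival times $0<\tau_1<\tau_2<\cdots$ of a Poisson process $N_t$ of rate $\lambda$, independent of $B$. The mispricing process $z_t$ satisfies $dz_t=\sigma\,dB_t$ between arrivals; at an arrival time $t=\tau_i$: if $z_{t^-}>\bar\gamma$ then $z_t=\gamma$; if $z_{t^-}<-\bar\gamma$ then $z_t=-\gamma$; otherwise $z_t=z_{t^-}$. ($\gamma$ is the trading fee and $\delta$ the extra threshold due to gas fees, both in log-price units.) $z_{0^-}$ is independent of $(B,N)$ and distributed according to the unique invariant distribution $\pi$ of this process. Under $\pi$, with $\eta=\sqrt{2\lambda}\,\bar\gamma/\sigma$: $\pi((\bar\gamma,\infty))=\pi((-\infty,-\bar\gamma))=\frac{1}{2+2\eta+\eta^2(1-(\gamma/\bar\gamma)^2)}$, and $z-\bar\gamma$ given $z>\bar\gamma$, and $-\bar\gamma-z$ given $z<-\bar\gamma$, are exponential with parameter $\sqrt{2\lambda}/\sigma$. $\mathsf{P}_{\mathsf{trade}}=\pi((\bar\gamma,\infty))+\pi((-\infty,-\bar\gamma))$.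 Pool. $f:\mathbb{R}_+^2\to\mathbb{R}$ is a bonding function and $L\in\mathbb{R}$; $V(P)=\min\{Px+y:(x,y)\in\mathbb{R}^2_+,\ f(x,y)=L\}$. Assume: (i) an optimal solution $(x^*(P),y^*(P))$ exists for every $P\ge0$; (ii) $V$ is everywhere twice continuously differentiable; (iii) $\mathsf{E}[\int_0^t x^*(P_s)^2P_s^2\,ds]<\infty$ for all $t\ge0$. Primes denote derivatives in price. $\mathbb{I}$ denotes an indicator; $g_\pm$ depend on the price argument $P$ (they are the gas costs valued in the numéraire). With $A=A_++A_-$, $\mathsf{ARB}_T=\sum_{i=1}^{N_T}A(P_{\tau_i},z_{\tau_i^-})$ and $\overline{\mathsf{ARB}}=\lim_{T\to0}\mathsf{E}[\mathsf{ARB}_T]/T$, which equals $\lambda\mathsf{E}_\pi[A(P,z)]$.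
   Formalization: The asymptotic expansion is asserted only for δ>0: at δ=0 its main term vanishes while ARB is of exact order λ^{-1/2} (e.g. x*=1/(1+P), y*=ln(1+P)+1/(1+P)−1), so the claim fails there; the nonnegativity claims are kept for δ≥0. *)

theory Defs
  imports "HOL-Probability.Probability" "HOL-Library.Landau_Symbols"
begin

section \<open>The pool\<close>

definition feasible :: "(real \<Rightarrow> real \<Rightarrow> real) \<Rightarrow> real \<Rightarrow> real \<times> real \<Rightarrow> bool" where
  "feasible f L = (\<lambda>(x, y). 0 \<le> x \<and> 0 \<le> y \<and> f x y = L)"

text \<open>The infimum below is a minimum as soon as an optimal solution exists, which is part of
  \<open>pool\<close>.\<close>

definition pool_value :: "(real \<Rightarrow> real \<Rightarrow> real) \<Rightarrow> real \<Rightarrow> real \<Rightarrow> real" where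
  "pool_value f L P = Inf ((\<lambda>(x, y). P * x + y) ` {r. feasible f L r})"

text \<open>\<open>xs\<close> and \<open>ys\<close> are the reserves \<open>x\<^sup>*\<close> and \<open>y\<^sup>*\<close> of an optimal solution.  Smoothness of the value
  function is required at positive prices only: for a constant-product pool it is a multiple of
  \<open>sqrt P\<close>, which has no derivative at \<open>0\<close>.\<close>

locale pool =
  fixes f :: "real \<Rightarrow> real \<Rightarrow> real" and L :: real and xs ys :: "real \<Rightarrow> real"
  assumes optimal: "0 \<le> P \<Longrightarrow> is_arg_min (\<lambda>(x, y). P * x + y) (feasible f L) (xs P, ys P)"
    and value_differentiable: "0 < P \<Longrightarrow> pool_value f L differentiable (at P)"
    and value_C2: "deriv (pool_value f L) C1_differentiable_on {0<..}"

section \<open>Arbitrage profits net of gas\<close>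

definition gas_plus :: "(real \<Rightarrow> real) \<Rightarrow> (real \<Rightarrow> real) \<Rightarrow> real \<Rightarrow> real \<Rightarrow> real \<Rightarrow> real" where
  "gas_plus xs ys \<gamma> \<delta> P =
     P * (xs (P * exp (- \<gamma> - \<delta>)) - xs (P * exp (- \<gamma>)))
     + exp \<gamma> * (ys (P * exp (- \<gamma> - \<delta>)) - ys (P * exp (- \<gamma>)))"

definition gas_minus :: "(real \<Rightarrow> real) \<Rightarrow> (real \<Rightarrow> real) \<Rightarrow> real \<Rightarrow> real \<Rightarrow> real \<Rightarrow> real" where
  "gas_minus xs ys \<gamma> \<delta> P =
     exp \<gamma> * P * (xs (P * exp (\<gamma> + \<delta>)) - xs (P * exp \<gamma>))
     + (ys (P * exp (\<gamma> + \<delta>)) - ys (P * exp \<gamma>))"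

definition profit_plus ::
    "(real \<Rightarrow> real) \<Rightarrow> (real \<Rightarrow> real) \<Rightarrow> real \<Rightarrow> real \<Rightarrow> real \<Rightarrow> real \<Rightarrow> real" where
  "profit_plus xs ys \<gamma> \<delta> P z =
     (P * (xs (P * exp (- z)) - xs (P * exp (- \<gamma>)))
      + exp \<gamma> * (ys (P * exp (- z)) - ys (P * exp (- \<gamma>)))
      - gas_plus xs ys \<gamma> \<delta> P) * indicator {\<gamma> + \<delta><..} z"

definition profit_minus ::
    "(real \<Rightarrow> real) \<Rightarrow> (real \<Rightarrow> real) \<Rightarrow> real \<Rightarrow> real \<Rightarrow> real \<Rightarrow> real \<Rightarrow> real" where
  "profit_minus xs ys \<gamma> \<delta> P z =
     (exp \<gamma> * P * (xs (P * exp (- z)) - xs (P * exp \<gamma>))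
      + (ys (P * exp (- z)) - ys (P * exp \<gamma>))
      - gas_minus xs ys \<gamma> \<delta> P) * indicator {..<- (\<gamma> + \<delta>)} z"

definition profit ::
    "(real \<Rightarrow> real) \<Rightarrow> (real \<Rightarrow> real) \<Rightarrow> real \<Rightarrow> real \<Rightarrow> real \<Rightarrow> real \<Rightarrow> real" where
  "profit xs ys \<gamma> \<delta> P z = profit_plus xs ys \<gamma> \<delta> P z + profit_minus xs ys \<gamma> \<delta> P z"

definition mean_profit ::
    "(real \<Rightarrow> real) \<Rightarrow> (real \<Rightarrow> real) \<Rightarrow> real \<Rightarrow> real \<Rightarrow> real \<Rightarrow> real \<Rightarrow> real" where
  "mean_profit xs ys \<gamma> \<delta> P x =
     (profit_plus xs ys \<gamma> \<delta> P (x + (\<gamma> + \<delta>)) + profit_minus xs ys \<gamma> \<delta> P (- x - (\<gamma> + \<delta>))) / 2"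

section \<open>Driving processes\<close>

text \<open>Paths are continuous everywhere and not just almost everywhere, so that evaluation of \<open>B\<close>
  at a random time is measurable without completing the measure.\<close>

locale standard_brownian_motion = prob_space +
  fixes B :: "real \<Rightarrow> 'a \<Rightarrow> real"
  assumes B_measurable: "0 \<le> t \<Longrightarrow> random_variable borel (B t)"
    and B_0: "\<omega> \<in> space M \<Longrightarrow> B 0 \<omega> = 0"
    and B_continuous: "\<omega> \<in> space M \<Longrightarrow> continuous_on {0..} (\<lambda>t. B t \<omega>)"
    and B_normal_increment: "0 \<le> s \<Longrightarrow> s < t \<Longrightarrow>
      distributed M lborel (\<lambda>\<omega>. B t \<omega> - B s \<omega>) (normal_density 0 (sqrt (t - s)))"
    and B_indep_increments: "0 \<le> r 0 \<Longrightarrow> (\<And>i. i < n \<Longrightarrow> r i \<le> r (Suc i)) \<Longrightarrow>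
      indep_vars (\<lambda>_. borel) (\<lambda>i \<omega>. B (r (Suc i)) \<omega> - B (r i) \<omega>) {..<n::nat}"

text \<open>The arrival times are \<open>\<tau> 1 < \<tau> 2 < \<dots>\<close>; the entry \<open>\<tau> 0 = 0\<close> is not an arrival.
  The Poisson process is given by its independent exponential waiting times, and its counting
  process is \<open>arrival_count\<close>.\<close>

locale poisson_arrivals = prob_space +
  fixes rate :: real and \<tau> :: "nat \<Rightarrow> 'a \<Rightarrow> real"
  assumes \<tau>_measurable: "random_variable borel (\<tau> i)"
    and \<tau>_0: "\<omega> \<in> space M \<Longrightarrow> \<tau> 0 \<omega> = 0"
    and \<tau>_strict_mono: "\<omega> \<in> space M \<Longrightarrow> strict_mono (\<lambda>i. \<tau> i \<omega>)"
    and \<tau>_at_top: "\<omega> \<in> space M \<Longrightarrow> filterlim (\<lambda>i. \<tau> i \<omega>) at_top sequentially"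
    and \<tau>_exponential_waiting:
      "distributed M lborel (\<lambda>\<omega>. \<tau> (Suc i) \<omega> - \<tau> i \<omega>) (exponential_density rate)"
    and \<tau>_indep_waiting: "indep_vars (\<lambda>_. borel) (\<lambda>i \<omega>. \<tau> (Suc i) \<omega> - \<tau> i \<omega>) UNIV"

definition arrival_count :: "(nat \<Rightarrow> real) \<Rightarrow> real \<Rightarrow> nat" where
  "arrival_count \<tau> t = card {i. 1 \<le> i \<and> \<tau> i \<le> t}"

text \<open>Solution of \<open>dP\<^sub>t / P\<^sub>t = \<mu> dt + \<sigma> dB\<^sub>t\<close>, \<open>P\<^sub>0 = P\<close>, along a path \<open>b\<close> of the Brownian motion.\<close>

definition geometric_path :: "real \<Rightarrow> real \<Rightarrow> real \<Rightarrow> (real \<Rightarrow> real) \<Rightarrow> real \<Rightarrow> real" where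
  "geometric_path \<mu> \<sigma> P b t = P * exp ((\<mu> - \<sigma>\<^sup>2 / 2) * t + \<sigma> * b t)"

definition price :: "real \<Rightarrow> real \<Rightarrow> (real \<Rightarrow> real) \<Rightarrow> real \<Rightarrow> real" where
  "price \<sigma> = geometric_path (\<sigma>\<^sup>2 / 2) \<sigma>"

section \<open>Mispricing\<close>

definition reset :: "real \<Rightarrow> real \<Rightarrow> real \<Rightarrow> real" where
  "reset \<gamma> \<delta> z = (if z > \<gamma> + \<delta> then \<gamma> else if z < - (\<gamma> + \<delta>) then - \<gamma> else z)"

text \<open>Pathwise construction from a driving path \<open>b\<close>, arrival times \<open>\<tau>\<close> and a starting point \<open>z\<close>
  (as no arrival occurs at time \<open>0\<close>, the values at \<open>0\<close> and just before \<open>0\<close> agree).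
  \<open>post_arrival\<close> is the value immediately after the \<open>i\<close>-th arrival; the argument of \<open>reset\<close> is the
  left limit at the next arrival, since \<open>b\<close> is continuous.\<close>

primrec post_arrival ::
    "real \<Rightarrow> real \<Rightarrow> real \<Rightarrow> (real \<Rightarrow> real) \<Rightarrow> (nat \<Rightarrow> real) \<Rightarrow> real \<Rightarrow> nat \<Rightarrow> real" where
  "post_arrival \<sigma> \<gamma> \<delta> b \<tau> z 0 = z"
| "post_arrival \<sigma> \<gamma> \<delta> b \<tau> z (Suc i) =
     reset \<gamma> \<delta> (post_arrival \<sigma> \<gamma> \<delta> b \<tau> z i + \<sigma> * (b (\<tau> (Suc i)) - b (\<tau> i)))"

definition mispricing ::
    "real \<Rightarrow> real \<Rightarrow> real \<Rightarrow> (real \<Rightarrow> real) \<Rightarrow> (nat \<Rightarrow> real) \<Rightarrow> real \<Rightarrow> real \<Rightarrow> real" where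
  "mispricing \<sigma> \<gamma> \<delta> b \<tau> z t =
     (let n = arrival_count \<tau> t in post_arrival \<sigma> \<gamma> \<delta> b \<tau> z n + \<sigma> * (b t - b (\<tau> n)))"

text \<open>The inner \<open>emeasure\<close> is the transition probability from \<open>x\<close> to \<open>A\<close> in time \<open>t\<close>.\<close>

definition invariant_distribution ::
    "real \<Rightarrow> real \<Rightarrow> real \<Rightarrow> 'a measure \<Rightarrow> (real \<Rightarrow> 'a \<Rightarrow> real) \<Rightarrow> (nat \<Rightarrow> 'a \<Rightarrow> real) \<Rightarrow> real measure \<Rightarrow> bool"
  where
  "invariant_distribution \<sigma> \<gamma> \<delta> M B \<tau> \<pi> \<longleftrightarrow>
     prob_space \<pi> \<and> sets \<pi> = sets borel \<and>
     (\<forall>t\<ge>0. \<forall>A\<in>sets borel. emeasure \<pi> A =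
        (\<integral>\<^sup>+ x. emeasure M
           {\<omega> \<in> space M. mispricing \<sigma> \<gamma> \<delta> (\<lambda>s. B s \<omega>) (\<lambda>i. \<tau> i \<omega>) x t \<in> A} \<partial>\<pi>))"

text \<open>Independence is stated through the generated sigma-algebras, because \<open>indep_var\<close> needs both
  variables to have values in the same type.\<close>

locale mispricing_model =
  standard_brownian_motion M B + poisson_arrivals M rate \<tau>
  for M :: "'a measure" and B :: "real \<Rightarrow> 'a \<Rightarrow> real" and rate :: real and \<tau> :: "nat \<Rightarrow> 'a \<Rightarrow> real" +
  fixes \<sigma> \<gamma> \<delta> :: real and \<pi> :: "real measure" and z0 :: "'a \<Rightarrow> real"
  assumes B_indep_\<tau>:
      "indep_set (sets (vimage_algebra (space M) (\<lambda>\<omega>. \<lambda>t\<in>{0..}. B t \<omega>) (PiM {0..} (\<lambda>_. borel))))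
                 (sets (vimage_algebra (space M) (\<lambda>\<omega> i. \<tau> i \<omega>) (PiM UNIV (\<lambda>_. borel))))"
    and z0_indep:
      "indep_set (sets (vimage_algebra (space M) z0 borel))
                 (sets (vimage_algebra (space M) (\<lambda>\<omega>. (\<lambda>t\<in>{0..}. B t \<omega>, \<lambda>i. \<tau> i \<omega>))
                          (PiM {0..} (\<lambda>_. borel) \<Otimes>\<^sub>M PiM UNIV (\<lambda>_. borel))))"
    and \<pi>_invariant: "invariant_distribution \<sigma> \<gamma> \<delta> M B \<tau> \<pi>"
    and z0_distr: "distr M borel z0 = \<pi>"

definition trade_prob :: "real \<Rightarrow> real \<Rightarrow> real measure \<Rightarrow> real" where
  "trade_prob \<gamma> \<delta> \<pi> = measure \<pi> {\<gamma> + \<delta><..} + measure \<pi> {..<- (\<gamma> + \<delta>)}"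

section \<open>Aggregate arbitrage profits\<close>

text \<open>\<open>Lim (at_left t)\<close> of the mispricing path is its value just before the arrival at \<open>t\<close>.\<close>

definition arb ::
    "(real \<Rightarrow> real) \<Rightarrow> (real \<Rightarrow> real) \<Rightarrow> real \<Rightarrow> real \<Rightarrow> real \<Rightarrow> real \<Rightarrow>
     (real \<Rightarrow> real) \<Rightarrow> (nat \<Rightarrow> real) \<Rightarrow> real \<Rightarrow> real \<Rightarrow> real" where
  "arb xs ys \<sigma> \<gamma> \<delta> P b \<tau> z T =
     (\<Sum>i = 1..arrival_count \<tau> T.
        profit xs ys \<gamma> \<delta> (price \<sigma> P b (\<tau> i)) (Lim (at_left (\<tau> i)) (mispricing \<sigma> \<gamma> \<delta> b \<tau> z)))"

definition arb_rate ::
    "(real \<Rightarrow> real) \<Rightarrow> (real \<Rightarrow> real) \<Rightarrow> real \<Rightarrow> real \<Rightarrow> real \<Rightarrow> real \<Rightarrow>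
     'a measure \<Rightarrow> (real \<Rightarrow> 'a \<Rightarrow> real) \<Rightarrow> (nat \<Rightarrow> 'a \<Rightarrow> real) \<Rightarrow> ('a \<Rightarrow> real) \<Rightarrow> real" where
  "arb_rate xs ys \<sigma> \<gamma> \<delta> P M B \<tau> z0 =
     Lim (at_right 0)
       (\<lambda>T. (\<integral>\<omega>. arb xs ys \<sigma> \<gamma> \<delta> P (\<lambda>t. B t \<omega>) (\<lambda>i. \<tau> i \<omega>) (z0 \<omega>) T \<partial>M) / T)"

end

theory Submission
  imports Defs
begin

text \<open>Let \<open>\<theta> = sqrt (2 * l) / \<sigma>\<close>.  Expanding the semigroup of the mispricing to first order at time \<open>0\<close> on
  characteristic functions shows that \<open>\<pi>\<close> is the law of \<open>reset \<gamma> \<delta> z + X\<close>, where \<open>z\<close> has law \<open>\<pi>\<close> and \<open>X\<close> is an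
  independent Laplace variable with parameter \<open>\<theta>\<close>.  Hence both tails of \<open>\<pi>\<close> are exponential with parameter
  \<open>\<theta>\<close>; comparing first moments, they have the same mass, and comparing second moments, this mass is
  \<open>O(1 / l)\<close> if \<open>\<delta> > 0\<close>.  The expected profit up to time \<open>T\<close> is that of the first arrival up to \<open>O(T\<^sup>2)\<close>, so
  \<open>arb_rate\<close> is \<open>l\<close> times the mean profit under \<open>\<pi>\<close>, i.e. \<open>l * trade_prob\<close> times the average of
  \<open>mean_profit\<close> over the exponential law.  Multiplied by \<open>\<theta>\<close>, this average tends to the derivative of
  \<open>mean_profit\<close> at \<open>0\<close>, which the envelope identities \<open>xs = V'\<close> and \<open>ys' = - P * xs'\<close> evaluate.  The growth
  condition dominates this limit; since the reserves are monotone, it also bounds the profit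
  exponentially in the log-price and the mispricing, uniformly in the price.\<close>

section \<open>The pool\<close>

text \<open>Let p be the trade probability, J(\<theta>) the exponential average of the profit times
  \<theta>, and a the derivative of \<open>mean_profit\<close> at 0. The rate minus its main term is
  exactly \<open>\<sigma>\<^sup>2 / 2 * \<theta> * p * (J \<theta> - a)\<close>. As p = O(1 / l) and
  \<theta> has order sqrt l, the prefactor is O(1 / sqrt l), so convergence of J at any speed
  suffices. The bound on p divides by
  \<open>(\<gamma> + \<delta>)\<^sup>2 - \<gamma>\<^sup>2\<close>, hence the guard \<delta> > 0.

  Two obstacles shape the rest. First, \<open>reset\<close> may jump at the thresholds, so the
  short-time expansion is pointwise only off them, and \<open>\<pi>\<close> must be shown to have no
  atoms. Characters are good test functions: they are bounded, and they determine the law. Second,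
  profits are evaluated at a random price, while the growth condition has constants depending on the
  price. Its instance at price 1 bounds the reserves, which are functions of one variable, and these
  bound the profit at all prices. The resulting exponent k is smaller than \<theta> once l is
  large.\<close>

context pool
begin

lemma reserves_nonneg:
  assumes "0 \<le> p"
  shows "0 \<le> xs p" "0 \<le> ys p"
  using optimal[OF assms] by (auto simp: is_arg_min_def feasible_def)

lemma reserves_optimal:
  assumes "0 \<le> p" "0 \<le> q"
  shows "p * xs p + ys p \<le> p * xs q + ys q"
  using optimal[OF assms(1)] optimal[OF assms(2)]
  by (auto simp: is_arg_min_def not_less)

lemma pool_value_eq:
  assumes "0 \<le> p"
  shows "pool_value f L p = p * xs p + ys p"
  unfolding pool_value_def using optimal[OF assms]
  by (intro cInf_eq_minimum)
     (auto simp: is_arg_min_def not_less intro!: image_eqI[where x="(xs p, ys p)"])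

text \<open>Adding the two optimality inequalities, each tested with the reserves of the other
  price, cancels the \<open>ys\<close> terms.\<close>

lemma xs_antimono:
  assumes "0 \<le> p" "p \<le> q"
  shows "xs q \<le> xs p"
proof (cases "p = q")
  case False
  have "(q - p) * (xs q - xs p) \<le> 0"
    using reserves_optimal[of p q] reserves_optimal[of q p] assms by (simp add: algebra_simps)
  then show ?thesis
    using assms False by (simp add: mult_le_0_iff)
qed simp

lemma ys_mono:
  assumes "0 \<le> p" "p \<le> q"
  shows "ys p \<le> ys q"
proof -
  have "0 \<le> p * (xs p - xs q)"
    using assms xs_antimono by simp
  then show ?thesis
    using reserves_optimal[of p q] assms by (simp add: algebra_simps)
qed

text \<open>The envelope argument: the tangent line \<open>q \<mapsto> q * xs p + ys p\<close> touches the concave value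
  function from above at \<open>p\<close>.\<close>

lemma deriv_pool_value:
  assumes "0 < p"
  shows "deriv (pool_value f L) p = xs p"
proof -
  obtain d where d: "(pool_value f L has_real_derivative d) (at p)"
    using value_differentiable[OF assms] real_differentiable_def by blast
  have "((\<lambda>q. q * xs p + ys p - pool_value f L q) has_real_derivative xs p - d) (at p)"
    by (auto intro!: derivative_eq_intros d)
  then have "xs p - d = 0"
  proof (rule DERIV_local_min[OF _ assms], intro allI impI)
    \<comment> \<open>The radius p in the local minimum rule keeps q nonnegative, so optimality is
      available at every competing price.\<close>
    fix q assume "\<bar>p - q\<bar> < p"
    then have "0 \<le> q" by simp
    then show "p * xs p + ys p - pool_value f L p \<le> q * xs p + ys p - pool_value f L q"
      using reserves_optimal[of q p] assms by (simp add: pool_value_eq)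
  qed
  then show ?thesis
    using DERIV_imp_deriv[OF d] by simp
qed

lemma has_derivative_xs:
  assumes "0 < p"
  shows "(xs has_real_derivative deriv xs p) (at p)"
proof -
  obtain D where D: "(deriv (pool_value f L) has_real_derivative D) (at p)"
    using value_C2 assms
    by (auto simp: C1_differentiable_on_def has_real_derivative_iff_has_vector_derivative)
  have "(xs has_real_derivative D) (at p)"
    by (rule has_field_derivative_transform_within_open[OF D open_greaterThan])
       (use assms deriv_pool_value in auto)
  then show ?thesis
    using DERIV_imp_deriv by metis
qed

text \<open>Since \<open>ys p\<close> is V(p) - p * \<open>xs p\<close> with V' = \<open>xs\<close>,
  the two undifferentiated \<open>xs\<close> terms cancel.\<close>

lemma has_derivative_ys:
  assumes "0 < p"
  shows "(ys has_real_derivative - p * deriv xs p) (at p)"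
proof -
  have "(pool_value f L has_real_derivative xs p) (at p)"
    using value_differentiable[OF assms] deriv_pool_value[OF assms]
    by (metis DERIV_imp_deriv real_differentiable_def)
  then have "((\<lambda>q. pool_value f L q - q * xs q) has_real_derivative - p * deriv xs p) (at p)"
    by (auto intro!: derivative_eq_intros has_derivative_xs assms)
  then show ?thesis
    by (rule has_field_derivative_transform_within_open[OF _ open_greaterThan])
       (use assms in \<open>auto simp: pool_value_eq\<close>)
qed

lemma deriv_ys:
  "0 < p \<Longrightarrow> deriv ys p = - p * deriv xs p"
  using has_derivative_ys DERIV_imp_deriv by blast

lemma continuous_on_reserves:
  "continuous_on {0<..} xs" "continuous_on {0<..} ys"
  using has_derivative_xs has_derivative_ys
  by (auto intro!: DERIV_continuous continuous_at_imp_continuous_on)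

end

section \<open>Profit and gas\<close>

text \<open>The gas costs make the terms at the prices \<open>Q * exp (- \<gamma>)\<close> and \<open>Q * exp \<gamma>\<close> cancel, so the profit is
  a continuous function of the mispricing, without a jump at the threshold \<open>\<gamma> + \<delta>\<close>.\<close>

definition buy_profit :: "(real \<Rightarrow> real) \<Rightarrow> (real \<Rightarrow> real) \<Rightarrow> real \<Rightarrow> real \<Rightarrow> real \<Rightarrow> real \<Rightarrow> real" where
  "buy_profit xs ys \<gamma> g Q z =
     Q * (xs (Q * exp (- z)) - xs (Q * exp (- g))) + exp \<gamma> * (ys (Q * exp (- z)) - ys (Q * exp (- g)))"

definition sell_profit :: "(real \<Rightarrow> real) \<Rightarrow> (real \<Rightarrow> real) \<Rightarrow> real \<Rightarrow> real \<Rightarrow> real \<Rightarrow> real \<Rightarrow> real" where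
  "sell_profit xs ys \<gamma> g Q z =
     exp \<gamma> * Q * (xs (Q * exp (- z)) - xs (Q * exp g)) + (ys (Q * exp (- z)) - ys (Q * exp g))"

text \<open>Subtracting the gas moves the reference point from \<gamma> to \<gamma> + \<delta>. The
  bracket then vanishes at the threshold, so truncating its argument by \<open>max\<close> has the
  effect of the indicator.\<close>

lemma profit_plus_eq_buy_profit:
  "profit_plus xs ys \<gamma> \<delta> Q z = buy_profit xs ys \<gamma> (\<gamma> + \<delta>) Q (max z (\<gamma> + \<delta>))"
  by (cases "z > \<gamma> + \<delta>")
     (auto simp: profit_plus_def gas_plus_def buy_profit_def max_def right_diff_distrib)

lemma profit_minus_eq_sell_profit:
  "profit_minus xs ys \<gamma> \<delta> Q z = sell_profit xs ys \<gamma> (\<gamma> + \<delta>) Q (min z (- (\<gamma> + \<delta>)))"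
proof (cases "z < - (\<gamma> + \<delta>)")
  case True
  then show ?thesis
    by (auto simp: profit_minus_def gas_minus_def sell_profit_def min_def right_diff_distrib)
next
  case False
  then have "min z (- (\<gamma> + \<delta>)) = - (\<gamma> + \<delta>)" by simp
  with False show ?thesis
    by (auto simp: profit_minus_def sell_profit_def add.commute)
qed

text \<open>The gas cost is the gross profit of a trade exactly at the threshold. With reference
  point \<gamma> instead of \<gamma> + \<delta>, one sign argument covers both gas and net
  profit.\<close>

lemma gas_plus_eq_buy_profit: "gas_plus xs ys \<gamma> \<delta> Q = buy_profit xs ys \<gamma> \<gamma> Q (\<gamma> + \<delta>)"
  by (simp add: gas_plus_def buy_profit_def)

lemma gas_minus_eq_sell_profit: "gas_minus xs ys \<gamma> \<delta> Q = sell_profit xs ys \<gamma> \<gamma> Q (- (\<gamma> + \<delta>))"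
  by (simp add: gas_minus_def sell_profit_def add.commute)

context pool
begin

text \<open>Optimality at the price \<open>Q * exp (- g)\<close> bounds the change of \<open>ys\<close> by that of \<open>xs\<close>.\<close>

lemma buy_profit_nonneg:
  assumes "0 < Q" "\<gamma> \<le> g" "g \<le> z"
  shows "0 \<le> buy_profit xs ys \<gamma> g Q z"
proof -
  let ?p = "Q * exp (- g)" and ?q = "Q * exp (- z)"
  have "ys ?p - ys ?q \<le> ?p * (xs ?q - xs ?p)"
    using reserves_optimal[of ?p ?q] assms by (simp add: algebra_simps)
  then have "exp \<gamma> * (ys ?p - ys ?q) \<le> exp \<gamma> * (?p * (xs ?q - xs ?p))"
    by (rule mult_left_mono) simp
  also have "\<dots> = exp (\<gamma> - g) * (Q * (xs ?q - xs ?p))"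
    by (simp add: exp_diff exp_minus divide_simps)
  also have "\<dots> \<le> 1 * (Q * (xs ?q - xs ?p))"
    using assms xs_antimono[of ?q ?p] by (intro mult_right_mono) auto
  finally show ?thesis
    by (simp add: buy_profit_def algebra_simps)
qed

lemma sell_profit_nonneg:
  assumes "0 < Q" "\<gamma> \<le> g" "g \<le> - z"
  shows "0 \<le> sell_profit xs ys \<gamma> g Q z"
proof -
  let ?p = "Q * exp g" and ?q = "Q * exp (- z)"
  have "ys ?q - ys ?p \<ge> ?p * (xs ?p - xs ?q)"
    using reserves_optimal[of ?p ?q] assms by (simp add: algebra_simps)
  moreover have "exp \<gamma> * (Q * (xs ?p - xs ?q)) \<le> exp g * (Q * (xs ?p - xs ?q))"
    using assms xs_antimono[of ?p ?q] by (intro mult_right_mono) auto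
  ultimately show ?thesis
    by (simp add: sell_profit_def algebra_simps)
qed

lemma gas_nonneg:
  assumes "0 < Q" "0 \<le> \<delta>"
  shows "0 \<le> gas_plus xs ys \<gamma> \<delta> Q" "0 \<le> gas_minus xs ys \<gamma> \<delta> Q"
  using assms by (auto simp: gas_plus_eq_buy_profit gas_minus_eq_sell_profit
      intro!: buy_profit_nonneg sell_profit_nonneg)

lemma profit_parts_nonneg:
  assumes "0 < Q" "0 \<le> \<delta>"
  shows "0 \<le> profit_plus xs ys \<gamma> \<delta> Q z" "0 \<le> profit_minus xs ys \<gamma> \<delta> Q z"
  using assms by (auto simp: profit_plus_eq_buy_profit profit_minus_eq_sell_profit
      intro!: buy_profit_nonneg sell_profit_nonneg)

lemma profit_nonneg:
  assumes "0 < Q" "0 \<le> \<delta>"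
  shows "0 \<le> profit xs ys \<gamma> \<delta> Q z"
  using profit_parts_nonneg[OF assms] by (simp add: profit_def)

lemma mean_profit_nonneg:
  assumes "0 < Q" "0 \<le> \<delta>"
  shows "0 \<le> mean_profit xs ys \<gamma> \<delta> Q x"
  using profit_parts_nonneg[OF assms] by (simp add: mean_profit_def)

lemma continuous_on_profit:
  assumes "continuous_on S q" "continuous_on S z" "\<And>s. s \<in> S \<Longrightarrow> 0 < q s"
  shows "continuous_on S (\<lambda>s. profit xs ys \<gamma> \<delta> (q s) (z s))"
proof -
  note [continuous_intros] = continuous_on_compose2[OF continuous_on_reserves(1)]
    continuous_on_compose2[OF continuous_on_reserves(2)]
  show ?thesis
    unfolding profit_def profit_plus_eq_buy_profit profit_minus_eq_sell_profit
      buy_profit_def sell_profit_def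
    using assms by (auto intro!: continuous_intros)
qed

lemma borel_measurable_profit [measurable (raw)]:
  assumes [measurable]: "q \<in> borel_measurable N" "z \<in> borel_measurable N"
    and q: "\<And>s. s \<in> space N \<Longrightarrow> 0 < q s"
  shows "(\<lambda>s. profit xs ys \<gamma> \<delta> (q s) (z s)) \<in> borel_measurable N"
proof -
  \<comment> \<open>The reserves are known to be continuous at positive prices only; writing the
    price as an exponential gives a function continuous on the whole plane.\<close>
  have "continuous_on UNIV (\<lambda>r :: real \<times> real. profit xs ys \<gamma> \<delta> (exp (fst r)) (snd r))"
    by (intro continuous_on_profit continuous_intros) auto
  then have [measurable]: "(\<lambda>r :: real \<times> real. profit xs ys \<gamma> \<delta> (exp (fst r)) (snd r)) \<in> borel_measurable borel"
    by (rule borel_measurable_continuous_onI)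
  have "(\<lambda>s. (ln (q s), z s)) \<in> borel_measurable N"
    by measurable
  then have "(\<lambda>s. profit xs ys \<gamma> \<delta> (exp (fst (ln (q s), z s))) (snd (ln (q s), z s))) \<in> borel_measurable N"
    by (rule measurable_compose) measurable
  then show ?thesis
    by (rule measurable_cong[THEN iffD1, rotated]) (use q in auto)
qed

lemma mean_profit_0 [simp]: "mean_profit xs ys \<gamma> \<delta> Q 0 = 0"
  by (simp add: mean_profit_def profit_plus_def profit_minus_def)

text \<open>At a price p = Q exp(-(\<gamma> + \<delta>)), the relation ys' = -p xs' turns the buy
  side into ys'(p) (Q - exp(\<gamma>) p) = Q ys'(p) (1 - exp(-\<delta>)). The sell side gives the
  same factor 1 - exp(-\<delta>) with the weight exp(\<gamma> + \<delta>).\<close>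

lemma has_derivative_mean_profit_0:
  assumes Q: "0 < Q"
  shows "(mean_profit xs ys \<gamma> \<delta> Q has_real_derivative
     Q * (deriv ys (Q * exp (- \<gamma> - \<delta>)) + exp (\<gamma> + \<delta>) * deriv ys (Q * exp (\<gamma> + \<delta>))) / 2 * (1 - exp (- \<delta>)))
     (at 0 within {0..})"
proof -
  let ?g = "\<gamma> + \<delta>"
  let ?p = "Q * exp (- ?g)" and ?q = "Q * exp ?g"
  have p: "((\<lambda>x. Q * exp (- (x + ?g))) has_real_derivative - ?p) (at 0)"
    by (auto intro!: derivative_eq_intros)
  have q: "((\<lambda>x. Q * exp (- (- x - ?g))) has_real_derivative ?q) (at 0)"
    by (auto intro!: derivative_eq_intros)
  have xp: "((\<lambda>x. xs (Q * exp (- (x + ?g)))) has_real_derivative deriv xs ?p * - ?p) (at 0)"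
    by (rule DERIV_chain2[OF _ p]) (use has_derivative_xs[of ?p] Q in simp)
  have yp: "((\<lambda>x. ys (Q * exp (- (x + ?g)))) has_real_derivative - ?p * deriv xs ?p * - ?p) (at 0)"
    by (rule DERIV_chain2[OF _ p]) (use has_derivative_ys[of ?p] Q in simp)
  have xq: "((\<lambda>x. xs (Q * exp (- (- x - ?g)))) has_real_derivative deriv xs ?q * ?q) (at 0)"
    by (rule DERIV_chain2[OF _ q]) (use has_derivative_xs[of ?q] Q in \<open>simp add: add.commute\<close>)
  have yq: "((\<lambda>x. ys (Q * exp (- (- x - ?g)))) has_real_derivative - ?q * deriv xs ?q * ?q) (at 0)"
    by (rule DERIV_chain2[OF _ q]) (use has_derivative_ys[of ?q] Q in \<open>simp add: add.commute\<close>)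
  \<comment> \<open>The profits without truncation are differentiable on both sides of 0 and agree
    with \<open>mean_profit\<close> for x >= 0, which leaves the one-sided derivative.\<close>
  have "((\<lambda>x. (buy_profit xs ys \<gamma> ?g Q (x + ?g) + sell_profit xs ys \<gamma> ?g Q (- x - ?g)) / 2)
     has_real_derivative
     (Q * (deriv xs ?p * - ?p) + exp \<gamma> * (- ?p * deriv xs ?p * - ?p)
      + (exp \<gamma> * Q * (deriv xs ?q * ?q) + - ?q * deriv xs ?q * ?q)) / 2) (at 0)"
    unfolding buy_profit_def sell_profit_def
    by (rule derivative_eq_intros xp yp xq yq refl | simp)+
  also have "(Q * (deriv xs ?p * - ?p) + exp \<gamma> * (- ?p * deriv xs ?p * - ?p)
      + (exp \<gamma> * Q * (deriv xs ?q * ?q) + - ?q * deriv xs ?q * ?q)) / 2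
    = Q * (deriv ys (Q * exp (- \<gamma> - \<delta>)) + exp ?g * deriv ys ?q) / 2 * (1 - exp (- \<delta>))"
  proof -
    have *: "exp (- \<gamma> - \<delta>) = inverse (exp \<gamma> * exp \<delta>)" "exp (- ?g) = inverse (exp \<gamma> * exp \<delta>)"
      "exp ?g = exp \<gamma> * exp \<delta>" "exp (- \<delta>) = inverse (exp \<delta>)"
      by (simp_all add: exp_add exp_minus exp_diff field_simps)
    define X Y where "X = deriv xs ?p" and "Y = deriv xs ?q"
    have p: "exp (- \<gamma> - \<delta>) = exp (- ?g)" by simp
    have "deriv ys ?p = - ?p * X" "deriv ys ?q = - ?q * Y"
      using Q deriv_ys[of ?p] deriv_ys[of ?q] by (simp_all add: X_def Y_def)
    then show ?thesis
      unfolding X_def[symmetric] Y_def[symmetric] p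
      by (simp only: * mult_minus_left mult_minus_right) (simp add: field_simps)
  qed
  finally have "((\<lambda>x. (buy_profit xs ys \<gamma> ?g Q (x + ?g) + sell_profit xs ys \<gamma> ?g Q (- x - ?g)) / 2)
     has_real_derivative
     Q * (deriv ys (Q * exp (- \<gamma> - \<delta>)) + exp (\<gamma> + \<delta>) * deriv ys (Q * exp (\<gamma> + \<delta>))) / 2 * (1 - exp (- \<delta>)))
     (at 0 within {0..})"
    by (rule has_field_derivative_at_within)
  then show ?thesis
    by (rule has_field_derivative_transform_within[OF _ zero_less_one])
       (auto simp: mean_profit_def profit_plus_eq_buy_profit profit_minus_eq_sell_profit)
qed

end

text \<open>Mean value theorem from 0, where the profit vanishes. The linear factor x must survive:
  it compensates the factor \<theta> when the average over the exponential law is rescaled. Absolute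
  values of A and c make the bound monotone in x.\<close>

lemma mean_profit_growth:
  assumes D: "\<And>x. 0 \<le> x \<Longrightarrow> (mean_profit xs ys \<gamma> \<delta> Q has_real_derivative D x) (at x within {0..})"
    and bound: "\<And>x. 0 \<le> x \<Longrightarrow> D x \<le> A * exp (c * x)"
  shows "\<exists>A\<ge>0. \<exists>c\<ge>0. \<forall>x\<ge>0. mean_profit xs ys \<gamma> \<delta> Q x \<le> A * x * exp (c * x)"
proof -
  have "mean_profit xs ys \<gamma> \<delta> Q x \<le> \<bar>A\<bar> * x * exp (\<bar>c\<bar> * x)" if x: "0 \<le> x" for x
  proof (cases "x = 0")
    case True
    then show ?thesis by (simp add: mean_profit_def profit_plus_def profit_minus_def)
  next
    case False
    with x have x: "0 < x" by simp
    have cont: "continuous_on {0..x} (mean_profit xs ys \<gamma> \<delta> Q)"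
      by (rule DERIV_continuous_on[where D=D]) (auto intro: DERIV_subset[OF D])
    have der: "(mean_profit xs ys \<gamma> \<delta> Q has_derivative (\<lambda>h. h * D u)) (at u)" if "0 < u" "u < x" for u
    proof -
      have "at u within {0..} = at u"
        by (rule at_within_interior) (use that in simp)
      with D[of u] that show ?thesis
        by (simp add: has_field_derivative_def mult_commute_abs)
    qed
    obtain u where u: "0 < u" "u < x"
      "mean_profit xs ys \<gamma> \<delta> Q x - mean_profit xs ys \<gamma> \<delta> Q 0 = (x - 0) * D u"
      by (rule mvt[OF x cont der])
    have "D u \<le> A * exp (c * u)" using bound u by simp
    also have "\<dots> \<le> \<bar>A\<bar> * exp (\<bar>c\<bar> * x)"
    proof (rule mult_mono)
      have "c * u \<le> \<bar>c\<bar> * u" using u by (intro mult_right_mono) auto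
      also have "\<dots> \<le> \<bar>c\<bar> * x" using u by (intro mult_left_mono) auto
      finally show "exp (c * u) \<le> exp (\<bar>c\<bar> * x)" by simp
    qed simp_all
    finally have "x * D u \<le> x * (\<bar>A\<bar> * exp (\<bar>c\<bar> * x))"
      using x by (intro mult_left_mono) auto
    with u(3) show ?thesis
      by (simp add: mean_profit_def profit_plus_def profit_minus_def algebra_simps)
  qed
  then show ?thesis
    by (meson abs_ge_zero)
qed

section \<open>Exponential bounds on reserves and profit, uniform in the price\<close>

context pool
begin

text \<open>At price 1, twice the mean profit at v - (\<gamma> + \<delta>) equals
  \<open>xs (exp (- v)) + ys (exp v)\<close> plus nonnegative reserves minus a constant. So a bound
  on the profit bounds the two reserves in the directions in which they grow.\<close>

lemma reserves_growth:
  assumes "0 \<le> A" "0 \<le> c" "\<forall>x\<ge>0. mean_profit xs ys \<gamma> \<delta> 1 x \<le> A * x * exp (c * x)" "0 \<le> \<gamma>" "0 \<le> \<delta>"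
  shows "\<exists>K\<ge>0. \<exists>k\<ge>0. \<forall>u. xs (exp u) + ys (exp u) \<le> K * exp (k * \<bar>u\<bar>)"
proof -
  let ?g = "\<gamma> + \<delta>"
  have lin: "x \<le> exp x" for x :: real
    using exp_ge_add_one_self[of x] by linarith
  have mp: "mean_profit xs ys \<gamma> \<delta> 1 x \<le> A * exp ((c + 1) * x)" if "0 \<le> x" for x
  proof -
    have "mean_profit xs ys \<gamma> \<delta> 1 x \<le> A * x * exp (c * x)" using assms that by simp
    also have "\<dots> \<le> A * exp x * exp (c * x)"
      using assms that lin[of x] by (intro mult_right_mono mult_left_mono) auto
    finally show ?thesis by (simp add: algebra_simps exp_add)
  qed
  \<comment> \<open>The reference terms at the two thresholds, which do not depend on v.\<close>
  define D where "D = xs (exp (- ?g)) + exp \<gamma> * ys (exp (- ?g)) + exp \<gamma> * xs (exp ?g) + ys (exp ?g)"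
  have nn [simp]: "0 \<le> xs (exp t)" "0 \<le> ys (exp t)" for t
    using reserves_nonneg by auto
  have D: "0 \<le> D"
    unfolding D_def by (intro add_nonneg_nonneg mult_nonneg_nonneg) auto
  have bound: "xs (exp u) + ys (exp u) \<le> (D + 2 * A) * exp ((c + 1) * \<bar>u\<bar>)" for u
  proof -
    \<comment> \<open>The mean profit sees only arguments beyond the threshold; monotonicity of the
      reserves allows |u| to be enlarged to such a v.\<close>
    define v where "v = max \<bar>u\<bar> ?g"
    have v: "\<bar>u\<bar> \<le> v" "?g \<le> v" "v - ?g \<le> \<bar>u\<bar>" using assms by (auto simp: v_def)
    have "xs (exp u) + ys (exp u) \<le> xs (exp (- v)) + ys (exp v)"
      using v by (intro add_mono xs_antimono ys_mono) auto
    also have "\<dots> \<le> D + 2 * mean_profit xs ys \<gamma> \<delta> 1 (v - ?g)"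
    proof -
      have "2 * mean_profit xs ys \<gamma> \<delta> 1 (v - ?g) = buy_profit xs ys \<gamma> ?g 1 v + sell_profit xs ys \<gamma> ?g 1 (- v)"
        using v by (simp add: mean_profit_def profit_plus_eq_buy_profit profit_minus_eq_sell_profit max_def min_def)
      also have "\<dots> = xs (exp (- v)) + ys (exp v) + (exp \<gamma> * ys (exp (- v)) + exp \<gamma> * xs (exp v)) - D"
        by (simp add: buy_profit_def sell_profit_def D_def algebra_simps)
      finally show ?thesis by (simp add: add_nonneg_nonneg)
    qed
    also have "\<dots> \<le> D * exp ((c + 1) * \<bar>u\<bar>) + 2 * (A * exp ((c + 1) * \<bar>u\<bar>))"
    proof (rule add_mono)
      have "D * 1 \<le> D * exp ((c + 1) * \<bar>u\<bar>)" using D assms by (intro mult_left_mono) auto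
      then show "D \<le> D * exp ((c + 1) * \<bar>u\<bar>)" by simp
      have "(c + 1) * (v - ?g) \<le> (c + 1) * \<bar>u\<bar>" using v assms by (intro mult_left_mono) auto
      then have "A * exp ((c + 1) * (v - ?g)) \<le> A * exp ((c + 1) * \<bar>u\<bar>)" using assms by (intro mult_left_mono) auto
      then show "2 * mean_profit xs ys \<gamma> \<delta> 1 (v - ?g) \<le> 2 * (A * exp ((c + 1) * \<bar>u\<bar>))"
        using mp[of "v - ?g"] v by simp
    qed
    finally show ?thesis by (simp add: algebra_simps)
  qed
  show ?thesis
  proof (intro exI conjI allI)
    show "0 \<le> D + 2 * A" "0 \<le> c + 1" using D assms by auto
  qed (rule bound)
qed

text \<open>The reference terms enter with a negative sign and are dropped, leaving the reserves at
  the price Q exp(-z), whose logarithm is ln P + w - z. The extra 1 in the exponent pays for the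
  explicit factor Q = P exp w.\<close>

lemma profit_growth:
  assumes K: "0 \<le> K" "0 \<le> k" "\<forall>u. xs (exp u) + ys (exp u) \<le> K * exp (k * \<bar>u\<bar>)"
    and P: "0 < P"
  shows "\<exists>C\<ge>0. \<exists>k\<ge>0. \<forall>w z. profit xs ys \<gamma> \<delta> (P * exp w) z \<le> C * exp (k * (\<bar>w\<bar> + \<bar>z\<bar>))"
proof -
  define C where "C = (P + 1) * (2 + 2 * exp \<gamma>) * (K * exp (k * \<bar>ln P\<bar>))"
  have "profit xs ys \<gamma> \<delta> (P * exp w) z \<le> C * exp ((k + 1) * (\<bar>w\<bar> + \<bar>z\<bar>))" for w z
  proof -
    let ?Q = "P * exp w" and ?q = "P * exp w * exp (- z)"
    have nn: "0 \<le> xs p" "0 \<le> ys p" if "0 \<le> p" for p using reserves_nonneg[OF that] .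
    define E where "E = xs ?q + ys ?q"
    have E0: "0 \<le> E" "xs ?q \<le> E" "ys ?q \<le> E"
      unfolding E_def using nn P by auto
    have q: "?q = exp (ln P + w - z)"
      using P by (simp add: exp_add exp_diff exp_minus field_simps)
    have E: "E \<le> (K * exp (k * \<bar>ln P\<bar>)) * exp (k * (\<bar>w\<bar> + \<bar>z\<bar>))"
    proof -
      have "E \<le> K * exp (k * \<bar>ln P + w - z\<bar>)" unfolding E_def q using K by simp
      also have "\<dots> \<le> K * exp (k * (\<bar>ln P\<bar> + (\<bar>w\<bar> + \<bar>z\<bar>)))"
        using K by (intro mult_left_mono) (auto intro!: mult_left_mono)
      finally show ?thesis by (simp add: algebra_simps exp_add)
    qed
    have plus: "profit_plus xs ys \<gamma> \<delta> ?Q z \<le> ?Q * xs ?q + exp \<gamma> * ys ?q"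
    proof -
      have "0 \<le> ?Q * xs (?Q * exp (- (\<gamma> + \<delta>))) + exp \<gamma> * ys (?Q * exp (- (\<gamma> + \<delta>)))"
        using P by (intro add_nonneg_nonneg mult_nonneg_nonneg nn) auto
      moreover have "0 \<le> ?Q * xs ?q + exp \<gamma> * ys ?q"
        using P by (intro add_nonneg_nonneg mult_nonneg_nonneg nn) auto
      ultimately show ?thesis
        unfolding profit_plus_eq_buy_profit buy_profit_def max_def by (simp add: algebra_simps)
    qed
    have minus: "profit_minus xs ys \<gamma> \<delta> ?Q z \<le> exp \<gamma> * ?Q * xs ?q + ys ?q"
    proof -
      have "0 \<le> exp \<gamma> * ?Q * xs (?Q * exp (\<gamma> + \<delta>)) + ys (?Q * exp (\<gamma> + \<delta>))"
        using P by (intro add_nonneg_nonneg mult_nonneg_nonneg nn) auto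
      moreover have "0 \<le> exp \<gamma> * ?Q * xs ?q + ys ?q"
        using P by (intro add_nonneg_nonneg mult_nonneg_nonneg nn) auto
      ultimately show ?thesis
        unfolding profit_minus_eq_sell_profit sell_profit_def min_def by (simp add: algebra_simps)
    qed
    have "profit xs ys \<gamma> \<delta> ?Q z \<le> (?Q * xs ?q + exp \<gamma> * ys ?q) + (exp \<gamma> * ?Q * xs ?q + ys ?q)"
      using plus minus by (simp add: profit_def)
    also have "\<dots> = ?Q * ((1 + exp \<gamma>) * xs ?q) + (1 + exp \<gamma>) * ys ?q"
      by (simp add: algebra_simps)
    also have "\<dots> \<le> ?Q * ((1 + exp \<gamma>) * E) + (1 + exp \<gamma>) * E"
      using E0 P by (intro add_mono mult_left_mono) (auto simp: add_nonneg_nonneg)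
    also have "\<dots> = (?Q + 1) * ((1 + exp \<gamma>) * E)"
      by (simp add: algebra_simps)
    also have "\<dots> \<le> ((P + 1) * exp (\<bar>w\<bar> + \<bar>z\<bar>)) * ((2 + 2 * exp \<gamma>) * ((K * exp (k * \<bar>ln P\<bar>)) * exp (k * (\<bar>w\<bar> + \<bar>z\<bar>))))"
    proof (rule mult_mono)
      have "P * exp w \<le> P * exp (\<bar>w\<bar> + \<bar>z\<bar>)" using P by (intro mult_left_mono) auto
      moreover have "1 \<le> exp (\<bar>w\<bar> + \<bar>z\<bar>)" by simp
      ultimately show "?Q + 1 \<le> (P + 1) * exp (\<bar>w\<bar> + \<bar>z\<bar>)" unfolding distrib_right mult_1 by linarith
      show "(1 + exp \<gamma>) * E \<le> (2 + 2 * exp \<gamma>) * ((K * exp (k * \<bar>ln P\<bar>)) * exp (k * (\<bar>w\<bar> + \<bar>z\<bar>)))"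
        using E E0 by (intro mult_mono) (auto simp: add_nonneg_nonneg)
    qed (use E0 P in \<open>auto simp: add_nonneg_nonneg\<close>)
    also have "\<dots> = C * exp ((k + 1) * (\<bar>w\<bar> + \<bar>z\<bar>))"
      by (simp add: C_def algebra_simps exp_add)
    finally show ?thesis .
  qed
  moreover have "0 \<le> C" using K P by (simp add: C_def)
  moreover have "0 \<le> k + 1" using K by simp
  ultimately show ?thesis
    by blast
qed

end

section \<open>Arrival times and paths\<close>

lemma arrival_count_eqI:
  assumes "strict_mono r" "r k \<le> t" "t < r (Suc k)"
  shows "arrival_count r t = k"
proof -
  have "i \<le> k \<longleftrightarrow> r i \<le> t" for i
  proof
    assume "i \<le> k"
    then have "r i \<le> r k" using assms(1) by (simp add: strict_mono_less_eq)
    with assms(2) show "r i \<le> t" by simp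
  next
    assume "r i \<le> t"
    with assms(3) have "r i < r (Suc k)" by simp
    then show "i \<le> k" using assms(1) by (simp add: strict_mono_less)
  qed
  then have "{i. 1 \<le> i \<and> r i \<le> t} = {i. 1 \<le> i \<and> i \<le> k}" by blast
  also have "\<dots> = {1..k}" by auto
  finally show ?thesis unfolding arrival_count_def by simp
qed

lemma arrival_count_bounds:
  assumes "strict_mono r" "filterlim r at_top sequentially" "r 0 = 0" "0 \<le> t"
  shows "r (arrival_count r t) \<le> t" "t < r (Suc (arrival_count r t))"
proof -
  have "\<exists>n. t < r n"
    using assms(2) eventually_happens'[OF sequentially_bot, of "\<lambda>n. t < r n"]
    by (auto simp: filterlim_at_top_dense)
  then obtain n where "t < r n" ..
  then obtain k where "\<forall>i\<le>k. \<not> t < r i" "t < r (Suc k)"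
    using ex_least_nat_less[of "\<lambda>i. t < r i" n] assms(3,4) by auto
  then have "r k \<le> t" "t < r (Suc k)" by auto
  with arrival_count_eqI[OF assms(1) this]
  show "r (arrival_count r t) \<le> t" "t < r (Suc (arrival_count r t))" by auto
qed

lemma arrival_count_eq_iff:
  assumes "strict_mono r" "filterlim r at_top sequentially" "r 0 = 0" "0 \<le> t"
  shows "arrival_count r t = k \<longleftrightarrow> r k \<le> t \<and> t < r (Suc k)"
  using arrival_count_bounds[OF assms] arrival_count_eqI[OF assms(1)] by blast

lemma le_arrival_count_iff:
  assumes "strict_mono r" "filterlim r at_top sequentially" "r 0 = 0" "0 \<le> t"
  shows "i \<le> arrival_count r t \<longleftrightarrow> r i \<le> t"
proof
  assume "i \<le> arrival_count r t"
  then have "r i \<le> r (arrival_count r t)" using assms(1) by (simp add: strict_mono_less_eq)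
  with arrival_count_bounds[OF assms] show "r i \<le> t" by simp
next
  assume "r i \<le> t"
  with arrival_count_bounds[OF assms] have "r i < r (Suc (arrival_count r t))" by simp
  then show "i \<le> arrival_count r t" using assms(1) by (simp add: strict_mono_less)
qed

text \<open>The index counts the arrivals that have already occurred: index i belongs to the arrival
  \<open>Suc i\<close>, so sums over arrivals start at 0.\<close>

definition pre_arrival ::
    "real \<Rightarrow> real \<Rightarrow> real \<Rightarrow> (real \<Rightarrow> real) \<Rightarrow> (nat \<Rightarrow> real) \<Rightarrow> real \<Rightarrow> nat \<Rightarrow> real" where
  "pre_arrival \<sigma> \<gamma> \<delta> b r z i = post_arrival \<sigma> \<gamma> \<delta> b r z i + \<sigma> * (b (r (Suc i)) - b (r i))"

text \<open>Strictly between two consecutive arrivals the count is constant, so the mispricing is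
  there a shift of the continuous driving path.\<close>

lemma Lim_at_left_mispricing:
  assumes "strict_mono r" "r 0 = 0" "continuous_on {0..} b"
  shows "Lim (at_left (r (Suc i))) (mispricing \<sigma> \<gamma> \<delta> b r z) = pre_arrival \<sigma> \<gamma> \<delta> b r z i"
proof (rule tendsto_Lim)
  have lt: "r i < r (Suc i)" using assms(1) by (simp add: strict_mono_less)
  have "r 0 \<le> r i" using assms(1) by (simp add: strict_mono_less_eq)
  with lt assms(2) have pos: "0 < r (Suc i)" by simp
  have "\<forall>\<^sub>F s in at_left (r (Suc i)). s \<in> {r i<..<r (Suc i)}"
    by (rule eventually_at_leftI[OF _ lt]) simp
  then have eq: "\<forall>\<^sub>F s in at_left (r (Suc i)). post_arrival \<sigma> \<gamma> \<delta> b r z i + \<sigma> * (b s - b (r i)) = mispricing \<sigma> \<gamma> \<delta> b r z s"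
  proof eventually_elim
    case (elim s)
    then have "arrival_count r s = i" using assms(1) by (intro arrival_count_eqI) auto
    then show ?case by (simp add: mispricing_def)
  qed
  have "isCont b (r (Suc i))"
    using assms(3) pos by (intro continuous_on_interior[of "{0..}"]) auto
  then have "(b \<longlongrightarrow> b (r (Suc i))) (at_left (r (Suc i)))"
    by (simp add: isCont_def filterlim_at_split)
  then have "((\<lambda>s. post_arrival \<sigma> \<gamma> \<delta> b r z i + \<sigma> * (b s - b (r i))) \<longlongrightarrow> pre_arrival \<sigma> \<gamma> \<delta> b r z i) (at_left (r (Suc i)))"
    unfolding pre_arrival_def by (intro tendsto_intros)
  then show "(mispricing \<sigma> \<gamma> \<delta> b r z \<longlongrightarrow> pre_arrival \<sigma> \<gamma> \<delta> b r z i) (at_left (r (Suc i)))"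
    using eq by (rule Lim_transform_eventually)
qed (simp add: trivial_limit_at_left_real)

lemma abs_reset_le: "0 \<le> \<gamma> \<Longrightarrow> 0 \<le> \<delta> \<Longrightarrow> \<bar>reset \<gamma> \<delta> z\<bar> \<le> \<bar>z\<bar>"
  by (auto simp: reset_def)

text \<open>A reset never increases the modulus, so the state is controlled by the sum of absolute
  increments between arrivals, whose exponential factorises over independent increments.\<close>

lemma abs_post_arrival_le:
  assumes "0 \<le> \<gamma>" "0 \<le> \<delta>" "0 \<le> \<sigma>"
  shows "\<bar>post_arrival \<sigma> \<gamma> \<delta> b r z n\<bar> \<le> \<bar>z\<bar> + \<sigma> * (\<Sum>j<n. \<bar>b (r (Suc j)) - b (r j)\<bar>)"
proof (induction n)
  case (Suc n)
  have "\<bar>post_arrival \<sigma> \<gamma> \<delta> b r z (Suc n)\<bar> \<le> \<bar>post_arrival \<sigma> \<gamma> \<delta> b r z n + \<sigma> * (b (r (Suc n)) - b (r n))\<bar>"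
    using assms by (simp add: abs_reset_le)
  also have "\<dots> \<le> \<bar>post_arrival \<sigma> \<gamma> \<delta> b r z n\<bar> + \<sigma> * \<bar>b (r (Suc n)) - b (r n)\<bar>"
    using assms abs_triangle_ineq[of "post_arrival \<sigma> \<gamma> \<delta> b r z n" "\<sigma> * (b (r (Suc n)) - b (r n))"]
    by (simp add: abs_mult)
  also have "\<dots> \<le> \<bar>z\<bar> + \<sigma> * (\<Sum>j<Suc n. \<bar>b (r (Suc j)) - b (r j)\<bar>)"
    using Suc by (simp add: algebra_simps)
  finally show ?case .
qed simp

lemma abs_pre_arrival_le:
  assumes "0 \<le> \<gamma>" "0 \<le> \<delta>" "0 \<le> \<sigma>"
  shows "\<bar>pre_arrival \<sigma> \<gamma> \<delta> b r z n\<bar> \<le> \<bar>z\<bar> + \<sigma> * (\<Sum>j<Suc n. \<bar>b (r (Suc j)) - b (r j)\<bar>)"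
proof -
  have "\<bar>pre_arrival \<sigma> \<gamma> \<delta> b r z n\<bar> \<le> \<bar>post_arrival \<sigma> \<gamma> \<delta> b r z n\<bar> + \<sigma> * \<bar>b (r (Suc n)) - b (r n)\<bar>"
    using assms abs_triangle_ineq[of "post_arrival \<sigma> \<gamma> \<delta> b r z n" "\<sigma> * (b (r (Suc n)) - b (r n))"]
    by (simp add: abs_mult pre_arrival_def)
  with abs_post_arrival_le[OF assms, of b r z n] show ?thesis
    by (simp add: algebra_simps)
qed

section \<open>Integration over independent sources\<close>

text \<open>Independence of two sub-sigma-algebras is recast as independence of the identity map,
  read as a random variable into each of the two coarser spaces. Product measures thereby become
  applicable.\<close>

lemma (in prob_space) indep_var_sources:
  assumes N: "space N1 = space M" "space N2 = space M" "indep_set (sets N1) (sets N2)"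
  shows "indep_var N1 (\<lambda>w. w) N2 (\<lambda>w. w)"
proof -
  have vim: "(\<lambda>w. w) -` A \<inter> space M = A" if "A \<in> sets N" "space N = space M" for A and N :: "'a measure"
    using sets.sets_into_space[OF that(1)] that(2) by auto
  have "(\<lambda>w. w) \<in> M \<rightarrow>\<^sub>M N1" "(\<lambda>w. w) \<in> M \<rightarrow>\<^sub>M N2"
    using N(1,2) indep_setD_ev1[OF N(3)] indep_setD_ev2[OF N(3)]
    by (auto intro!: measurableI simp: vim)
  moreover have "sigma_sets (space M) {(\<lambda>w. w) -` A \<inter> space M |A. A \<in> sets N} = sets N"
    if "space N = space M" for N :: "'a measure"
  proof -
    have "{(\<lambda>w. w) -` A \<inter> space M |A. A \<in> sets N} = (\<lambda>A. (\<lambda>w. w) -` A \<inter> space M) ` sets N"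
      by auto
    also have "\<dots> = sets N"
      using vim[OF _ that] by (simp cong: image_cong)
    finally show ?thesis using that sets.sigma_sets_eq[of N] by simp
  qed
  ultimately show ?thesis
    using N by (simp add: indep_var_eq)
qed

text \<open>Decoupling: the joint law of the two copies of the sample point is a product measure, so
  one source can be frozen while the other is integrated.\<close>

lemma (in prob_space) nn_integral_indep_sources:
  assumes N: "space N1 = space M" "space N2 = space M" "indep_set (sets N1) (sets N2)"
    and [measurable]: "(\<lambda>(x, y). H x y) \<in> borel_measurable (N1 \<Otimes>\<^sub>M N2)"
  shows "(\<integral>\<^sup>+w. H w w \<partial>M) = (\<integral>\<^sup>+y. (\<integral>\<^sup>+x. H x y \<partial>M) \<partial>M)"
proof -
  note indep = indep_var_sources[OF N(1-3)]
  have [measurable]: "(\<lambda>w. w) \<in> M \<rightarrow>\<^sub>M N1" "(\<lambda>w. w) \<in> M \<rightarrow>\<^sub>M N2"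
    using indep by (auto dest: indep_var_rv1 indep_var_rv2)
  have eq: "distr M N1 (\<lambda>w. w) \<Otimes>\<^sub>M distr M N2 (\<lambda>w. w) = distr M (N1 \<Otimes>\<^sub>M N2) (\<lambda>w. (w, w))"
    using indep by (simp add: indep_var_distribution_eq)
  interpret D1: prob_space "distr M N1 (\<lambda>w. w)" by (rule prob_space_distr) measurable
  interpret D2: prob_space "distr M N2 (\<lambda>w. w)" by (rule prob_space_distr) measurable
  interpret D: pair_sigma_finite "distr M N1 (\<lambda>w. w)" "distr M N2 (\<lambda>w. w)" ..
  have "(\<integral>\<^sup>+w. H w w \<partial>M) = (\<integral>\<^sup>+p. (case p of (x, y) \<Rightarrow> H x y) \<partial>distr M (N1 \<Otimes>\<^sub>M N2) (\<lambda>w. (w, w)))"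
    by (subst nn_integral_distr) auto
  also have "\<dots> = (\<integral>\<^sup>+y. (\<integral>\<^sup>+x. H x y \<partial>distr M N1 (\<lambda>w. w)) \<partial>distr M N2 (\<lambda>w. w))"
    unfolding eq[symmetric] by (subst D.nn_integral_snd[symmetric]) auto
  also have "\<dots> = (\<integral>\<^sup>+y. (\<integral>\<^sup>+x. H x y \<partial>distr M N1 (\<lambda>w. w)) \<partial>M)"
    by (subst nn_integral_distr) auto
  also have "\<dots> = (\<integral>\<^sup>+y. (\<integral>\<^sup>+x. H x y \<partial>M) \<partial>M)"
    by (intro nn_integral_cong, subst nn_integral_distr)
       (use N in \<open>auto intro!: measurable_compose[OF measurable_Pair1']\<close>)
  finally show ?thesis .
qed

lemma (in prob_space) indep_set_commute: "indep_set A A' \<Longrightarrow> indep_set A' A"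
  by (simp add: indep_sets2_eq) (metis Int_commute mult.commute)

section \<open>Measurability of the state and decoupling of path, arrivals and starting
  point\<close>

locale mispricing_setting = mispricing_model M B rate \<tau> \<sigma> \<gamma> \<delta> \<pi> z0
  for M :: "'a measure" and B :: "real \<Rightarrow> 'a \<Rightarrow> real" and rate :: real and \<tau> :: "nat \<Rightarrow> 'a \<Rightarrow> real"
    and \<sigma> \<gamma> \<delta> :: real and \<pi> :: "real measure" and z0 :: "'a \<Rightarrow> real" +
  assumes rate_pos: "0 < rate" and \<sigma>_pos: "0 < \<sigma>" and \<gamma>_pos: "0 < \<gamma>" and \<delta>_nonneg: "0 \<le> \<delta>"
begin

abbreviation clip :: "real \<Rightarrow> real" where
  "clip \<equiv> reset \<gamma> \<delta>"

definition path_algebra :: "'a measure" where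
  "path_algebra = vimage_algebra (space M) (\<lambda>w. \<lambda>t\<in>{0..}. B t w) (PiM {0..} (\<lambda>_. borel))"

definition arrival_algebra :: "'a measure" where
  "arrival_algebra = vimage_algebra (space M) (\<lambda>w i. \<tau> i w) (PiM UNIV (\<lambda>_. borel))"

definition driver_algebra :: "'a measure" where
  "driver_algebra = vimage_algebra (space M) (\<lambda>w. (\<lambda>t\<in>{0..}. B t w, \<lambda>i. \<tau> i w))
     (PiM {0..} (\<lambda>_. borel) \<Otimes>\<^sub>M PiM UNIV (\<lambda>_. borel))"

lemma space_algebras [simp]:
  "space path_algebra = space M" "space arrival_algebra = space M" "space driver_algebra = space M"
  by (simp_all add: path_algebra_def arrival_algebra_def driver_algebra_def)

lemma measurable_B_path: "0 \<le> t \<Longrightarrow> B t \<in> borel_measurable path_algebra"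
proof -
  assume t: "0 \<le> t"
  have "(\<lambda>w. \<lambda>t\<in>{0..}. B t w) \<in> path_algebra \<rightarrow>\<^sub>M PiM {0..} (\<lambda>_. borel)"
    unfolding path_algebra_def by (rule measurable_vimage_algebra1) (auto simp: space_PiM)
  from measurable_compose[OF this measurable_component_singleton[of t "{0..}" "\<lambda>_. borel"]] t
  show ?thesis by simp
qed

lemma measurable_\<tau>_arrival: "\<tau> i \<in> borel_measurable arrival_algebra"
proof -
  have "(\<lambda>w i. \<tau> i w) \<in> arrival_algebra \<rightarrow>\<^sub>M PiM UNIV (\<lambda>_. borel)"
    unfolding arrival_algebra_def by (rule measurable_vimage_algebra1) (auto simp: space_PiM)
  from measurable_compose[OF this measurable_component_singleton[of i UNIV "\<lambda>_. borel"]]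
  show ?thesis by simp
qed

lemma measurable_id_driver [measurable]: "(\<lambda>w. w) \<in> M \<rightarrow>\<^sub>M driver_algebra"
  unfolding driver_algebra_def
  by (rule measurable_vimage_algebra2)
     (auto intro!: measurable_PiM_single' measurable_Pair measurable_restrict B_measurable \<tau>_measurable)

lemma measurable_driver_sources [measurable]:
  "(\<lambda>w. w) \<in> driver_algebra \<rightarrow>\<^sub>M path_algebra" "(\<lambda>w. w) \<in> driver_algebra \<rightarrow>\<^sub>M arrival_algebra"
proof -
  have *: "(\<lambda>w. (\<lambda>t\<in>{0..}. B t w, \<lambda>i. \<tau> i w)) \<in> driver_algebra \<rightarrow>\<^sub>M (PiM {0..} (\<lambda>_. borel) \<Otimes>\<^sub>M PiM UNIV (\<lambda>_. borel))"
    unfolding driver_algebra_def by (rule measurable_vimage_algebra1) (auto simp: space_PiM space_pair_measure)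
  show "(\<lambda>w. w) \<in> driver_algebra \<rightarrow>\<^sub>M path_algebra" unfolding path_algebra_def
    by (rule measurable_vimage_algebra2) (use measurable_compose[OF * measurable_fst] in auto)
  show "(\<lambda>w. w) \<in> driver_algebra \<rightarrow>\<^sub>M arrival_algebra" unfolding arrival_algebra_def
    by (rule measurable_vimage_algebra2) (use measurable_compose[OF * measurable_snd] in auto)
qed

lemma \<tau>_nonneg: "w \<in> space M \<Longrightarrow> 0 \<le> \<tau> i w"
  using strict_mono_less_eq[OF \<tau>_strict_mono, of w 0 i] \<tau>_0[of w] by simp

lemma \<tau>_less_Suc: "w \<in> space M \<Longrightarrow> \<tau> i w < \<tau> (Suc i) w"
  using strict_mono_less[OF \<tau>_strict_mono, of w i "Suc i"] by simp

lemma measurable_\<tau>_compose [measurable (raw)]: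
  "g \<in> N \<rightarrow>\<^sub>M arrival_algebra \<Longrightarrow> (\<lambda>n. \<tau> i (g n)) \<in> borel_measurable N"
  by (rule measurable_compose[OF _ measurable_\<tau>_arrival])

text \<open>Evaluating the path at a random time is a limit of evaluations at multiples of \<open>1 / Suc k\<close>.\<close>

lemma measurable_B_random_time:
  assumes g [measurable]: "g \<in> borel_measurable N" and pos: "\<And>n. n \<in> space N \<Longrightarrow> 0 \<le> g n"
    and h: "h \<in> N \<rightarrow>\<^sub>M path_algebra"
  shows "(\<lambda>n. B (g n) (h n)) \<in> borel_measurable N"
proof (rule borel_measurable_LIMSEQ_real)
  let ?t = "\<lambda>k n. real (nat \<lfloor>g n * Suc k\<rfloor>) / Suc k"
  show "(\<lambda>n. B (?t k n) (h n)) \<in> borel_measurable N" for k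
    by (rule measurable_compose_countable[where f="\<lambda>j n. B (real j / Suc k) (h n)"])
       (auto intro!: measurable_compose[OF h measurable_B_path])
  show "(\<lambda>k. B (?t k n) (h n)) \<longlonglongrightarrow> B (g n) (h n)" if n: "n \<in> space N" for n
  proof (rule continuous_on_tendsto_compose[OF B_continuous])
    show "h n \<in> space M" using measurable_space[OF h n] by simp
    show "(\<lambda>k. ?t k n) \<longlonglongrightarrow> g n"
    proof (rule real_tendsto_sandwich)
      have fl: "real (nat \<lfloor>g n * Suc k\<rfloor>) = of_int \<lfloor>g n * Suc k\<rfloor>" for k
        using pos[OF n] by (simp add: floor_mono)
      have lo: "g n - inverse (Suc k) \<le> ?t k n" and hi: "?t k n \<le> g n" for k
      proof -
        have fl': "?t k n = of_int \<lfloor>g n * Suc k\<rfloor> / Suc k" unfolding fl ..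
        show "g n - inverse (Suc k) \<le> ?t k n"
          unfolding fl' using floor_correct[of "g n * Suc k"]
          by (simp add: pos_le_divide_eq left_diff_distrib del: of_nat_Suc)
        show "?t k n \<le> g n"
          unfolding fl' by (simp add: pos_divide_le_eq del: of_nat_Suc)
      qed
      show "\<forall>\<^sub>F k in sequentially. g n - inverse (Suc k) \<le> ?t k n" using lo by auto
      show "\<forall>\<^sub>F k in sequentially. ?t k n \<le> g n" using hi by auto
      show "(\<lambda>k. g n - inverse (Suc k)) \<longlonglongrightarrow> g n"
        using tendsto_diff[OF tendsto_const LIMSEQ_inverse_real_of_nat, of "g n"] by simp
    qed auto
  qed (use pos[OF n] in auto)
qed

lemma measurable_B_compose [measurable (raw)]:
  "h \<in> N \<rightarrow>\<^sub>M path_algebra \<Longrightarrow> 0 \<le> t \<Longrightarrow> (\<lambda>n. B t (h n)) \<in> borel_measurable N"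
  by (rule measurable_compose[OF _ measurable_B_path])

lemma measurable_B_\<tau>_compose [measurable (raw)]:
  assumes g: "g \<in> N \<rightarrow>\<^sub>M arrival_algebra" and h: "h \<in> N \<rightarrow>\<^sub>M path_algebra"
  shows "(\<lambda>n. B (\<tau> i (g n)) (h n)) \<in> borel_measurable N"
  using measurable_space[OF g] by (intro measurable_B_random_time h measurable_\<tau>_compose g \<tau>_nonneg) auto

lemma measurable_reset [measurable]: "clip \<in> borel_measurable borel"
  unfolding reset_def[abs_def] by measurable

lemma measurable_post_arrival [measurable (raw)]:
  assumes [measurable]: "x \<in> borel_measurable N" "g \<in> N \<rightarrow>\<^sub>M arrival_algebra" "h \<in> N \<rightarrow>\<^sub>M path_algebra"
  shows "(\<lambda>n. post_arrival \<sigma> \<gamma> \<delta> (\<lambda>s. B s (h n)) (\<lambda>i. \<tau> i (g n)) (x n) k) \<in> borel_measurable N"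
  by (induction k) simp_all

lemma measurable_pre_arrival [measurable (raw)]:
  assumes [measurable]: "x \<in> borel_measurable N" "g \<in> N \<rightarrow>\<^sub>M arrival_algebra" "h \<in> N \<rightarrow>\<^sub>M path_algebra"
  shows "(\<lambda>n. pre_arrival \<sigma> \<gamma> \<delta> (\<lambda>s. B s (h n)) (\<lambda>i. \<tau> i (g n)) (x n) k) \<in> borel_measurable N"
  unfolding pre_arrival_def by measurable

lemma arrival_count_\<tau>_eq_iff:
  "w \<in> space M \<Longrightarrow> 0 \<le> t \<Longrightarrow> arrival_count (\<lambda>i. \<tau> i w) t = k \<longleftrightarrow> \<tau> k w \<le> t \<and> t < \<tau> (Suc k) w"
  by (rule arrival_count_eq_iff) (auto simp: \<tau>_strict_mono \<tau>_at_top \<tau>_0)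

lemma le_arrival_count_\<tau>_iff:
  "w \<in> space M \<Longrightarrow> 0 \<le> t \<Longrightarrow> i \<le> arrival_count (\<lambda>i. \<tau> i w) t \<longleftrightarrow> \<tau> i w \<le> t"
  by (rule le_arrival_count_iff) (auto simp: \<tau>_strict_mono \<tau>_at_top \<tau>_0)

lemma measurable_arrival_count [measurable (raw)]:
  assumes [measurable]: "g \<in> N \<rightarrow>\<^sub>M arrival_algebra" and t: "0 \<le> t"
  shows "(\<lambda>n. arrival_count (\<lambda>i. \<tau> i (g n)) t) \<in> N \<rightarrow>\<^sub>M count_space UNIV"
  unfolding measurable_count_space_eq2_countable
proof (intro conjI ballI)
  fix k
  have "(\<lambda>n. arrival_count (\<lambda>i. \<tau> i (g n)) t) -` {k} \<inter> space N
     = {n \<in> space N. arrival_count (\<lambda>i. \<tau> i (g n)) t = k}"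
    by auto
  also have "\<dots> = {n \<in> space N. \<tau> k (g n) \<le> t \<and> t < \<tau> (Suc k) (g n)}"
    using measurable_space[OF assms(1)] t arrival_count_\<tau>_eq_iff[of _ t k] by (intro Collect_cong) auto
  also have "\<dots> \<in> sets N" by measurable
  finally show "(\<lambda>n. arrival_count (\<lambda>i. \<tau> i (g n)) t) -` {k} \<inter> space N \<in> sets N" .
qed auto

lemma measurable_mispricing [measurable (raw)]:
  assumes [measurable]: "x \<in> borel_measurable N" "g \<in> N \<rightarrow>\<^sub>M arrival_algebra" "h \<in> N \<rightarrow>\<^sub>M path_algebra"
    and [simp]: "0 \<le> t"
  shows "(\<lambda>n. mispricing \<sigma> \<gamma> \<delta> (\<lambda>s. B s (h n)) (\<lambda>i. \<tau> i (g n)) (x n) t) \<in> borel_measurable N"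
  unfolding mispricing_def Let_def
  by (rule measurable_compose_countable[where f="\<lambda>k n. post_arrival \<sigma> \<gamma> \<delta> (\<lambda>s. B s (h n)) (\<lambda>i. \<tau> i (g n)) (x n) k
      + \<sigma> * (B t (h n) - B (\<tau> k (g n)) (h n))"]) measurable

lemma nn_integral_path_arrival:
  assumes "(\<lambda>(x, y). H x y) \<in> borel_measurable (path_algebra \<Otimes>\<^sub>M arrival_algebra)"
  shows "(\<integral>\<^sup>+w. H w w \<partial>M) = (\<integral>\<^sup>+y. (\<integral>\<^sup>+x. H x y \<partial>M) \<partial>M)"
  using B_indep_\<tau> assms
  by (intro nn_integral_indep_sources[of path_algebra arrival_algebra])
     (simp_all add: path_algebra_def arrival_algebra_def)

lemma measurable_z0 [measurable]: "z0 \<in> borel_measurable M"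
proof -
  have "z0 -` A \<inter> space M \<in> sets M" if "A \<in> sets borel" for A
    using in_vimage_algebra[OF that, of z0 "space M"] indep_setD_ev1[OF z0_indep] by auto
  then show ?thesis by (intro measurableI) auto
qed

lemma prob_space_\<pi>: "prob_space \<pi>" and sets_\<pi> [measurable_cong, simp]: "sets \<pi> = sets borel"
  using \<pi>_invariant by (auto simp: invariant_distribution_def)

lemma space_\<pi> [simp]: "space \<pi> = UNIV"
  using sets_eq_imp_space_eq[OF sets_\<pi>] by simp

lemma nn_integral_start_driver:
  assumes [measurable]: "(\<lambda>(x, y). H x y) \<in> borel_measurable (borel \<Otimes>\<^sub>M driver_algebra)"
  shows "(\<integral>\<^sup>+w. H (z0 w) w \<partial>M) = (\<integral>\<^sup>+x. (\<integral>\<^sup>+w. H x w \<partial>M) \<partial>\<pi>)"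
proof -
  let ?Z = "vimage_algebra (space M) z0 borel"
  have [measurable]: "z0 \<in> borel_measurable ?Z" by (rule measurable_vimage_algebra1) auto
  have "(\<lambda>(x, y). H (z0 y) x) \<in> borel_measurable (driver_algebra \<Otimes>\<^sub>M ?Z)" by measurable
  then have "(\<integral>\<^sup>+w. H (z0 w) w \<partial>M) = (\<integral>\<^sup>+y. (\<integral>\<^sup>+w. H (z0 y) w \<partial>M) \<partial>M)"
    using indep_set_commute[OF z0_indep]
    by (intro nn_integral_indep_sources[of driver_algebra ?Z]) (simp_all add: driver_algebra_def)
  also have "\<dots> = (\<integral>\<^sup>+x. (\<integral>\<^sup>+w. H x w \<partial>M) \<partial>distr M borel z0)"
    by (subst nn_integral_distr) measurable
  finally show ?thesis by (simp add: z0_distr)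
qed

end

section \<open>Exponential, Laplace and normal densities\<close>

lemma integrable_exponential_density:
  assumes "0 < \<theta>"
  shows "integrable lborel (exponential_density \<theta>)"
  by (rule integrableI_nonneg)
     (use nn_integral_erlang_ith_moment[OF assms, of 0 0] assms in \<open>auto simp: exponential_density_nonneg\<close>)

text \<open>The integrand is \<theta> exp(-s u) with the complex rate s = \<theta> - i \<xi>. Its
  real part is \<theta> > 0, so the explicit antiderivative vanishes at infinity.\<close>

lemma integral_exponential_density_iexp:
  fixes \<theta> \<xi> :: real
  assumes \<theta>: "0 < \<theta>"
  shows "(CLBINT u. exponential_density \<theta> u *\<^sub>R iexp (\<xi> * u)) = \<theta> / (\<theta> - \<i> * \<xi>)"
proof -
  let ?s = "\<theta> - \<i> * \<xi>"
  have s: "?s \<noteq> 0" using \<theta> by (auto simp: complex_eq_iff)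
  let ?f = "\<lambda>u :: real. \<theta> * exp (- ?s * u)"
  let ?F = "\<lambda>u :: real. - (\<theta> / ?s) * exp (- ?s * u)"
  have f: "exponential_density \<theta> u *\<^sub>R iexp (\<xi> * u) = ?f u" if "0 < u" for u
  proof -
    have *: "- ?s * of_real u = of_real (- u * \<theta>) + \<i> * of_real (\<xi> * u)"
      by (simp add: algebra_simps)
    show ?thesis
      unfolding * exp_add exp_of_real
      using that by (simp add: exponential_density_def scaleR_conv_of_real)
  qed
  have f': "exponential_density \<theta> u *\<^sub>R iexp (\<xi> * u) = indicator {0<..} u *\<^sub>R ?f u" if "u \<noteq> 0" for u
  proof (cases "0 < u")
    case True
    then show ?thesis using f[OF True] by simp
  qed (use that in \<open>simp add: exponential_density_def\<close>)
  have norm_exp: "norm (exp (- ?s * of_real u)) = exp (- \<theta> * u)" for u :: real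
    by (simp add: norm_exp_eq_Re)
  have "(CLBINT u. exponential_density \<theta> u *\<^sub>R iexp (\<xi> * u)) = (CLBINT u:{0<..}. ?f u)"
    unfolding set_lebesgue_integral_def
    by (rule integral_cong_AE, measurable, rule AE_mp[OF AE_lborel_singleton[of 0] AE_I2])
       (use f' in blast)
  also have "\<dots> = (CLBINT u=0..\<infinity>. ?f u)"
    by (simp add: interval_lebesgue_integral_0_infty)
  also have "\<dots> = 0 - ?F 0"
  proof (rule interval_integral_FTC_integrable)
    have "((\<lambda>u. exp (- ?s * of_real u)) has_vector_derivative - ?s * exp (- ?s * of_real u)) (at u)" for u :: real
      by (rule has_vector_derivative_real_field) (auto intro!: derivative_eq_intros)
    then show "(?F has_vector_derivative ?f u) (at u)" for u
      using s by (auto intro!: derivative_eq_intros simp: field_simps)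
    show "set_integrable lborel (einterval 0 \<infinity>) ?f"
    proof -
      have "einterval 0 \<infinity> = {0<..}" by (auto simp: einterval_def)
      moreover have "set_integrable lborel {0<..} ?f"
        unfolding set_integrable_def
        by (rule Bochner_Integration.integrable_bound[OF integrable_exponential_density[OF \<theta>]])
           (use \<theta> in \<open>auto simp: exponential_density_def norm_mult norm_exp algebra_simps split: split_indicator\<close>)
      ultimately show ?thesis by simp
    qed
    show "((?F \<circ> real_of_ereal) \<longlongrightarrow> ?F 0) (at_right 0)"
      unfolding zero_ereal_def ereal_tendsto_simps
      by (intro tendsto_eq_intros) (auto intro!: tendsto_eq_intros)
    have "((\<lambda>u. exp (- \<theta> * u)) \<longlongrightarrow> 0) at_top"
      using \<theta>
      by (intro filterlim_compose[OF exp_at_bot] filterlim_tendsto_neg_mult_at_bot[OF tendsto_const _ filterlim_ident]) simp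
    then have "((\<lambda>u. exp (- ?s * of_real u)) \<longlongrightarrow> 0) at_top"
      unfolding tendsto_norm_zero_iff[symmetric, of "\<lambda>u. exp (- ?s * of_real u)"] norm_exp .
    from tendsto_mult_left[OF this, of "- (\<theta> / ?s)"]
    show "((?F \<circ> real_of_ereal) \<longlongrightarrow> 0) (at_left \<infinity>)"
      unfolding ereal_tendsto_simps by simp
  qed (auto intro!: continuous_intros)
  finally show ?thesis by simp
qed

text \<open>Both halves contribute at the point 0, where the value is \<theta> instead of \<theta> /
  2; hence the closed form below is stated for positive arguments, and 0 is treated as a null
  set.\<close>

definition laplace_density :: "real \<Rightarrow> real \<Rightarrow> real" where
  "laplace_density \<theta> x = (exponential_density \<theta> x + exponential_density \<theta> (- x)) / 2"

lemma borel_measurable_laplace_density [measurable]: "laplace_density \<theta> \<in> borel_measurable borel"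
  unfolding laplace_density_def[abs_def] by measurable

lemma laplace_density_nonneg: "0 < \<theta> \<Longrightarrow> 0 \<le> laplace_density \<theta> x"
  by (simp add: laplace_density_def exponential_density_nonneg)

lemma laplace_density_eq: "0 < x \<Longrightarrow> laplace_density \<theta> x = \<theta> / 2 * exp (- \<theta> * x)"
  by (simp add: laplace_density_def exponential_density_def mult.commute)

lemma laplace_density_minus [simp]: "laplace_density \<theta> (- x) = laplace_density \<theta> x"
  by (simp add: laplace_density_def)

lemma nn_integral_laplace_density:
  assumes \<theta>: "0 < \<theta>" and [measurable]: "h \<in> borel_measurable borel"
  shows "(\<integral>\<^sup>+x. ennreal (laplace_density \<theta> x) * h x \<partial>lborel)
    = (\<integral>\<^sup>+u. ennreal (exponential_density \<theta> u) * ((h u + h (- u)) / 2) \<partial>lborel)"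
proof -
  have "(\<integral>\<^sup>+x. ennreal (laplace_density \<theta> x) * h x \<partial>lborel)
    = (\<integral>\<^sup>+x. ennreal (exponential_density \<theta> x) * (h x / 2)
        + ennreal (exponential_density \<theta> (- x)) * (h x / 2) \<partial>lborel)"
  proof (intro nn_integral_cong)
    fix x
    have "ennreal (laplace_density \<theta> x)
      = (ennreal (exponential_density \<theta> x) + ennreal (exponential_density \<theta> (- x))) * inverse 2"
      unfolding laplace_density_def
      using exponential_density_nonneg[OF \<theta>]
      by (simp add: divide_ennreal_def[symmetric] ennreal_plus[symmetric] del: ennreal_plus)
         (metis add_nonneg_nonneg divide_ennreal ennreal_numeral zero_less_numeral)
    then show "ennreal (laplace_density \<theta> x) * h x = ennreal (exponential_density \<theta> x) * (h x / 2)
        + ennreal (exponential_density \<theta> (- x)) * (h x / 2)"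
      by (simp add: divide_ennreal_def algebra_simps)
  qed
  also have "\<dots> = (\<integral>\<^sup>+x. ennreal (exponential_density \<theta> x) * (h x / 2) \<partial>lborel)
      + (\<integral>\<^sup>+x. ennreal (exponential_density \<theta> (- x)) * (h x / 2) \<partial>lborel)"
    by (rule nn_integral_add) measurable
  also have "(\<integral>\<^sup>+x. ennreal (exponential_density \<theta> (- x)) * (h x / 2) \<partial>lborel)
      = (\<integral>\<^sup>+x. ennreal (exponential_density \<theta> x) * (h (- x) / 2) \<partial>lborel)"
    by (subst nn_integral_real_affine[where c="-1" and t=0]) simp_all
  also have "(\<integral>\<^sup>+x. ennreal (exponential_density \<theta> x) * (h x / 2) \<partial>lborel) + \<dots>
      = (\<integral>\<^sup>+x. ennreal (exponential_density \<theta> x) * (h x / 2)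
        + ennreal (exponential_density \<theta> x) * (h (- x) / 2) \<partial>lborel)"
    by (rule nn_integral_add[symmetric]) measurable
  finally show ?thesis
    by (simp add: divide_ennreal_def algebra_simps)
qed

lemma prob_space_laplace: "0 < \<theta> \<Longrightarrow> prob_space (density lborel (laplace_density \<theta>))"
  using nn_integral_laplace_density[of \<theta> "\<lambda>_. 1"] nn_integral_erlang_ith_moment[of \<theta> 0 0]
  by (intro prob_spaceI) (simp add: emeasure_density)

text \<open>With \<theta>^2 = 2 l / \<sigma>^2 this is l / (l + \<xi>^2 \<sigma>^2 / 2), the factor
  that appears in the stationarity equation for \<open>\<pi>\<close>.\<close>

lemma char_laplace:
  assumes \<theta>: "0 < \<theta>"
  shows "char (density lborel (laplace_density \<theta>)) \<xi> = \<theta>\<^sup>2 / (\<theta>\<^sup>2 + \<xi>\<^sup>2)"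
proof -
  let ?e = "\<lambda>u. exponential_density \<theta> u *\<^sub>R iexp (\<xi> * u)"
  have int: "integrable lborel (\<lambda>u. exponential_density \<theta> u *\<^sub>R iexp (\<eta> * u))" for \<eta>
    by (rule Bochner_Integration.integrable_bound[OF integrable_exponential_density[OF \<theta>]]) auto
  have int': "integrable lborel (\<lambda>x. exponential_density \<theta> (- x) *\<^sub>R iexp (\<xi> * x))"
    using lborel_integrable_real_affine[OF int[of "- \<xi>"], of "-1" 0] by simp
  have "char (density lborel (laplace_density \<theta>)) \<xi> = (CLBINT x. laplace_density \<theta> x *\<^sub>R iexp (\<xi> * x))"
    unfolding char_def by (subst integral_density) (auto simp: laplace_density_nonneg \<theta>)
  also have "\<dots> = (CLBINT x. (?e x + exponential_density \<theta> (- x) *\<^sub>R iexp (\<xi> * x)) / 2)"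
    by (simp add: laplace_density_def scaleR_conv_of_real algebra_simps add_divide_distrib)
  also have "\<dots> = ((CLBINT x. ?e x) + (CLBINT x. exponential_density \<theta> (- x) *\<^sub>R iexp (\<xi> * x))) / 2"
    using int[of \<xi>] int' by simp
  also have "(CLBINT x. exponential_density \<theta> (- x) *\<^sub>R iexp (\<xi> * x))
      = (CLBINT x. exponential_density \<theta> x *\<^sub>R iexp ((- \<xi>) * x))"
    by (subst lborel_integral_real_affine[where c="-1" and t=0]) simp_all
  also have "((CLBINT x. ?e x) + \<dots>) / 2 = (\<theta> / (\<theta> - \<i> * \<xi>) + \<theta> / (\<theta> + \<i> * \<xi>)) / 2"
    unfolding integral_exponential_density_iexp[OF \<theta>] by simp
  also have "\<dots> = \<theta>\<^sup>2 / (\<theta>\<^sup>2 + \<xi>\<^sup>2)"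
  proof -
    have "\<theta> - \<i> * \<xi> \<noteq> 0" "\<theta> + \<i> * \<xi> \<noteq> 0" using \<theta> by (auto simp: complex_eq_iff)
    moreover have "(t / a + t / b) / 2 = t * (a + b) / 2 / (a * b)" if "a \<noteq> 0" "b \<noteq> 0" for t a b :: complex
      using that by (simp add: field_simps)
    ultimately have "(\<theta> / (\<theta> - \<i> * \<xi>) + \<theta> / (\<theta> + \<i> * \<xi>)) / 2
      = \<theta> * ((\<theta> - \<i> * \<xi>) + (\<theta> + \<i> * \<xi>)) / 2 / ((\<theta> - \<i> * \<xi>) * (\<theta> + \<i> * \<xi>))"
      by blast
    also have "(\<theta> - \<i> * \<xi>) * (\<theta> + \<i> * \<xi>) = \<theta>\<^sup>2 + \<xi>\<^sup>2"
      by (simp add: algebra_simps power2_eq_square)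
    also have "\<theta> * ((\<theta> - \<i> * \<xi>) + (\<theta> + \<i> * \<xi>)) / 2 = (complex_of_real \<theta>)\<^sup>2"
      by (simp add: power2_eq_square)
    finally show ?thesis by (simp only: of_real_divide of_real_power)
  qed
  finally show ?thesis .
qed

lemma nn_integral_laplace_square:
  assumes "0 < \<theta>"
  shows "(\<integral>\<^sup>+x. ennreal (laplace_density \<theta> x) * ennreal (x\<^sup>2) \<partial>lborel) = ennreal (2 / \<theta>\<^sup>2)"
proof -
  have e: "(ennreal r + ennreal r) / 2 = ennreal r" if "0 \<le> r" for r
    using that divide_ennreal[of "2 * r" 2] by (simp add: ennreal_plus[symmetric] del: ennreal_plus)
  show ?thesis
    using nn_integral_laplace_density[OF assms, of "\<lambda>x. ennreal (x\<^sup>2)"]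
      nn_integral_erlang_ith_moment[OF assms, of 0 2] assms
    by (simp add: e ennreal_mult''[symmetric] fact_numeral)
qed

lemma integral_laplace_id: "(\<integral>x. x \<partial>density lborel (laplace_density \<theta>)) = 0" if "0 < \<theta>"
proof -
  have eq: "(\<integral>x. x \<partial>density lborel (laplace_density \<theta>)) = (\<integral>x. laplace_density \<theta> x * x \<partial>lborel)"
    by (subst integral_density) (auto simp: laplace_density_nonneg that)
  have "(\<integral>x. laplace_density \<theta> x * x \<partial>lborel) = - (\<integral>x. laplace_density \<theta> x * x \<partial>lborel)"
    by (subst lborel_integral_real_affine[where c="-1" and t=0]) simp_all
  with eq show ?thesis by simp
qed

text \<open>Completing the square: exponential tilting of a centred normal density shifts its
  mean.\<close>

lemma normal_density_times_exp:
  assumes "0 < s"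
  shows "normal_density 0 s x * exp (k * x) = exp (k\<^sup>2 * s\<^sup>2 / 2) * normal_density (k * s\<^sup>2) s x"
proof -
  have "- x\<^sup>2 / (2 * s\<^sup>2) + k * x = k\<^sup>2 * s\<^sup>2 / 2 + - (x - k * s\<^sup>2)\<^sup>2 / (2 * s\<^sup>2)"
    using assms by (simp add: field_simps power2_eq_square)
  then show ?thesis
    by (simp add: normal_density_def exp_add[symmetric])
qed

lemma nn_integral_normal_density_exp:
  assumes s: "0 < s"
  shows "(\<integral>\<^sup>+x. ennreal (normal_density 0 s x) * ennreal (exp (k * x)) \<partial>lborel) = ennreal (exp (k\<^sup>2 * s\<^sup>2 / 2))"
proof -
  have "(\<integral>\<^sup>+x. ennreal (normal_density 0 s x) * ennreal (exp (k * x)) \<partial>lborel)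
     = (\<integral>\<^sup>+x. ennreal (exp (k\<^sup>2 * s\<^sup>2 / 2)) * ennreal (normal_density (k * s\<^sup>2) s x) \<partial>lborel)"
    by (simp add: ennreal_mult'[symmetric] normal_density_times_exp[OF s] ennreal_mult''[symmetric])
  also have "\<dots> = ennreal (exp (k\<^sup>2 * s\<^sup>2 / 2)) * (\<integral>\<^sup>+x. ennreal (normal_density (k * s\<^sup>2) s x) \<partial>lborel)"
    by (rule nn_integral_cmult) simp
  also have "(\<integral>\<^sup>+x. ennreal (normal_density (k * s\<^sup>2) s x) \<partial>lborel) = 1"
    using s by (subst nn_integral_eq_integral) auto
  finally show ?thesis by simp
qed

text \<open>From exp(k |x|) <= exp(k x) + exp(-k x). The factor 2 accumulates to
  \<open>2 ^ n\<close> over n increments and is later absorbed by taking the time horizon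
  small.\<close>

lemma nn_integral_normal_density_exp_abs:
  assumes s: "0 < s"
  shows "(\<integral>\<^sup>+x. ennreal (normal_density 0 s x) * ennreal (exp (k * \<bar>x\<bar>)) \<partial>lborel) \<le> ennreal (2 * exp (k\<^sup>2 * s\<^sup>2 / 2))"
proof -
  have "exp (k * \<bar>x\<bar>) \<le> exp (k * x) + exp (- k * x)" for x :: real
    by (cases "x \<ge> 0") (auto simp: add_increasing add_increasing2)
  then have "(\<integral>\<^sup>+x. ennreal (normal_density 0 s x) * ennreal (exp (k * \<bar>x\<bar>)) \<partial>lborel)
    \<le> (\<integral>\<^sup>+x. ennreal (normal_density 0 s x) * ennreal (exp (k * x))
        + ennreal (normal_density 0 s x) * ennreal (exp (- k * x)) \<partial>lborel)"
    by (intro nn_integral_mono)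
       (auto simp: distrib_left[symmetric] ennreal_plus[symmetric] simp del: ennreal_plus
         intro!: mult_left_mono ennreal_leI)
  also have "\<dots> = ennreal (exp (k\<^sup>2 * s\<^sup>2 / 2)) + ennreal (exp ((- k)\<^sup>2 * s\<^sup>2 / 2))"
    unfolding nn_integral_normal_density_exp[OF s, symmetric] by (rule nn_integral_add) measurable
  also have "\<dots> = ennreal (2 * exp (k\<^sup>2 * s\<^sup>2 / 2))"
    by (simp add: ennreal_plus[symmetric] del: ennreal_plus)
  finally show ?thesis .
qed

lemma integral_normal_density_iexp:
  assumes s: "0 < s"
  shows "(CLBINT x. normal_density 0 s x *\<^sub>R iexp (\<xi> * x)) = exp (- (\<xi>\<^sup>2 * s\<^sup>2) / 2)"
proof -
  have "(CLBINT x. normal_density 0 s x *\<^sub>R iexp (\<xi> * x))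
      = s *\<^sub>R (CLBINT x. normal_density 0 s (0 + s * x) *\<^sub>R iexp (\<xi> * (0 + s * x)))"
    using s by (subst lborel_integral_real_affine[where c=s and t=0]) auto
  also have "\<dots> = (CLBINT x. std_normal_density x *\<^sub>R iexp ((\<xi> * s) * x))"
    unfolding integral_scaleR_right[symmetric] scaleR_scaleR
    using s by (intro Bochner_Integration.integral_cong)
      (auto simp: normal_density_def real_sqrt_mult power_mult_distrib algebra_simps)
  also have "\<dots> = char std_normal_distribution (\<xi> * s)"
    unfolding char_def by (subst integral_density) auto
  finally show ?thesis
    by (simp add: char_std_normal_distribution power_mult_distrib)
qed

lemma nn_integral_exponential_density_exp:
  assumes "k < \<theta>" "0 < \<theta>"
  shows "(\<integral>\<^sup>+u. ennreal (exponential_density \<theta> u) * ennreal (exp (k * u)) \<partial>lborel) = ennreal (\<theta> / (\<theta> - k))"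
proof -
  have "exponential_density \<theta> u * exp (k * u) = \<theta> / (\<theta> - k) * exponential_density (\<theta> - k) u" for u
  proof -
    have "exp (- u * \<theta>) * exp (k * u) = exp (- u * (\<theta> - k))"
      by (simp add: algebra_simps flip: exp_add)
    then show ?thesis
      using assms by (simp add: exponential_density_def)
  qed
  then have "ennreal (exponential_density \<theta> u) * ennreal (exp (k * u))
      = ennreal (\<theta> / (\<theta> - k)) * ennreal (exponential_density (\<theta> - k) u)" for u
    using assms exponential_density_nonneg[of \<theta> u] exponential_density_nonneg[of "\<theta> - k" u]
    by (simp add: ennreal_mult'[symmetric] ennreal_mult''[symmetric] del: times_divide_eq_left)
  then show ?thesis
    using nn_integral_erlang_ith_moment[of "\<theta> - k" 0 0] assms by (simp add: nn_integral_cmult)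
qed

lemma norm_iexp_diff_le: "cmod (iexp a - iexp b) \<le> \<bar>a - b\<bar>"
proof -
  have "iexp a - iexp b = iexp b * (iexp (a - b) - 1)"
    by (simp add: algebra_simps flip: exp_add)
  then have "cmod (iexp a - iexp b) = cmod (iexp (a - b) - 1)"
    by (simp add: norm_mult)
  also have "\<dots> \<le> \<bar>a - b\<bar>"
    using iexp_approx1[of "a - b" 0] by simp
  finally show ?thesis .
qed

lemma integrable_std_normal_exp:
  "integrable lborel (\<lambda>v. std_normal_density v * exp (c * \<bar>v\<bar>))"
proof (rule integrableI_nonneg)
  have le: "(\<integral>\<^sup>+v. ennreal (std_normal_density v * exp (c * \<bar>v\<bar>)) \<partial>lborel) \<le> ennreal (2 * exp (c\<^sup>2 * 1\<^sup>2 / 2))"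
    using nn_integral_normal_density_exp_abs[of 1 c] by (simp add: ennreal_mult')
  show "(\<integral>\<^sup>+v. ennreal (std_normal_density v * exp (c * \<bar>v\<bar>)) \<partial>lborel) < \<infinity>"
    using le_less_trans[OF le ennreal_less_top] by simp
qed auto

text \<open>Rescaling by \<open>\<theta>\<close> turns the left-hand side into the integral of \<open>\<theta> * h (v / \<theta>)\<close> against the
  standard exponential law, which converges to that of \<open>a * v\<close>.\<close>

lemma tendsto_exponential_average:
  fixes h :: "real \<Rightarrow> real"
  assumes h: "h \<in> borel_measurable borel" "h 0 = 0" "(h has_real_derivative a) (at 0 within {0..})"
    and bound: "\<And>x. 0 \<le> x \<Longrightarrow> \<bar>h x\<bar> \<le> A * x * exp (c * x)" and c: "0 \<le> c"
  shows "((\<lambda>\<theta>. \<theta> * (\<integral>u. exponential_density \<theta> u * h u \<partial>lborel)) \<longlongrightarrow> a) at_top"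
proof -
  note [measurable] = h(1)
  have A: "0 \<le> A"
    using order_trans[OF abs_ge_zero bound[of 1]] by (simp add: zero_le_mult_iff)
  have moment: "has_bochner_integral lborel (\<lambda>v. exponential_density \<theta> v * v) (1 / \<theta>)" if "0 < \<theta>" for \<theta>
    using nn_integral_erlang_ith_moment[OF that, of 0 1] that
    by (intro has_bochner_integral_nn_integral) (auto simp: exponential_density_def)
  have "((\<lambda>\<theta>. \<integral>v. exponential_density 1 v * (\<theta> * h (v / \<theta>)) \<partial>lborel)
      \<longlongrightarrow> (\<integral>v. exponential_density 1 v * (a * v) \<partial>lborel)) at_top"
  proof (rule integral_dominated_convergence_at_top[where w="\<lambda>v. 2 * A * (exponential_density (1/2) v * v)"])
    \<comment> \<open>For \<theta> >= 2 c the growth factor exp(c v / \<theta>) is at most exp(v /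
      2), so exp(-v / 2) remains. The factor 2 undoes the normalisation of
      \<open>exponential_density (1/2)\<close>.\<close>
    show "integrable lborel (\<lambda>v. 2 * A * (exponential_density (1/2) v * v))"
      using moment[of "1/2"] by (auto simp: has_bochner_integral_iff)
    show "\<forall>\<^sub>F \<theta> in at_top. AE v in lborel. norm (exponential_density 1 v * (\<theta> * h (v / \<theta>)))
        \<le> 2 * A * (exponential_density (1/2) v * v)"
      using eventually_ge_at_top[of "2 * c + 1"]
    proof eventually_elim
      case (elim \<theta>)
      then have \<theta>: "0 < \<theta>" "2 * c \<le> \<theta>" using c by auto
      have "exponential_density 1 v * (\<theta> * \<bar>h (v / \<theta>)\<bar>) \<le> 2 * A * (exponential_density (1/2) v * v)"
        if v: "0 \<le> v" for v
      proof -
        have "\<bar>h (v / \<theta>)\<bar> \<le> A * (v / \<theta>) * exp (c * (v / \<theta>))"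
          using v \<theta> by (intro bound) simp
        also have "\<dots> \<le> A * (v / \<theta>) * exp (v / 2)"
          using v \<theta> A mult_right_mono[of "2 * c" \<theta> v] by (intro mult_left_mono) (auto simp: field_simps)
        finally have "\<theta> * \<bar>h (v / \<theta>)\<bar> \<le> A * v * exp (v / 2)"
          using \<theta> by (simp add: field_simps)
        then have "exp (- v) * (\<theta> * \<bar>h (v / \<theta>)\<bar>) \<le> exp (- v) * (A * v * exp (v / 2))"
          by (rule mult_left_mono) simp
        also have "\<dots> = A * (exp (- v / 2) * v)"
          by (simp add: mult.assoc[symmetric] exp_minus exp_double[symmetric] flip: exp_diff)
            (simp add: field_simps flip: exp_add)
        finally show ?thesis using v by (simp add: exponential_density_def algebra_simps)
      qed
      then have "norm (exponential_density 1 v * (\<theta> * h (v / \<theta>))) \<le> 2 * A * (exponential_density (1/2) v * v)" for v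
        using \<theta>
        by (cases "0 \<le> v") (simp_all add: abs_mult exponential_density_nonneg, simp add: exponential_density_def)
      then show ?case by auto
    qed
    show "AE v in lborel. ((\<lambda>\<theta>. exponential_density 1 v * (\<theta> * h (v / \<theta>)))
        \<longlongrightarrow> exponential_density 1 v * (a * v)) at_top"
    proof (rule AE_mp[OF AE_lborel_singleton[of 0] AE_I2], rule impI)
      \<comment> \<open>The point 0 is removed because v / \<theta> must stay away from 0 for the
        difference quotient; for negative v the density vanishes.\<close>
      fix v :: real assume "v \<noteq> 0"
      show "((\<lambda>\<theta>. exponential_density 1 v * (\<theta> * h (v / \<theta>))) \<longlongrightarrow> exponential_density 1 v * (a * v)) at_top"
      proof (cases "0 < v")
        case True
        have "((\<lambda>x. h x / x) \<longlongrightarrow> a) (at 0 within {0..})"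
          using h(2,3) by (simp add: has_field_derivative_iff)
        moreover have "filterlim (\<lambda>\<theta>. v / \<theta>) (at 0 within {0..}) at_top"
          unfolding filterlim_at using True
          by (auto intro!: eventually_mono[OF eventually_gt_at_top[of 0]] tendsto_divide_0 tendsto_const
              filterlim_mono[OF filterlim_ident _ order_refl] simp: at_top_le_at_infinity)
        ultimately have "((\<lambda>\<theta>. h (v / \<theta>) / (v / \<theta>)) \<longlongrightarrow> a) at_top"
          by (rule filterlim_compose)
        then have "((\<lambda>\<theta>. exponential_density 1 v * (h (v / \<theta>) / (v / \<theta>) * v)) \<longlongrightarrow> exponential_density 1 v * (a * v)) at_top"
          by (intro tendsto_intros)
        then show ?thesis
          using True by (simp add: field_simps)
      qed (use \<open>v \<noteq> 0\<close> in \<open>simp add: exponential_density_def\<close>)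
    qed
  qed measurable
  also have "(\<integral>v. exponential_density 1 v * (a * v) \<partial>lborel) = a"
    using moment[of 1] by (simp add: has_bochner_integral_iff mult.left_commute)
  finally show ?thesis
  proof (rule Lim_transform_eventually)
    show "\<forall>\<^sub>F \<theta> in at_top. (\<integral>v. exponential_density 1 v * (\<theta> * h (v / \<theta>)) \<partial>lborel)
        = \<theta> * (\<integral>u. exponential_density \<theta> u * h u \<partial>lborel)"
      using eventually_gt_at_top[of 0]
    proof eventually_elim
      case (elim \<theta>)
      have "(\<integral>u. exponential_density \<theta> u * h u \<partial>lborel)
          = (1 / \<theta>) * (\<integral>v. exponential_density \<theta> (v / \<theta>) * h (v / \<theta>) \<partial>lborel)"
        using elim by (subst lborel_integral_real_affine[where c="1 / \<theta>" and t=0]) auto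
      also have "(\<lambda>v. exponential_density \<theta> (v / \<theta>) * h (v / \<theta>)) = (\<lambda>v. exponential_density 1 v * (\<theta> * h (v / \<theta>)))"
        using elim by (auto simp: exponential_density_def fun_eq_iff field_simps)
      finally show ?case using elim by simp
    qed
  qed
qed

section \<open>Moments of the driving processes\<close>

context mispricing_setting
begin

lemma prob_first_arrival_le:
  assumes "0 \<le> T"
  shows "prob {w \<in> space M. \<tau> (Suc 0) w \<le> T} = 1 - exp (- rate * T)"
proof -
  have "{w \<in> space M. \<tau> (Suc 0) w \<le> T} = {w \<in> space M. \<tau> (Suc 0) w - \<tau> 0 w \<le> T}"
    using \<tau>_0 by auto
  then show ?thesis
    using exponential_distributedD_le[OF \<tau>_exponential_waiting assms rate_pos, of 0] by (simp add: mult.commute)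
qed

text \<open>If k arrivals occur by time T, each of the k independent waiting times is at most T,
  which has probability 1 - exp(-l T) <= l T. The bound lacks the factor 1 / k!, but it is geometric
  in k, which is enough to sum it for small T.\<close>

lemma prob_arrival_le:
  assumes T: "0 \<le> T"
  shows "prob {w \<in> space M. \<tau> k w \<le> T} \<le> (rate * T) ^ k"
proof (cases "k = 0")
  case False
  let ?X = "\<lambda>i w. \<tau> (Suc i) w - \<tau> i w"
  have "\<tau> (Suc i) w - \<tau> i w \<le> T" if "w \<in> space M" "\<tau> k w \<le> T" "i < k" for w i
  proof -
    have "\<tau> (Suc i) w \<le> \<tau> k w"
      using strict_mono_less_eq[OF \<tau>_strict_mono[OF that(1)], of "Suc i" k] that(3) by simp
    with \<tau>_nonneg[OF that(1), of i] that(2) show ?thesis by simp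
  qed
  then have "prob {w \<in> space M. \<tau> k w \<le> T} \<le> prob (\<Inter>i\<in>{..<k}. ?X i -` {..T} \<inter> space M)"
    using False by (intro finite_measure_mono) (auto intro!: sets.finite_INT)
  also have "\<dots> = (\<Prod>i\<in>{..<k}. prob (?X i -` {..T} \<inter> space M))"
    using False by (intro indep_varsD[OF \<tau>_indep_waiting]) auto
  also have "\<dots> \<le> (\<Prod>i\<in>{..<k}. rate * T)"
  proof (intro prod_mono conjI)
    fix i
    have "?X i -` {..T} \<inter> space M = {w \<in> space M. ?X i w \<le> T}" by auto
    then have "prob (?X i -` {..T} \<inter> space M) = 1 - exp (- T * rate)"
      using exponential_distributedD_le[OF \<tau>_exponential_waiting T rate_pos, of i] by simp
    also have "\<dots> \<le> rate * T"
      using exp_ge_add_one_self[of "- T * rate"] by (simp add: mult.commute)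
    finally show "prob (?X i -` {..T} \<inter> space M) \<le> rate * T" .
  qed simp
  finally show ?thesis by simp
qed (simp add: prob_space)

lemma nn_integral_increment:
  assumes "0 \<le> s" "s < t" and [measurable]: "h \<in> borel_measurable borel"
  shows "(\<integral>\<^sup>+w. h (B t w - B s w) \<partial>M) = (\<integral>\<^sup>+x. ennreal (normal_density 0 (sqrt (t - s)) x) * h x \<partial>lborel)"
  by (rule distributed_nn_integral[OF B_normal_increment[OF assms(1,2)], symmetric]) simp

lemma nn_integral_abs_increment_le:
  assumes "0 \<le> s" "s \<le> t"
  shows "(\<integral>\<^sup>+w. ennreal \<bar>B t w - B s w\<bar> \<partial>M) \<le> ennreal (sqrt (t - s))"
proof (cases "s = t")
  case False
  with assms have st: "s < t" by simp
  let ?s = "sqrt (t - s)"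
  have "has_bochner_integral lborel (\<lambda>x. normal_density 0 ?s x * \<bar>x\<bar>) (?s * sqrt (2 / pi))"
    using normal_moment_abs_odd[of ?s 0 0] st by simp
  then have "(\<integral>\<^sup>+x. ennreal (normal_density 0 ?s x * \<bar>x\<bar>) \<partial>lborel) = ennreal (?s * sqrt (2 / pi))"
    by (auto simp: has_bochner_integral_iff nn_integral_eq_integral)
  then have "(\<integral>\<^sup>+w. ennreal \<bar>B t w - B s w\<bar> \<partial>M) = ennreal (?s * sqrt (2 / pi))"
    using nn_integral_increment[OF assms(1) st, of "\<lambda>x. ennreal \<bar>x\<bar>"] by (simp add: ennreal_mult')
  also have "\<dots> \<le> ennreal (?s * 1)"
    using pi_ge_two st by (intro ennreal_leI mult_left_mono) auto
  finally show ?thesis by simp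
qed simp

text \<open>Independence of the increments over a deterministic grid turns the exponential of the
  sum into a product, and the variances telescope. It is applied to frozen arrival times.\<close>

lemma nn_integral_exp_increments_le:
  assumes r: "0 \<le> r 0" "\<And>i. i < n \<Longrightarrow> r i < r (Suc i)"
  shows "(\<integral>\<^sup>+w. ennreal (exp (k * (\<Sum>j<n. \<bar>B (r (Suc j)) w - B (r j) w\<bar>))) \<partial>M)
    \<le> ennreal (2 ^ n * exp (k\<^sup>2 * (r n - r 0) / 2))"
proof -
  have r0: "0 \<le> r i" if "i \<le> n" for i
    using that by (induction i) (use r in \<open>auto intro: less_imp_le order_trans simp: Suc_le_eq\<close>)
  let ?X = "\<lambda>j w. ennreal (exp (k * \<bar>B (r (Suc j)) w - B (r j) w\<bar>))"
  have "indep_vars (\<lambda>_. borel) (\<lambda>i w. B (r (Suc i)) w - B (r i) w) {..<n}"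
    using r by (intro B_indep_increments) (auto intro: less_imp_le)
  then have indep: "indep_vars (\<lambda>_. borel) ?X {..<n}"
    by (rule indep_vars_compose2) measurable
  have "(\<integral>\<^sup>+w. ennreal (exp (k * (\<Sum>j<n. \<bar>B (r (Suc j)) w - B (r j) w\<bar>))) \<partial>M) = (\<integral>\<^sup>+w. (\<Prod>j\<in>{..<n}. ?X j w) \<partial>M)"
    by (simp add: sum_distrib_left exp_sum prod_ennreal)
  also have "\<dots> = (\<Prod>j\<in>{..<n}. \<integral>\<^sup>+w. ?X j w \<partial>M)"
    using indep by (intro indep_vars_nn_integral) auto
  also have "\<dots> \<le> (\<Prod>j\<in>{..<n}. ennreal (2 * exp (k\<^sup>2 * (r (Suc j) - r j) / 2)))"
  proof (rule prod_mono_ennreal)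
    fix j assume j: "j \<in> {..<n}"
    then show "(\<integral>\<^sup>+w. ?X j w \<partial>M) \<le> ennreal (2 * exp (k\<^sup>2 * (r (Suc j) - r j) / 2))"
      using nn_integral_increment[of "r j" "r (Suc j)" "\<lambda>x. ennreal (exp (k * \<bar>x\<bar>))"] r0[of j] r(2)[of j]
        nn_integral_normal_density_exp_abs[of "sqrt (r (Suc j) - r j)" k]
      by simp
  qed
  also have "\<dots> = ennreal (\<Prod>j\<in>{..<n}. 2 * exp (k\<^sup>2 * (r (Suc j) - r j) / 2))"
    by (rule prod_ennreal) simp
  also have "(\<Prod>j\<in>{..<n}. 2 * exp (k\<^sup>2 * (r (Suc j) - r j) / 2)) = 2 ^ n * exp (\<Sum>j<n. k\<^sup>2 * (r (Suc j) - r j) / 2)"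
    by (simp add: prod.distrib exp_sum)
  also have "(\<Sum>j<n. k\<^sup>2 * (r (Suc j) - r j) / 2) = k\<^sup>2 * (r n - r 0) / 2"
    by (simp add: sum_divide_distrib[symmetric] sum_distrib_left[symmetric] sum_lessThan_telescope)
  finally show ?thesis .
qed

section \<open>The invariant distribution\<close>

abbreviation state :: "real \<Rightarrow> real \<Rightarrow> 'a \<Rightarrow> real" where
  "state t x w \<equiv> mispricing \<sigma> \<gamma> \<delta> (\<lambda>s. B s w) (\<lambda>i. \<tau> i w) x t"

sublocale \<pi>: prob_space \<pi> by (rule prob_space_\<pi>)

lemma real_distribution_\<pi>: "real_distribution \<pi>"
  by (intro real_distribution.intro prob_space_\<pi> real_distribution_axioms.intro) simp_all

lemma measurable_state [measurable]:
  "0 \<le> t \<Longrightarrow> (\<lambda>(x, w). state t x w) \<in> borel_measurable (\<pi> \<Otimes>\<^sub>M M)"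
  by measurable

lemma state_eq:
  assumes "w \<in> space M" "0 \<le> t"
  shows "t < \<tau> (Suc 0) w \<Longrightarrow> state t x w = x + \<sigma> * B t w"
    and "\<tau> (Suc 0) w \<le> t \<Longrightarrow> t < \<tau> (Suc (Suc 0)) w \<Longrightarrow>
      state t x w = clip (x + \<sigma> * B (\<tau> (Suc 0) w) w) + \<sigma> * (B t w - B (\<tau> (Suc 0) w) w)"
proof -
  have eq: "state t x w = post_arrival \<sigma> \<gamma> \<delta> (\<lambda>s. B s w) (\<lambda>i. \<tau> i w) x k + \<sigma> * (B t w - B (\<tau> k w) w)"
    if "\<tau> k w \<le> t" "t < \<tau> (Suc k) w" for k
    using arrival_count_\<tau>_eq_iff[OF assms, of k] that by (simp add: mispricing_def)
  show "t < \<tau> (Suc 0) w \<Longrightarrow> state t x w = x + \<sigma> * B t w"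
    using eq[of 0] assms by (simp add: \<tau>_0 B_0)
  show "\<tau> (Suc 0) w \<le> t \<Longrightarrow> t < \<tau> (Suc (Suc 0)) w \<Longrightarrow>
      state t x w = clip (x + \<sigma> * B (\<tau> (Suc 0) w) w) + \<sigma> * (B t w - B (\<tau> (Suc 0) w) w)"
    using eq[of "Suc 0"] assms by (simp add: \<tau>_0 B_0)
qed

lemma emeasure_\<pi>_eq:
  assumes "0 \<le> t" "A \<in> sets borel"
  shows "emeasure \<pi> A = (\<integral>\<^sup>+x. emeasure M {w \<in> space M. state t x w \<in> A} \<partial>\<pi>)"
  using \<pi>_invariant assms unfolding invariant_distribution_def by blast

lemma \<pi>_eq_distr:
  assumes t: "0 \<le> t"
  shows "\<pi> = distr (\<pi> \<Otimes>\<^sub>M M) borel (\<lambda>(x, w). state t x w)"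
proof (rule measure_eqI)
  fix A assume A: "A \<in> sets \<pi>"
  have "emeasure (distr (\<pi> \<Otimes>\<^sub>M M) borel (\<lambda>(x, w). state t x w)) A
      = emeasure (\<pi> \<Otimes>\<^sub>M M) ((\<lambda>(x, w). state t x w) -` A \<inter> space (\<pi> \<Otimes>\<^sub>M M))"
    using A t by (intro emeasure_distr) auto
  also have "\<dots> = (\<integral>\<^sup>+x. emeasure M (Pair x -` ((\<lambda>(x, w). state t x w) -` A \<inter> space (\<pi> \<Otimes>\<^sub>M M))) \<partial>\<pi>)"
    using A t by (intro emeasure_pair_measure_alt measurable_sets[OF measurable_state]) auto
  also have "\<dots> = (\<integral>\<^sup>+x. emeasure M {w \<in> space M. state t x w \<in> A} \<partial>\<pi>)"
    by (intro nn_integral_cong arg_cong[where f="emeasure M"]) (auto simp: space_pair_measure)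
  also have "\<dots> = emeasure \<pi> A"
    using emeasure_\<pi>_eq[OF t, of A] A by simp
  finally show "emeasure \<pi> A = emeasure (distr (\<pi> \<Otimes>\<^sub>M M) borel (\<lambda>(x, w). state t x w)) A" ..
qed simp

text \<open>Within a short time there is most likely no arrival, and without one the law of the state has a
  density.\<close>

lemma \<pi>_no_atoms: "measure \<pi> {a} = 0"
proof -
  have "measure \<pi> {a} \<le> rate * t" if t: "0 < t" for t
  proof -
    have null: "emeasure M {w \<in> space M. B t w - B 0 w = c} = 0" for c
    proof -
      have "{w \<in> space M. B t w - B 0 w = c} = (\<lambda>w. B t w - B 0 w) -` {c} \<inter> space M" by auto
      then show ?thesis
        using distributed_emeasure[OF B_normal_increment[OF order_refl t], of "{c}"]
        by (simp add: nn_integral_null_set null_setsI)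
    qed
    have "emeasure M {w \<in> space M. state t x w \<in> {a}} \<le> ennreal (rate * t)" for x
    proof -
      have "emeasure M {w \<in> space M. state t x w \<in> {a}}
        \<le> emeasure M ({w \<in> space M. \<tau> (Suc 0) w \<le> t} \<union> {w \<in> space M. B t w - B 0 w = (a - x) / \<sigma>})"
      proof (rule emeasure_mono)
        show "{w \<in> space M. state t x w \<in> {a}}
          \<subseteq> {w \<in> space M. \<tau> (Suc 0) w \<le> t} \<union> {w \<in> space M. B t w - B 0 w = (a - x) / \<sigma>}"
        proof
          fix w assume *: "w \<in> {w \<in> space M. state t x w \<in> {a}}"
          then show "w \<in> {w \<in> space M. \<tau> (Suc 0) w \<le> t} \<union> {w \<in> space M. B t w - B 0 w = (a - x) / \<sigma>}"
            using state_eq(1)[of w t x] t \<sigma>_pos B_0[of w]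
            by (cases "\<tau> (Suc 0) w \<le> t") (auto simp: field_simps)
        qed
      qed (use t in auto)
      also have "\<dots> \<le> emeasure M {w \<in> space M. \<tau> (Suc 0) w \<le> t} + emeasure M {w \<in> space M. B t w - B 0 w = (a - x) / \<sigma>}"
        using t by (intro emeasure_subadditive) auto
      also have "\<dots> \<le> ennreal (rate * t)"
        unfolding null using prob_arrival_le[of t "Suc 0"] t by (simp add: emeasure_eq_measure ennreal_leI)
      finally show ?thesis .
    qed
    then have "(\<integral>\<^sup>+x. emeasure M {w \<in> space M. state t x w \<in> {a}} \<partial>\<pi>) \<le> (\<integral>\<^sup>+x. ennreal (rate * t) \<partial>\<pi>)"
      by (intro nn_integral_mono)
    moreover have "emeasure \<pi> {a} = (\<integral>\<^sup>+x. emeasure M {w \<in> space M. state t x w \<in> {a}} \<partial>\<pi>)"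
      using t by (intro emeasure_\<pi>_eq) auto
    ultimately have "emeasure \<pi> {a} \<le> ennreal (rate * t)"
      by (simp add: \<pi>.emeasure_space_1[simplified])
    then show ?thesis
      using rate_pos t by (simp add: \<pi>.emeasure_eq_measure)
  qed
  note * = this
  have "measure \<pi> {a} \<le> 0"
  proof (rule field_le_epsilon)
    fix e :: real assume "0 < e"
    then show "measure \<pi> {a} \<le> 0 + e" using *[of "e / rate"] rate_pos by simp
  qed
  then show ?thesis using measure_nonneg[of \<pi> "{a}"] by simp
qed

text \<open>The thresholds are the only points where \<open>clip\<close> can be
  discontinuous.\<close>

lemma AE_\<pi>_not_threshold: "AE x in \<pi>. \<bar>x\<bar> \<noteq> \<gamma> + \<delta>"
proof -
  have "{a} \<in> null_sets \<pi>" for a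
    using \<pi>_no_atoms[of a] by (intro null_setsI) (simp_all add: \<pi>.emeasure_eq_measure)
  then have "{- (\<gamma> + \<delta>), \<gamma> + \<delta>} \<in> null_sets \<pi>"
    using null_sets.Un[of "{- (\<gamma> + \<delta>)}" \<pi> "{\<gamma> + \<delta>}"] by (simp add: insert_commute)
  then show ?thesis
    by (rule AE_not_in[THEN AE_mp]) (auto simp: abs_if)
qed

abbreviation lipschitz_bound :: "real \<Rightarrow> real \<Rightarrow> real" where
  "lipschitz_bound \<xi> x \<equiv> \<bar>\<xi>\<bar> + 2 / \<bar>\<bar>x\<bar> - (\<gamma> + \<delta>)\<bar>"

text \<open>If |u| is smaller than the distance d from x to the nearer threshold, no threshold is
  crossed and \<open>clip\<close> moves by at most |u|. Otherwise the trivial bound 2 is at most 2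
  |u| / d.\<close>

lemma one_arrival_bound:
  assumes x: "\<bar>x\<bar> \<noteq> \<gamma> + \<delta>"
  shows "cmod (iexp (\<xi> * (clip (x + u) + v)) - iexp (\<xi> * clip x))
    \<le> lipschitz_bound \<xi> x * (\<bar>u\<bar> + \<bar>v\<bar>)"
proof (cases "\<bar>u\<bar> < \<bar>\<bar>x\<bar> - (\<gamma> + \<delta>)\<bar>")
  case True
  then have "\<bar>clip (x + u) - clip x\<bar> \<le> \<bar>u\<bar>"
    using x \<gamma>_pos \<delta>_nonneg by (auto simp: reset_def abs_if split: if_splits)
  then have "\<bar>clip (x + u) + v - clip x\<bar> \<le> \<bar>u\<bar> + \<bar>v\<bar>" by simp
  then have "\<bar>\<xi>\<bar> * \<bar>clip (x + u) + v - clip x\<bar> \<le> \<bar>\<xi>\<bar> * (\<bar>u\<bar> + \<bar>v\<bar>)"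
    by (rule mult_left_mono) simp
  moreover have "\<bar>\<xi>\<bar> * (\<bar>u\<bar> + \<bar>v\<bar>) \<le> lipschitz_bound \<xi> x * (\<bar>u\<bar> + \<bar>v\<bar>)"
    by (rule mult_right_mono) auto
  ultimately show ?thesis
    using norm_iexp_diff_le[of "\<xi> * (clip (x + u) + v)" "\<xi> * clip x"]
    by (simp only: right_diff_distrib[symmetric] abs_mult)
next
  case False
  let ?d = "\<bar>\<bar>x\<bar> - (\<gamma> + \<delta>)\<bar>"
  have d: "0 < ?d" using x by simp
  have "cmod (iexp (\<xi> * (clip (x + u) + v)) - iexp (\<xi> * clip x)) \<le> 1 + 1"
    by (rule order_trans[OF norm_triangle_ineq4]) simp
  also have "\<dots> \<le> 2 / ?d * \<bar>u\<bar>"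
    using d False by (simp add: field_simps)
  also have "\<dots> \<le> (\<bar>\<xi>\<bar> + 2 / ?d) * (\<bar>u\<bar> + \<bar>v\<bar>)"
    using d by (intro mult_mono) auto
  finally show ?thesis .
qed

section \<open>Short-time expansion of the semigroup on characters\<close>

definition arrived :: "real \<Rightarrow> 'a \<Rightarrow> real" where
  "arrived t w = indicator {..t} (\<tau> (Suc 0) w)"

lemma measurable_arrived [measurable]:
  "arrived t \<in> borel_measurable M" "arrived t \<in> borel_measurable arrival_algebra"
proof -
  note [measurable] = measurable_\<tau>_arrival
  show "arrived t \<in> borel_measurable M" "arrived t \<in> borel_measurable arrival_algebra"
    unfolding arrived_def[abs_def] by measurable
qed

lemma integral_arrived: "0 \<le> t \<Longrightarrow> (\<integral>w. arrived t w \<partial>M) = 1 - exp (- rate * t)"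
proof -
  assume t: "0 \<le> t"
  have "(\<integral>w. arrived t w \<partial>M) = (\<integral>w. indicator {w \<in> space M. \<tau> (Suc 0) w \<le> t} w \<partial>M)"
    by (intro Bochner_Integration.integral_cong) (auto simp: arrived_def split: split_indicator)
  also have "\<dots> = 1 - exp (- rate * t)"
    using prob_first_arrival_le[OF t] by simp
  finally show ?thesis .
qed

lemma arrived_bounds: "0 \<le> arrived t w" "arrived t w \<le> 1"
  by (auto simp: arrived_def split: split_indicator)

definition arrived_part :: "real \<Rightarrow> real \<Rightarrow> real \<Rightarrow> complex" where
  "arrived_part \<xi> t x = (CLINT w|M. iexp (\<xi> * state t x w) * arrived t w)"

lemma integrable_arrived_part:
  "0 \<le> t \<Longrightarrow> integrable M (\<lambda>w. iexp (\<xi> * state t x w) * arrived t w)"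
  by (rule integrable_const_bound[where B=1]) (auto simp: norm_mult arrived_bounds)

lemma measurable_arrived_part [measurable]:
  "0 \<le> t \<Longrightarrow> arrived_part \<xi> t \<in> borel_measurable \<pi>"
  unfolding arrived_part_def[abs_def]
  by (rule borel_measurable_lebesgue_integral) (simp add: split_beta', measurable)

lemma norm_arrived_part_le:
  assumes t: "0 \<le> t"
  shows "cmod (arrived_part \<xi> t x) \<le> rate * t"
proof -
  have "cmod (arrived_part \<xi> t x) \<le> (\<integral>w. cmod (iexp (\<xi> * state t x w) * arrived t w) \<partial>M)"
    unfolding arrived_part_def by (rule integral_norm_bound)
  also have "\<dots> = (\<integral>w. arrived t w \<partial>M)"
    by (simp add: norm_mult arrived_bounds)
  also have "\<dots> \<le> rate * t"
    using exp_ge_add_one_self[of "- rate * t"] by (simp add: integral_arrived[OF t])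
  finally show ?thesis .
qed

text \<open>With the arrival time frozen by independence, both increments have mean modulus at most
  sqrt t; the arrival itself supplies the factor l t. The total is of order t^(3/2), negligible
  against t.\<close>

lemma nn_integral_arrived_increments:
  assumes t: "0 \<le> t"
  shows "(\<integral>\<^sup>+w. ennreal (arrived t w) * (ennreal \<bar>B (\<tau> (Suc 0) w) w - B 0 w\<bar>
        + ennreal \<bar>B t w - B (\<tau> (Suc 0) w) w\<bar>) \<partial>M) \<le> ennreal (rate * t * (2 * sqrt t))"
proof -
  have "(\<integral>\<^sup>+w. ennreal (arrived t w) * (ennreal \<bar>B (\<tau> (Suc 0) w) w - B 0 w\<bar>
        + ennreal \<bar>B t w - B (\<tau> (Suc 0) w) w\<bar>) \<partial>M)
     = (\<integral>\<^sup>+w'. (\<integral>\<^sup>+w. ennreal (arrived t w') * (ennreal \<bar>B (\<tau> (Suc 0) w') w - B 0 w\<bar>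
        + ennreal \<bar>B t w - B (\<tau> (Suc 0) w') w\<bar>) \<partial>M) \<partial>M)"
    using t by (intro nn_integral_path_arrival) measurable
  also have "\<dots> \<le> (\<integral>\<^sup>+w'. ennreal (arrived t w') * ennreal (2 * sqrt t) \<partial>M)"
  proof (intro nn_integral_mono)
    fix w' assume w': "w' \<in> space M"
    let ?s = "\<tau> (Suc 0) w'"
    have s: "0 \<le> ?s" using \<tau>_nonneg[OF w'] .
    show "(\<integral>\<^sup>+w. ennreal (arrived t w') * (ennreal \<bar>B ?s w - B 0 w\<bar> + ennreal \<bar>B t w - B ?s w\<bar>) \<partial>M)
        \<le> ennreal (arrived t w') * ennreal (2 * sqrt t)"
    proof (cases "?s \<le> t")
      case True
      have "(\<integral>\<^sup>+w. ennreal (arrived t w') * (ennreal \<bar>B ?s w - B 0 w\<bar> + ennreal \<bar>B t w - B ?s w\<bar>) \<partial>M)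
         = ennreal (arrived t w') * ((\<integral>\<^sup>+w. ennreal \<bar>B ?s w - B 0 w\<bar> \<partial>M) + (\<integral>\<^sup>+w. ennreal \<bar>B t w - B ?s w\<bar> \<partial>M))"
        using s t by (subst nn_integral_cmult, measurable) (subst nn_integral_add, auto)
      also have "\<dots> \<le> ennreal (arrived t w') * (ennreal (sqrt (?s - 0)) + ennreal (sqrt (t - ?s)))"
        using s True by (intro mult_left_mono add_mono nn_integral_abs_increment_le) auto
      also have "\<dots> \<le> ennreal (arrived t w') * ennreal (2 * sqrt t)"
      proof (intro mult_left_mono)
        have "sqrt (?s - 0) \<le> sqrt t" "sqrt (t - ?s) \<le> sqrt t" using s True by auto
        then have "sqrt (?s - 0) + sqrt (t - ?s) \<le> 2 * sqrt t" by linarith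
        then show "ennreal (sqrt (?s - 0)) + ennreal (sqrt (t - ?s)) \<le> ennreal (2 * sqrt t)"
          using s True by (simp add: ennreal_plus[symmetric] ennreal_leI del: ennreal_plus)
      qed simp
      finally show ?thesis .
    qed (simp add: arrived_def)
  qed
  also have "\<dots> = (\<integral>\<^sup>+w'. ennreal (arrived t w') \<partial>M) * ennreal (2 * sqrt t)"
    by (rule nn_integral_multc) measurable
  also have "(\<integral>\<^sup>+w'. ennreal (arrived t w') \<partial>M) = ennreal (1 - exp (- rate * t))"
    unfolding integral_arrived[OF t, symmetric]
    by (intro nn_integral_eq_integral integrable_const_bound[where B=1]) (auto simp: arrived_bounds)
  also have "ennreal (1 - exp (- rate * t)) * ennreal (2 * sqrt t) = ennreal ((1 - exp (- rate * t)) * (2 * sqrt t))"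
    using t rate_pos by (intro ennreal_mult[symmetric]) auto
  also have "\<dots> \<le> ennreal (rate * t * (2 * sqrt t))"
    using t exp_ge_add_one_self[of "- rate * t"] by (intro ennreal_leI mult_right_mono) auto
  finally show ?thesis .
qed

text \<open>Two arrivals by time t have probability O(t^2). With exactly one, the state is
  \<open>clip x\<close> up to the perturbation by the two increments, at cost O(t^(3/2)). Both
  errors are o(t) for x fixed off the thresholds.\<close>

lemma arrived_part_approx:
  assumes t: "0 < t" and x: "\<bar>x\<bar> \<noteq> \<gamma> + \<delta>"
  shows "cmod (arrived_part \<xi> t x - (1 - exp (- rate * t)) * iexp (\<xi> * clip x))
    \<le> 2 * (rate * t)\<^sup>2 + lipschitz_bound \<xi> x * \<sigma> * (rate * t * (2 * sqrt t))"
proof -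
  let ?K = "lipschitz_bound \<xi> x * \<sigma>"
  let ?e = "\<lambda>w. iexp (\<xi> * state t x w)" and ?c = "iexp (\<xi> * clip x)"
  let ?A = "{w \<in> space M. \<tau> (Suc (Suc 0)) w \<le> t}"
  let ?I = "\<lambda>w. ennreal (arrived t w) * (ennreal \<bar>B (\<tau> (Suc 0) w) w - B 0 w\<bar> + ennreal \<bar>B t w - B (\<tau> (Suc 0) w) w\<bar>)"
  have t0: "0 \<le> t" using t by simp
  have K: "0 \<le> ?K" using \<sigma>_pos by simp
  have "(CLINT w|M. ?c * arrived t w) = ?c * (1 - exp (- rate * t))"
    using integral_arrived[OF t0] by (simp add: integral_mult_right_zero integral_of_real)
  then have eq: "arrived_part \<xi> t x - (1 - exp (- rate * t)) * ?c = (CLINT w|M. (?e w - ?c) * arrived t w)"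
    unfolding arrived_part_def left_diff_distrib
    by (subst Bochner_Integration.integral_diff[OF integrable_arrived_part[OF t0]])
       (auto intro!: integrable_const_bound[where B=1] simp: norm_mult arrived_bounds mult.commute)
  have le2: "cmod ((?e w - ?c) * arrived t w) \<le> 2" for w
  proof -
    have "cmod ((?e w - ?c) * arrived t w) \<le> (1 + 1) * 1"
      unfolding norm_mult
      by (intro mult_mono order_trans[OF norm_triangle_ineq4]) (auto simp: arrived_bounds)
    then show ?thesis by simp
  qed
  have "ennreal (cmod (arrived_part \<xi> t x - (1 - exp (- rate * t)) * ?c))
      \<le> (\<integral>\<^sup>+w. ennreal (cmod ((?e w - ?c) * arrived t w)) \<partial>M)"
    unfolding eq using t0 le2 by (intro integral_norm_bound_ennreal integrable_const_bound[where B=2]) auto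
  also have "\<dots> \<le> (\<integral>\<^sup>+w. 2 * indicator ?A w + ennreal ?K * ?I w \<partial>M)"
  proof (intro nn_integral_mono)
    fix w assume w: "w \<in> space M"
    show "ennreal (cmod ((?e w - ?c) * arrived t w)) \<le> 2 * indicator ?A w + ennreal ?K * ?I w"
    proof (cases "\<tau> (Suc (Suc 0)) w \<le> t")
      case True
      have "ennreal (cmod ((?e w - ?c) * arrived t w)) \<le> 2"
        using ennreal_leI[OF le2] by simp
      with True w show ?thesis by (simp add: add_increasing2)
    next
      case False
      show ?thesis
      proof (cases "\<tau> (Suc 0) w \<le> t")
        case True
        let ?u = "\<sigma> * (B (\<tau> (Suc 0) w) w - B 0 w)" and ?v = "\<sigma> * (B t w - B (\<tau> (Suc 0) w) w)"
        have "state t x w = clip (x + ?u) + ?v"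
          using state_eq(2)[OF w t0 True, of x] False B_0[OF w] by simp
        then have "cmod ((?e w - ?c) * arrived t w) \<le> lipschitz_bound \<xi> x * (\<bar>?u\<bar> + \<bar>?v\<bar>)"
          using one_arrival_bound[OF x, of \<xi> ?u ?v] True by (simp add: norm_mult arrived_def)
        also have "\<dots> = ?K * (\<bar>B (\<tau> (Suc 0) w) w - B 0 w\<bar> + \<bar>B t w - B (\<tau> (Suc 0) w) w\<bar>)"
        proof -
          have "\<bar>\<sigma> * y\<bar> = \<sigma> * \<bar>y\<bar>" for y using \<sigma>_pos by (simp add: abs_mult)
          then show ?thesis by (simp only: distrib_left mult.assoc)
        qed
        finally have "ennreal (cmod ((?e w - ?c) * arrived t w)) \<le>
            ennreal (?K * (\<bar>B (\<tau> (Suc 0) w) w - B 0 w\<bar> + \<bar>B t w - B (\<tau> (Suc 0) w) w\<bar>))"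
          by (rule ennreal_leI)
        also have "\<dots> = ennreal ?K * ?I w"
          using True K by (simp add: ennreal_mult' arrived_def)
        finally show ?thesis by (rule order_trans) (simp add: add_increasing)
      qed (simp add: arrived_def)
    qed
  qed
  also have "\<dots> = 2 * emeasure M ?A + ennreal ?K * (\<integral>\<^sup>+w. ?I w \<partial>M)"
    using t0 by (subst nn_integral_add, measurable) (simp add: nn_integral_cmult nn_integral_cmult_indicator)
  also have "\<dots> \<le> 2 * ennreal ((rate * t)\<^sup>2) + ennreal ?K * ennreal (rate * t * (2 * sqrt t))"
    using prob_arrival_le[OF t0, of 2] nn_integral_arrived_increments[OF t0]
    by (intro add_mono mult_left_mono) (auto simp: emeasure_eq_measure numeral_2_eq_2 intro!: ennreal_leI)
  also have "\<dots> = ennreal (2 * (rate * t)\<^sup>2 + ?K * (rate * t * (2 * sqrt t)))"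
    using t0 rate_pos K by (simp add: ennreal_mult' ennreal_plus del: ennreal_numeral flip: ennreal_numeral)
  finally show ?thesis
    using t0 rate_pos K by (subst (asm) ennreal_le_iff) auto
qed

text \<open>Without an arrival the state is x + \<sigma> B_t. Independence of path and arrivals
  yields the product of the Gaussian factor exp(-\<xi>^2 \<sigma>^2 t / 2) and the survival
  probability exp(-l t); invariance puts the same characteristic function on both sides.\<close>

lemma char_\<pi>_split:
  assumes t: "0 < t"
  shows "char \<pi> \<xi> = exp (- (rate + \<xi>\<^sup>2 * \<sigma>\<^sup>2 / 2) * t) * char \<pi> \<xi> + (CLINT x|\<pi>. arrived_part \<xi> t x)"
proof -
  interpret P: pair_prob_space \<pi> M ..
  have t0: "0 \<le> t" using t by simp
  have inner: "(CLINT w|M. iexp (\<xi> * state t x w))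
      = exp (- (rate + \<xi>\<^sup>2 * \<sigma>\<^sup>2 / 2) * t) * iexp (\<xi> * x) + arrived_part \<xi> t x" for x
  proof -
    let ?b = "\<lambda>w. iexp ((\<xi> * \<sigma>) * (B t w - B 0 w))" and ?n = "\<lambda>w. 1 - complex_of_real (arrived t w)"
    have "indep_var path_algebra (\<lambda>w. w) arrival_algebra (\<lambda>w. w)"
      using B_indep_\<tau> by (intro indep_var_sources) (simp_all add: path_algebra_def arrival_algebra_def)
    then have "indep_var borel (?b \<circ> (\<lambda>w. w)) borel (?n \<circ> (\<lambda>w. w))"
      by (rule indep_var_compose) (use t0 in measurable)
    then have indep: "indep_var borel ?b borel ?n" by (simp add: comp_def)
    have int: "integrable M ?b"
      by (rule integrable_const_bound[where B=1]) (use t0 in auto)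
    have int': "integrable M ?n"
      by (rule integrable_const_bound[where B=1])
         (use arrived_bounds in \<open>auto simp: arrived_def split: split_indicator\<close>)
    have n: "(CLINT w|M. ?n w) = exp (- rate * t)"
    proof -
      have "integrable M (arrived t)"
        by (intro integrable_const_bound[where B=1]) (auto simp: arrived_bounds)
      then show ?thesis using integral_arrived[OF t0] by (simp add: prob_space)
    qed
    have b: "(CLINT w|M. ?b w) = exp (- ((\<xi> * \<sigma>)\<^sup>2 * t) / 2)"
    proof -
      have "(CLINT w|M. ?b w) = (CLINT x|distr M lborel (\<lambda>w. B t w - B 0 w). iexp ((\<xi> * \<sigma>) * x))"
        using t0 by (subst integral_distr) auto
      also have "\<dots> = (CLINT x|density lborel (normal_density 0 (sqrt (t - 0))). iexp ((\<xi> * \<sigma>) * x))"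
        unfolding distributed_distr_eq_density[OF B_normal_increment[OF order_refl t]] ..
      also have "\<dots> = (CLBINT x. normal_density 0 (sqrt t) x *\<^sub>R iexp ((\<xi> * \<sigma>) * x))"
        by (subst integral_density) auto
      also have "\<dots> = exp (- ((\<xi> * \<sigma>)\<^sup>2 * t) / 2)"
        using integral_normal_density_iexp[of "sqrt t" "\<xi> * \<sigma>"] t by simp
      finally show ?thesis .
    qed
    have "(CLINT w|M. iexp (\<xi> * state t x w))
      = (CLINT w|M. iexp (\<xi> * x) * (?b w * ?n w) + iexp (\<xi> * state t x w) * arrived t w)"
    proof (intro Bochner_Integration.integral_cong refl)
      fix w assume w: "w \<in> space M"
      show "iexp (\<xi> * state t x w) = iexp (\<xi> * x) * (?b w * ?n w) + iexp (\<xi> * state t x w) * arrived t w"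
        using state_eq(1)[OF w t0, of x] B_0[OF w]
        by (cases "\<tau> (Suc 0) w \<le> t") (simp_all add: arrived_def algebra_simps flip: exp_add)
    qed
    also have "\<dots> = iexp (\<xi> * x) * (CLINT w|M. ?b w * ?n w) + arrived_part \<xi> t x"
      unfolding arrived_part_def
      using indep_var_integrable[OF indep int int'] integrable_arrived_part[OF t0, of \<xi> x]
      by (subst Bochner_Integration.integral_add) auto
    also have "(CLINT w|M. ?b w * ?n w) = exp (- ((\<xi> * \<sigma>)\<^sup>2 * t) / 2) * exp (- rate * t)"
      unfolding indep_var_lebesgue_integral[OF indep int int'] n b by (simp only: of_real_mult)
    also have "\<dots> = exp (- (rate + \<xi>\<^sup>2 * \<sigma>\<^sup>2 / 2) * t)"
      by (simp add: algebra_simps power_mult_distrib flip: exp_of_real exp_add)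
    finally show ?thesis by (simp add: mult.commute)
  qed
  have intP: "integrable (\<pi> \<Otimes>\<^sub>M M) (\<lambda>p. iexp (\<xi> * (case p of (x, w) \<Rightarrow> state t x w)))"
    by (rule P.integrable_const_bound[where B=1]) (use t0 in auto)
  have int_x: "integrable \<pi> (\<lambda>x. iexp (\<xi> * x))"
    by (rule \<pi>.integrable_const_bound[where B=1]) auto
  have int_a: "integrable \<pi> (arrived_part \<xi> t)"
    by (rule \<pi>.integrable_const_bound[where B="rate * t"]) (use norm_arrived_part_le[OF t0] t0 in auto)
  have "char \<pi> \<xi> = (CLINT y|distr (\<pi> \<Otimes>\<^sub>M M) borel (\<lambda>(x, w). state t x w). iexp (\<xi> * y))"
    unfolding char_def using \<pi>_eq_distr[OF t0] by simp
  also have "\<dots> = (CLINT p|(\<pi> \<Otimes>\<^sub>M M). iexp (\<xi> * (case p of (x, w) \<Rightarrow> state t x w)))"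
    using t0 by (subst integral_distr) auto
  also have "\<dots> = (CLINT x|\<pi>. (CLINT w|M. iexp (\<xi> * state t x w)))"
    using P.integral_fst'[OF intP] by simp
  also have "\<dots> = (CLINT x|\<pi>. exp (- (rate + \<xi>\<^sup>2 * \<sigma>\<^sup>2 / 2) * t) * iexp (\<xi> * x) + arrived_part \<xi> t x)"
    unfolding inner ..
  also have "\<dots> = exp (- (rate + \<xi>\<^sup>2 * \<sigma>\<^sup>2 / 2) * t) * char \<pi> \<xi> + (CLINT x|\<pi>. arrived_part \<xi> t x)"
    unfolding char_def using int_x int_a by simp
  finally show ?thesis .
qed

text \<open>The stationarity equation at a characteristic function \<open>z \<mapsto> exp (\<i> \<xi> z)\<close>, obtained from the
  first-order expansion of the semigroup at time \<open>0\<close>.\<close>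

lemma char_\<pi>_stationary:
  "(rate + \<xi>\<^sup>2 * \<sigma>\<^sup>2 / 2) * char \<pi> \<xi> = rate * (CLINT x|\<pi>. iexp (\<xi> * clip x))"
proof (rule LIMSEQ_unique)
  \<comment> \<open>The limit of the arrival part divided by t, along t = 1 / (n + 1), is computed
    twice: exactly from \<open>char_\<pi>_split\<close>, and by dominated convergence from
    \<open>arrived_part_approx\<close>.\<close>
  let ?\<kappa> = "rate + \<xi>\<^sup>2 * \<sigma>\<^sup>2 / 2"
  let ?t = "\<lambda>n. inverse (real (Suc n))"
  have t0: "0 < ?t n" for n by simp
  have t_lim: "?t \<longlonglongrightarrow> 0" by (rule LIMSEQ_inverse_real_of_nat)
  have scale: "cmod (a / of_real t - of_real (q / t) * c) = cmod (a - of_real q * c) / t"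
    if "0 < t" for a c :: complex and q t :: real
  proof -
    have "a / of_real t - of_real (q / t) * c = (a - of_real q * c) / of_real t"
      by (simp add: diff_divide_distrib)
    then show ?thesis using that by (simp add: norm_divide)
  qed
  have cancel: "(2 * (r * t)\<^sup>2 + K * (r * t * w)) / t = 2 * r\<^sup>2 * t + K * (r * w)"
    if "0 < t" for r t K w :: real
    using that by (simp add: field_simps power2_eq_square)
  have rate_lim: "(\<lambda>n. (1 - exp (- k * ?t n)) / ?t n) \<longlonglongrightarrow> k" for k :: real
  proof -
    have "((\<lambda>t. 1 - exp (- k * t)) has_real_derivative k) (at 0)"
      by (auto intro!: derivative_eq_intros)
    then have "((\<lambda>t. (1 - exp (- k * t)) / t) \<longlongrightarrow> k) (at 0)"
      by (simp add: has_field_derivative_iff)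
    then show ?thesis
      by (rule filterlim_compose) (use t_lim in \<open>simp add: filterlim_at\<close>)
  qed
  have eq: "of_real ((1 - exp (- ?\<kappa> * ?t n)) / ?t n) * char \<pi> \<xi> = (CLINT x|\<pi>. arrived_part \<xi> (?t n) x / ?t n)" for n
  proof -
    have "of_real (1 - exp (- ?\<kappa> * ?t n)) * char \<pi> \<xi> = (CLINT x|\<pi>. arrived_part \<xi> (?t n) x)"
      using char_\<pi>_split[OF t0[of n], of \<xi>] by (simp add: algebra_simps)
    then have "of_real (1 - exp (- ?\<kappa> * ?t n)) * char \<pi> \<xi> / ?t n = (CLINT x|\<pi>. arrived_part \<xi> (?t n) x / ?t n)"
      by (simp only: integral_divide_zero)
    then show ?thesis
      by (simp only: of_real_divide times_divide_eq_left)
  qed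
  have "(\<lambda>n. CLINT x|\<pi>. arrived_part \<xi> (?t n) x / ?t n) \<longlonglongrightarrow> of_real ?\<kappa> * char \<pi> \<xi>"
    using tendsto_mult_right[OF tendsto_of_real[OF rate_lim[of ?\<kappa>], where 'a=complex], of "char \<pi> \<xi>"]
    unfolding eq .
  then show "(\<lambda>n. CLINT x|\<pi>. arrived_part \<xi> (?t n) x / ?t n) \<longlonglongrightarrow> (rate + \<xi>\<^sup>2 * \<sigma>\<^sup>2 / 2) * char \<pi> \<xi>"
    by simp
  have "(\<lambda>n. CLINT x|\<pi>. arrived_part \<xi> (?t n) x / ?t n) \<longlonglongrightarrow> (CLINT x|\<pi>. rate * iexp (\<xi> * clip x))"
  proof (rule integral_dominated_convergence[where w="\<lambda>_. rate"])
    show "AE x in \<pi>. cmod (arrived_part \<xi> (?t n) x / ?t n) \<le> rate" for n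
    proof (rule AE_I2)
      fix x
      have "cmod (arrived_part \<xi> (?t n) x / ?t n) = cmod (arrived_part \<xi> (?t n) x) / ?t n"
        by (simp add: norm_divide norm_inverse del: of_nat_Suc)
      also have "\<dots> \<le> rate * ?t n / ?t n"
        by (intro divide_right_mono norm_arrived_part_le) auto
      finally show "cmod (arrived_part \<xi> (?t n) x / ?t n) \<le> rate" by simp
    qed
    show "AE x in \<pi>. (\<lambda>n. arrived_part \<xi> (?t n) x / ?t n) \<longlonglongrightarrow> rate * iexp (\<xi> * clip x)"
      using AE_\<pi>_not_threshold
    proof eventually_elim
      case (elim x)
      let ?c = "iexp (\<xi> * clip x)"
      let ?K = "lipschitz_bound \<xi> x * \<sigma>"
      have "(\<lambda>n. arrived_part \<xi> (?t n) x / ?t n - of_real ((1 - exp (- rate * ?t n)) / ?t n) * ?c) \<longlonglongrightarrow> 0"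
      proof (rule Lim_null_comparison)
        show "\<forall>\<^sub>F n in sequentially. cmod (arrived_part \<xi> (?t n) x / ?t n - of_real ((1 - exp (- rate * ?t n)) / ?t n) * ?c)
            \<le> 2 * rate\<^sup>2 * ?t n + ?K * (rate * (2 * sqrt (?t n)))"
        proof (intro always_eventually allI)
          fix n
          have "cmod (arrived_part \<xi> (?t n) x / ?t n - of_real ((1 - exp (- rate * ?t n)) / ?t n) * ?c)
             = cmod (arrived_part \<xi> (?t n) x - (1 - exp (- rate * ?t n)) * ?c) / ?t n"
            using scale[OF t0[of n], of "arrived_part \<xi> (?t n) x" "1 - exp (- rate * ?t n)" ?c]
            by (simp only: of_real_diff of_real_1)
          also have "\<dots> \<le> (2 * (rate * ?t n)\<^sup>2 + ?K * (rate * ?t n * (2 * sqrt (?t n)))) / ?t n"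
            by (intro divide_right_mono arrived_part_approx elim) auto
          also have "\<dots> = 2 * rate\<^sup>2 * ?t n + ?K * (rate * (2 * sqrt (?t n)))"
            by (rule cancel[OF t0])
          finally show "cmod (arrived_part \<xi> (?t n) x / ?t n - of_real ((1 - exp (- rate * ?t n)) / ?t n) * ?c)
            \<le> 2 * rate\<^sup>2 * ?t n + ?K * (rate * (2 * sqrt (?t n)))" .
        qed
        have "(\<lambda>n. 2 * rate\<^sup>2 * ?t n + ?K * (rate * (2 * sqrt (?t n)))) \<longlonglongrightarrow> 2 * rate\<^sup>2 * 0 + ?K * (rate * (2 * sqrt 0))"
          by (intro tendsto_intros t_lim)
        then show "(\<lambda>n. 2 * rate\<^sup>2 * ?t n + ?K * (rate * (2 * sqrt (?t n)))) \<longlonglongrightarrow> 0" by simp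
      qed
      from tendsto_add[OF this tendsto_mult_right[OF tendsto_of_real[OF rate_lim[of rate], where 'a=complex], of ?c]]
      show ?case by simp
    qed
  qed (auto intro!: borel_measurable_divide)
  then show "(\<lambda>n. CLINT x|\<pi>. arrived_part \<xi> (?t n) x / ?t n) \<longlonglongrightarrow> rate * (CLINT x|\<pi>. iexp (\<xi> * clip x))"
    by simp
qed

end

section \<open>Consequences of stationarity: exponential tails, moments and trade
  probability\<close>

context mispricing_setting
begin

definition decay :: real where
  "decay = sqrt (2 * rate) / \<sigma>"

lemma decay_pos: "0 < decay"
  using rate_pos \<sigma>_pos by (simp add: decay_def)

lemma decay_square: "decay\<^sup>2 = 2 * rate / \<sigma>\<^sup>2"
  using rate_pos by (simp add: decay_def power_divide)

abbreviation jump_law :: "real measure" where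
  "jump_law \<equiv> density lborel (laplace_density decay)"

sublocale jump_law: prob_space jump_law
  by (rule prob_space_laplace[OF decay_pos])

sublocale \<pi>_jump: pair_prob_space \<pi> jump_law ..

text \<open>Between arrivals the state moves by the value of the Brownian motion at an exponential time,
  which has a Laplace law.\<close>

lemma \<pi>_convolution:
  "\<pi> = distr (\<pi> \<Otimes>\<^sub>M jump_law) borel (\<lambda>(x, l). clip x + l)"
proof (rule Levy_uniqueness[OF real_distribution_\<pi>])
  show "real_distribution (distr (\<pi> \<Otimes>\<^sub>M jump_law) borel (\<lambda>(x, l). clip x + l))"
    by (rule \<pi>_jump.real_distribution_distr) measurable
  show "char \<pi> = char (distr (\<pi> \<Otimes>\<^sub>M jump_law) borel (\<lambda>(x, l). clip x + l))"
  proof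
    fix \<xi>
    have int: "integrable (\<pi> \<Otimes>\<^sub>M jump_law) (\<lambda>p. iexp (\<xi> * (case p of (x, l) \<Rightarrow> clip x + l)))"
      by (rule \<pi>_jump.integrable_const_bound[where B=1]) auto
    have "char (distr (\<pi> \<Otimes>\<^sub>M jump_law) borel (\<lambda>(x, l). clip x + l)) \<xi>
        = (CLINT p|(\<pi> \<Otimes>\<^sub>M jump_law). iexp (\<xi> * (case p of (x, l) \<Rightarrow> clip x + l)))"
      unfolding char_def by (subst integral_distr) auto
    also have "\<dots> = (CLINT x|\<pi>. (CLINT l|jump_law. iexp (\<xi> * (clip x + l))))"
      using \<pi>_jump.integral_fst'[OF int] by simp
    also have "\<dots> = (CLINT x|\<pi>. (CLINT l|jump_law. iexp (\<xi> * clip x) * iexp (\<xi> * l)))"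
      by (simp add: algebra_simps exp_add)
    also have "\<dots> = (CLINT x|\<pi>. iexp (\<xi> * clip x)) * char jump_law \<xi>"
      unfolding char_def by simp
    also have "char jump_law \<xi> = rate / (rate + \<xi>\<^sup>2 * \<sigma>\<^sup>2 / 2)"
    proof -
      have "decay\<^sup>2 / (decay\<^sup>2 + \<xi>\<^sup>2) = rate / (rate + \<xi>\<^sup>2 * \<sigma>\<^sup>2 / 2)"
        unfolding decay_square using \<sigma>_pos rate_pos by (simp add: field_simps)
      then show ?thesis
        unfolding char_laplace[OF decay_pos] by (rule arg_cong[where f=complex_of_real])
    qed
    also have "(CLINT x|\<pi>. iexp (\<xi> * clip x)) * (rate / (rate + \<xi>\<^sup>2 * \<sigma>\<^sup>2 / 2)) = char \<pi> \<xi>"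
    proof -
      have "0 < rate + \<xi>\<^sup>2 * \<sigma>\<^sup>2 / 2" using rate_pos by (simp add: add_pos_nonneg)
      then have nz: "complex_of_real (rate + \<xi>\<^sup>2 * \<sigma>\<^sup>2 / 2) \<noteq> 0" by (metis less_irrefl of_real_eq_0_iff)
      have "complex_of_real (rate + \<xi>\<^sup>2 * \<sigma>\<^sup>2 / 2) * char \<pi> \<xi> = complex_of_real rate * (CLINT x|\<pi>. iexp (\<xi> * clip x))"
        using char_\<pi>_stationary[of \<xi>] by simp
      moreover have "X * (r / k) = c" if "k * c = r * X" "k \<noteq> 0" for X r k c :: complex
        using that by (simp add: field_simps)
      ultimately show ?thesis
        unfolding of_real_divide using nz by blast
    qed
    finally show "char \<pi> \<xi> = char (distr (\<pi> \<Otimes>\<^sub>M jump_law) borel (\<lambda>(x, l). clip x + l)) \<xi>" ..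
  qed
qed

lemma nn_integral_\<pi>:
  assumes [measurable]: "h \<in> borel_measurable borel"
  shows "(\<integral>\<^sup>+x. h x \<partial>\<pi>) = (\<integral>\<^sup>+x. (\<integral>\<^sup>+l. ennreal (laplace_density decay l) * h (clip x + l) \<partial>lborel) \<partial>\<pi>)"
proof -
  have "(\<integral>\<^sup>+x. h x \<partial>\<pi>) = (\<integral>\<^sup>+x. h x \<partial>distr (\<pi> \<Otimes>\<^sub>M jump_law) borel (\<lambda>(x, l). clip x + l))"
    using \<pi>_convolution by simp
  also have "\<dots> = (\<integral>\<^sup>+p. h (case p of (x, l) \<Rightarrow> clip x + l) \<partial>(\<pi> \<Otimes>\<^sub>M jump_law))"
    by (rule nn_integral_distr) measurable
  also have "\<dots> = (\<integral>\<^sup>+x. (\<integral>\<^sup>+l. h (clip x + l) \<partial>jump_law) \<partial>\<pi>)"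
    by (subst jump_law.nn_integral_fst[symmetric]) auto
  also have "\<dots> = (\<integral>\<^sup>+x. (\<integral>\<^sup>+l. ennreal (laplace_density decay l) * h (clip x + l) \<partial>lborel) \<partial>\<pi>)"
    by (intro nn_integral_cong nn_integral_density) auto
  finally show ?thesis .
qed

lemma abs_reset_le_threshold: "\<bar>clip x\<bar> \<le> \<gamma> + \<delta>"
  using \<gamma>_pos \<delta>_nonneg by (auto simp: reset_def)

text \<open>Memorylessness: beyond a level at distance a >= 0 the overshoot is exponential, with
  weight exp(-\<theta> a) / 2. The identity fails at u = 0, where the indicator is 0 but the
  exponential density is not.\<close>

lemma laplace_density_shift:
  assumes "0 \<le> a"
  shows "AE u in lborel. ennreal (laplace_density decay (a + u)) * (h u * indicator {0<..} u)
    = ennreal (exp (- decay * a) / 2) * (ennreal (exponential_density decay u) * h u)"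
proof (rule AE_mp[OF AE_lborel_singleton[of 0] AE_I2], rule impI)
  fix u :: real assume "u \<noteq> 0"
  show "ennreal (laplace_density decay (a + u)) * (h u * indicator {0<..} u)
    = ennreal (exp (- decay * a) / 2) * (ennreal (exponential_density decay u) * h u)"
  proof (cases "0 < u")
    case True
    have eq: "laplace_density decay (a + u) = exp (- decay * a) / 2 * exponential_density decay u"
    proof -
      have "exp (- decay * (a + u)) = exp (- decay * a) * exp (- u * decay)"
        by (simp add: algebra_simps flip: exp_add)
      then show ?thesis
        using True assms by (simp add: laplace_density_eq exponential_density_def)
    qed
    have "ennreal (laplace_density decay (a + u))
        = ennreal (exp (- decay * a) / 2) * ennreal (exponential_density decay u)"
      unfolding eq using exponential_density_nonneg[OF decay_pos, of u] by (intro ennreal_mult) simp_all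
    then show ?thesis using True by (simp add: mult.assoc)
  qed (use \<open>u \<noteq> 0\<close> in \<open>simp add: exponential_density_def\<close>)
qed

text \<open>Beyond the thresholds the Laplace law is memoryless, so the tails of \<open>\<pi>\<close> are exponential.\<close>

lemma nn_integral_\<pi>_tail:
  assumes s: "s = 1 \<or> s = - 1" and h [measurable]: "h \<in> borel_measurable borel"
  shows "(\<integral>\<^sup>+x. h x * indicator {\<gamma> + \<delta><..} (s * x) \<partial>\<pi>) = emeasure \<pi> {x. \<gamma> + \<delta> < s * x}
      * (\<integral>\<^sup>+u. ennreal (exponential_density decay u) * h (s * (\<gamma> + \<delta> + u)) \<partial>lborel)"
proof -
  let ?g = "\<gamma> + \<delta>" and ?r = "clip"
  let ?I = "\<lambda>h. \<integral>\<^sup>+u. ennreal (exponential_density decay u) * h (s * (?g + u)) \<partial>lborel"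
  \<comment> \<open>The overshoot weight averaged over the clipped state. The case h = 1 of
    \<open>tail\<close> identifies it with the mass of the tail at the end.\<close>
  define p where "p = (\<integral>\<^sup>+x. ennreal (exp (- decay * (?g - s * ?r x)) / 2) \<partial>\<pi>)"
  have tail: "(\<integral>\<^sup>+x. h x * indicator {?g<..} (s * x) \<partial>\<pi>) = p * ?I h"
    if [measurable]: "h \<in> borel_measurable borel" for h
  proof -
    have "(\<integral>\<^sup>+l. ennreal (laplace_density decay l) * (h (?r x + l) * indicator {?g<..} (s * (?r x + l))) \<partial>lborel)
      = ennreal (exp (- decay * (?g - s * ?r x)) / 2) * ?I h" for x
    proof -
      have a: "0 \<le> ?g - s * ?r x" using abs_reset_le_threshold[of x] s by auto
      have arg: "?r x + (s * ?g - ?r x + s * u) = s * (?g + u)" "s * (s * (?g + u)) = ?g + u" for u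
        using s by (auto simp: algebra_simps)
      have even: "laplace_density decay (s * ?g - ?r x + s * u) = laplace_density decay ((?g - s * ?r x) + u)" for u
      proof -
        have "s * ?g - ?r x + s * u = s * ((?g - s * ?r x) + u)" using s by (auto simp: algebra_simps)
        moreover have "laplace_density decay (s * y) = laplace_density decay y" for y using s by auto
        ultimately show ?thesis by simp
      qed
      have "(\<integral>\<^sup>+l. ennreal (laplace_density decay l) * (h (?r x + l) * indicator {?g<..} (s * (?r x + l))) \<partial>lborel)
        = ennreal \<bar>s\<bar> * (\<integral>\<^sup>+u. ennreal (laplace_density decay (s * ?g - ?r x + s * u))
          * (h (?r x + (s * ?g - ?r x + s * u)) * indicator {?g<..} (s * (?r x + (s * ?g - ?r x + s * u)))) \<partial>lborel)"
        by (rule nn_integral_real_affine) (use s in auto)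
      also have "\<dots> = (\<integral>\<^sup>+u. ennreal (laplace_density decay ((?g - s * ?r x) + u)) * (h (s * (?g + u)) * indicator {0<..} u) \<partial>lborel)"
      proof -
        have "\<bar>s\<bar> = 1" using s by auto
        then show ?thesis
          unfolding arg even by (simp, intro nn_integral_cong) (auto split: split_indicator)
      qed
      also have "\<dots> = (\<integral>\<^sup>+u. ennreal (exp (- decay * (?g - s * ?r x)) / 2) * (ennreal (exponential_density decay u) * h (s * (?g + u))) \<partial>lborel)"
        by (rule nn_integral_cong_AE, rule laplace_density_shift[OF a])
      also have "\<dots> = ennreal (exp (- decay * (?g - s * ?r x)) / 2) * ?I h"
        by (rule nn_integral_cmult) measurable
      finally show ?thesis .
    qed
    then have "(\<integral>\<^sup>+x. h x * indicator {?g<..} (s * x) \<partial>\<pi>) = (\<integral>\<^sup>+x. ennreal (exp (- decay * (?g - s * ?r x)) / 2) * ?I h \<partial>\<pi>)"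
      by (subst nn_integral_\<pi>) auto
    also have "\<dots> = p * ?I h"
      unfolding p_def by (rule nn_integral_multc) measurable
    finally show ?thesis .
  qed
  have "emeasure \<pi> {x. ?g < s * x} = (\<integral>\<^sup>+x. 1 * indicator {?g<..} (s * x) \<partial>\<pi>)"
  proof -
    have ind: "1 * indicator {?g<..} (s * x) = (indicator {x. ?g < s * x} x :: ennreal)" for x
      by (simp add: indicator_def)
    show ?thesis unfolding ind by (rule nn_integral_indicator[symmetric]) simp
  qed
  also have "\<dots> = p"
    using tail[of "\<lambda>_. 1"] nn_integral_erlang_ith_moment[OF decay_pos, of 0 0] by simp
  finally show ?thesis
    using tail[OF h] by simp
qed

lemma nn_integral_\<pi>_tails:
  assumes h: "h \<in> borel_measurable borel"
  shows "(\<integral>\<^sup>+x. h x * indicator {\<gamma> + \<delta><..} x \<partial>\<pi>) = emeasure \<pi> {\<gamma> + \<delta><..}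
      * (\<integral>\<^sup>+u. ennreal (exponential_density decay u) * h (\<gamma> + \<delta> + u) \<partial>lborel)"
    and "(\<integral>\<^sup>+x. h x * indicator {..<- (\<gamma> + \<delta>)} x \<partial>\<pi>) = emeasure \<pi> {..<- (\<gamma> + \<delta>)}
      * (\<integral>\<^sup>+u. ennreal (exponential_density decay u) * h (- (\<gamma> + \<delta>) - u) \<partial>lborel)"
proof -
  have "{x. \<gamma> + \<delta> < 1 * x} = {\<gamma> + \<delta><..}" "{x. \<gamma> + \<delta> < - 1 * x} = {..<- (\<gamma> + \<delta>)}"
    "indicator {\<gamma> + \<delta><..} (- 1 * x) = (indicator {..<- (\<gamma> + \<delta>)} x :: ennreal)"
    "- 1 * (\<gamma> + \<delta> + x) = - (\<gamma> + \<delta>) - x" for x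
    by (auto split: split_indicator)
  with nn_integral_\<pi>_tail[of 1 h] nn_integral_\<pi>_tail[of "- 1" h] h
  show "(\<integral>\<^sup>+x. h x * indicator {\<gamma> + \<delta><..} x \<partial>\<pi>) = emeasure \<pi> {\<gamma> + \<delta><..}
      * (\<integral>\<^sup>+u. ennreal (exponential_density decay u) * h (\<gamma> + \<delta> + u) \<partial>lborel)"
    "(\<integral>\<^sup>+x. h x * indicator {..<- (\<gamma> + \<delta>)} x \<partial>\<pi>) = emeasure \<pi> {..<- (\<gamma> + \<delta>)}
      * (\<integral>\<^sup>+u. ennreal (exponential_density decay u) * h (- (\<gamma> + \<delta>) - u) \<partial>lborel)"
    by (simp_all only: mult_1 simp_thms)
qed

text \<open>Between the thresholds the integrand is bounded, and beyond them the exponential tails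
  of rate \<open>decay\<close> beat the growth rate k.\<close>

lemma integrable_\<pi>_exp:
  assumes k: "0 \<le> k" "k < decay"
  shows "integrable \<pi> (\<lambda>x. exp (k * \<bar>x\<bar>))"
proof (rule integrableI_nonneg)
  let ?g = "\<gamma> + \<delta>"
  have g: "0 < ?g" using \<gamma>_pos \<delta>_nonneg by simp
  let ?h = "\<lambda>x. ennreal (exp (k * \<bar>x\<bar>))"
  have tail: "(\<integral>\<^sup>+u. ennreal (exponential_density decay u) * ?h (s u) \<partial>lborel) < \<infinity>"
    if "\<And>u. 0 \<le> u \<Longrightarrow> \<bar>s u\<bar> = ?g + u" for s
  proof -
    have "(\<integral>\<^sup>+u. ennreal (exponential_density decay u) * ?h (s u) \<partial>lborel)
      = (\<integral>\<^sup>+u. ennreal (exp (k * ?g)) * (ennreal (exponential_density decay u) * ennreal (exp (k * u))) \<partial>lborel)"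
    proof (intro nn_integral_cong)
      fix u
      show "ennreal (exponential_density decay u) * ?h (s u)
          = ennreal (exp (k * ?g)) * (ennreal (exponential_density decay u) * ennreal (exp (k * u)))"
      proof (cases "0 \<le> u")
        case True
        have "?h (s u) = ennreal (exp (k * ?g)) * ennreal (exp (k * u))"
          unfolding that[OF True] by (simp add: ennreal_mult''[symmetric] ring_distribs exp_add[symmetric])
        then show ?thesis by (simp add: mult.left_commute)
      qed (simp add: exponential_density_def)
    qed
    also have "\<dots> = ennreal (exp (k * ?g)) * ennreal (decay / (decay - k))"
      by (subst nn_integral_cmult) (auto simp: nn_integral_exponential_density_exp[OF k(2) decay_pos])
    finally show ?thesis by (simp add: ennreal_mult_less_top)
  qed
  have "(\<integral>\<^sup>+x. ?h x \<partial>\<pi>) \<le> (\<integral>\<^sup>+x. ennreal (exp (k * ?g)) + ?h x * indicator {?g<..} x + ?h x * indicator {..<- ?g} x \<partial>\<pi>)"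
  proof (intro nn_integral_mono)
    fix x
    show "?h x \<le> ennreal (exp (k * ?g)) + ?h x * indicator {?g<..} x + ?h x * indicator {..<- ?g} x"
    proof (cases "\<bar>x\<bar> \<le> ?g")
      case True
      then have "?h x \<le> ennreal (exp (k * ?g))"
        using k by (auto intro!: ennreal_leI mult_left_mono)
      then show ?thesis by (simp add: add_increasing2 add.assoc)
    next
      case False
      then have "x \<in> {?g<..} \<or> x \<in> {..<- ?g}" by auto
      then show ?thesis by (auto simp: add_increasing add_increasing2)
    qed
  qed
  also have "\<dots> = (\<integral>\<^sup>+x. ennreal (exp (k * ?g)) \<partial>\<pi>) + (\<integral>\<^sup>+x. ?h x * indicator {?g<..} x \<partial>\<pi>)
      + (\<integral>\<^sup>+x. ?h x * indicator {..<- ?g} x \<partial>\<pi>)"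
    by (simp add: nn_integral_add)
  also have "\<dots> = ennreal (exp (k * ?g)) + emeasure \<pi> {?g<..} * (\<integral>\<^sup>+u. ennreal (exponential_density decay u) * ?h (?g + u) \<partial>lborel)
      + emeasure \<pi> {..<- ?g} * (\<integral>\<^sup>+u. ennreal (exponential_density decay u) * ?h (- ?g - u) \<partial>lborel)"
  proof -
    have hm: "?h \<in> borel_measurable borel" by measurable
    have const: "(\<integral>\<^sup>+x. ennreal (exp (k * ?g)) \<partial>\<pi>) = ennreal (exp (k * ?g))"
      by (simp add: \<pi>.emeasure_space_1[simplified])
    show ?thesis unfolding const nn_integral_\<pi>_tails[OF hm] ..
  qed
  also have "\<dots> < \<infinity>"
    using tail[of "\<lambda>u. ?g + u"] tail[of "\<lambda>u. - ?g - u"] g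
    by (auto simp: ennreal_mult_less_top \<pi>.emeasure_eq_measure)
  finally show "(\<integral>\<^sup>+x. ?h x \<partial>\<pi>) < \<infinity>" .
qed auto

lemma integrable_\<pi>_moments: "integrable \<pi> (\<lambda>x. x)" "integrable \<pi> (\<lambda>x. x\<^sup>2)"
proof -
  let ?k = "decay / 2"
  have k: "0 < ?k" using decay_pos by simp
  have int: "integrable \<pi> (\<lambda>x. C * exp (?k * \<bar>x\<bar>))" for C
    using integrable_\<pi>_exp[of ?k] decay_pos by simp
  show "integrable \<pi> (\<lambda>x. x)"
  proof (rule Bochner_Integration.integrable_bound[OF int[of "1 / ?k"]])
    have "\<bar>x\<bar> \<le> 1 / ?k * exp (?k * \<bar>x\<bar>)" for x
      using exp_ge_add_one_self[of "?k * \<bar>x\<bar>"] k by (simp add: field_simps)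
    then show "AE x in \<pi>. norm x \<le> norm (1 / ?k * exp (?k * \<bar>x\<bar>))"
      using k by (intro AE_I2) (simp add: abs_mult)
  qed simp
  show "integrable \<pi> (\<lambda>x. x\<^sup>2)"
  proof (rule Bochner_Integration.integrable_bound[OF int[of "2 / ?k\<^sup>2"]])
    have "x\<^sup>2 \<le> 2 / ?k\<^sup>2 * exp (?k * \<bar>x\<bar>)" for x
    proof -
      have "1 + ?k * \<bar>x\<bar> + (?k * \<bar>x\<bar>)\<^sup>2 / 2 \<le> exp (?k * \<bar>x\<bar>)"
        using k by (intro exp_lower_Taylor_quadratic) simp
      moreover have "0 \<le> ?k * \<bar>x\<bar>" using k by simp
      moreover have "(?k * \<bar>x\<bar>)\<^sup>2 = ?k\<^sup>2 * x\<^sup>2" by (simp only: power_mult_distrib power2_abs)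
      ultimately have "?k\<^sup>2 * x\<^sup>2 \<le> 2 * exp (?k * \<bar>x\<bar>)"
        by linarith
      then show ?thesis using k by (simp add: field_simps)
    qed
    then show "AE x in \<pi>. norm (x\<^sup>2) \<le> norm (2 / ?k\<^sup>2 * exp (?k * \<bar>x\<bar>))"
      using k by (intro AE_I2) (simp add: abs_mult)
  qed simp
qed

lemma integrable_reset: "integrable \<pi> (clip)" "integrable \<pi> (\<lambda>x. (clip x)\<^sup>2)"
proof -
  show "integrable \<pi> (clip)"
    using abs_reset_le_threshold by (intro \<pi>.integrable_const_bound[where B="\<gamma> + \<delta>"]) auto
  show "integrable \<pi> (\<lambda>x. (clip x)\<^sup>2)"
  proof (rule \<pi>.integrable_const_bound[where B="(\<gamma> + \<delta>)\<^sup>2"])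
    have "(clip x)\<^sup>2 \<le> (\<gamma> + \<delta>)\<^sup>2" for x
      using power_mono[OF abs_reset_le_threshold[of x], of 2] by simp
    then show "AE x in \<pi>. norm ((clip x)\<^sup>2) \<le> (\<gamma> + \<delta>)\<^sup>2" by simp
  qed simp
qed

lemma jump_law_moments:
  "integrable jump_law (\<lambda>l. l)" "integrable jump_law (\<lambda>l. l\<^sup>2)"
  "(\<integral>l. l \<partial>jump_law) = 0" "(\<integral>l. l\<^sup>2 \<partial>jump_law) = 2 / decay\<^sup>2"
proof -
  have "(\<integral>\<^sup>+l. ennreal (l\<^sup>2) \<partial>jump_law) = ennreal (2 / decay\<^sup>2)"
    using nn_integral_laplace_square[OF decay_pos] by (simp add: nn_integral_density)
  then have sq: "has_bochner_integral jump_law (\<lambda>l. l\<^sup>2) (2 / decay\<^sup>2)"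
    by (intro has_bochner_integral_nn_integral) auto
  then show sq': "integrable jump_law (\<lambda>l. l\<^sup>2)" "(\<integral>l. l\<^sup>2 \<partial>jump_law) = 2 / decay\<^sup>2"
    by (auto simp: has_bochner_integral_iff)
  show "integrable jump_law (\<lambda>l. l)"
  proof (rule Bochner_Integration.integrable_bound[where f="\<lambda>l. 1 + l\<^sup>2"])
    have "\<bar>l\<bar> \<le> 1 + l\<^sup>2" for l :: real
      using sum_squares_ge_zero[of "\<bar>l\<bar> - 1" "\<bar>l\<bar>"] by (simp add: power2_eq_square algebra_simps)
    then show "AE l in jump_law. norm l \<le> norm (1 + l\<^sup>2)"
      by (intro AE_I2) (simp add: add_nonneg_nonneg)
  qed (use sq' in auto)
  show "(\<integral>l. l \<partial>jump_law) = 0"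
    by (rule integral_laplace_id[OF decay_pos])
qed

lemma integral_\<pi>:
  fixes h :: "real \<Rightarrow> real"
  assumes h: "integrable \<pi> h"
  shows "(\<integral>x. h x \<partial>\<pi>) = (\<integral>x. (\<integral>l. h (clip x + l) \<partial>jump_law) \<partial>\<pi>)"
proof -
  have [measurable]: "h \<in> borel_measurable borel"
    using borel_measurable_integrable[OF h] by simp
  have "integrable (distr (\<pi> \<Otimes>\<^sub>M jump_law) borel (\<lambda>(x, l). clip x + l)) h"
    using h \<pi>_convolution by simp
  then have int: "integrable (\<pi> \<Otimes>\<^sub>M jump_law) (\<lambda>p. h (case p of (x, l) \<Rightarrow> clip x + l))"
    by (subst (asm) integrable_distr_eq) auto
  have "(\<integral>x. h x \<partial>\<pi>) = (\<integral>x. h x \<partial>distr (\<pi> \<Otimes>\<^sub>M jump_law) borel (\<lambda>(x, l). clip x + l))"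
    using \<pi>_convolution by simp
  also have "\<dots> = (\<integral>p. h (case p of (x, l) \<Rightarrow> clip x + l) \<partial>(\<pi> \<Otimes>\<^sub>M jump_law))"
    by (rule integral_distr) auto
  also have "\<dots> = (\<integral>x. (\<integral>l. h (clip x + l) \<partial>jump_law) \<partial>\<pi>)"
    using \<pi>_jump.integral_fst'[OF int] by simp
  finally show ?thesis .
qed

text \<open>The jump has mean zero, so x and \<open>clip x\<close> have equal means under
  \<open>\<pi>\<close>. Their difference is the excess over \<gamma> on the upper tail and minus
  that excess on the lower one. Conditionally on either tail the excess has mean \<delta> + 1 /
  \<theta> > 0, so the two masses must balance.\<close>

lemma tails_symmetric: "measure \<pi> {\<gamma> + \<delta><..} = measure \<pi> {..<- (\<gamma> + \<delta>)}"
proof -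
  let ?g = "\<gamma> + \<delta>"
  let ?c = "\<delta> + 1 / decay"
  have c: "0 < ?c" using decay_pos \<delta>_nonneg by (simp add: add_nonneg_pos)
  have mean: "(\<integral>\<^sup>+u. ennreal (exponential_density decay u) * ennreal (\<delta> + u) \<partial>lborel) = ennreal ?c"
  proof -
    have "(\<integral>\<^sup>+u. ennreal (exponential_density decay u) * ennreal (\<delta> + u) \<partial>lborel)
      = (\<integral>\<^sup>+u. ennreal \<delta> * ennreal (exponential_density decay u) + ennreal (exponential_density decay u * u) \<partial>lborel)"
    proof (intro nn_integral_cong)
      fix u
      show "ennreal (exponential_density decay u) * ennreal (\<delta> + u)
          = ennreal \<delta> * ennreal (exponential_density decay u) + ennreal (exponential_density decay u * u)"
      proof (cases "0 \<le> u")
        case True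
        then show ?thesis
          using \<delta>_nonneg exponential_density_nonneg[OF decay_pos, of u]
          by (simp add: ennreal_plus[symmetric] ennreal_mult[symmetric] algebra_simps del: ennreal_plus)
      qed (simp add: exponential_density_def)
    qed
    also have "\<dots> = ennreal \<delta> * 1 + ennreal (1 / decay)"
      using nn_integral_erlang_ith_moment[OF decay_pos, of 0 0] nn_integral_erlang_ith_moment[OF decay_pos, of 0 1]
      by (simp add: nn_integral_add nn_integral_cmult)
    also have "\<dots> = ennreal ?c"
      using \<delta>_nonneg decay_pos by (simp add: ennreal_plus)
    finally show ?thesis .
  qed
  have excess: "has_bochner_integral \<pi> (\<lambda>x. (s * x - \<gamma>) * indicator {?g<..} (s * x)) (measure \<pi> {x. ?g < s * x} * ?c)"
    if s: "s = 1 \<or> s = - 1" for s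
  proof (rule has_bochner_integral_nn_integral)
    have "(\<integral>\<^sup>+x. ennreal ((s * x - \<gamma>) * indicator {?g<..} (s * x)) \<partial>\<pi>) = (\<integral>\<^sup>+x. ennreal (s * x - \<gamma>) * indicator {?g<..} (s * x) \<partial>\<pi>)"
      by (intro nn_integral_cong) (auto split: split_indicator)
    also have "\<dots> = emeasure \<pi> {x. ?g < s * x} * (\<integral>\<^sup>+u. ennreal (exponential_density decay u) * ennreal (\<delta> + u) \<partial>lborel)"
    proof -
      have "s * (s * (?g + u)) - \<gamma> = \<delta> + u" for u using s by auto
      then show ?thesis by (subst nn_integral_\<pi>_tail[OF s]) simp_all
    qed
    finally show "(\<integral>\<^sup>+x. ennreal ((s * x - \<gamma>) * indicator {?g<..} (s * x)) \<partial>\<pi>) = ennreal (measure \<pi> {x. ?g < s * x} * ?c)"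
      unfolding mean using c by (simp add: \<pi>.emeasure_eq_measure ennreal_mult)
  qed (use c \<delta>_nonneg in \<open>auto split: split_indicator\<close>)
  have "(\<integral>x. x \<partial>\<pi>) = (\<integral>x. (\<integral>l. clip x + l \<partial>jump_law) \<partial>\<pi>)"
    by (rule integral_\<pi>[OF integrable_\<pi>_moments(1)])
  also have "\<dots> = (\<integral>x. clip x \<partial>\<pi>)"
    using jump_law_moments by (simp add: jump_law.prob_space[simplified])
  finally have "(\<integral>x. x - clip x \<partial>\<pi>) = 0"
    using integrable_\<pi>_moments(1) integrable_reset(1) by simp
  moreover have "x - clip x = (1 * x - \<gamma>) * indicator {?g<..} (1 * x) - (- 1 * x - \<gamma>) * indicator {?g<..} (- 1 * x)" for x
    using \<gamma>_pos \<delta>_nonneg by (auto simp: reset_def split: split_indicator)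
  ultimately have "measure \<pi> {x. ?g < 1 * x} * ?c = measure \<pi> {x. ?g < - 1 * x} * ?c"
    using has_bochner_integral_diff[OF excess[of 1] excess[of "- 1"]] by (simp only: has_bochner_integral_iff simp_thms) simp
  moreover have "{x. ?g < 1 * x} = {?g<..}" "{x. ?g < - 1 * x} = {..<- ?g}" by auto
  ultimately show ?thesis using c by simp
qed

text \<open>Stationarity of the second moment: the jump adds its variance 2 / \<theta>^2, and the
  resets must remove as much. Each reset lowers the square by at least (\<gamma> + \<delta>)^2 -
  \<gamma>^2. For \<delta> = 0 this lower bound is 0 and nothing is learnt about the mass.\<close>

lemma trade_prob_le:
  "trade_prob \<gamma> \<delta> \<pi> * ((\<gamma> + \<delta>)\<^sup>2 - \<gamma>\<^sup>2) \<le> 2 / decay\<^sup>2"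
proof -
  let ?g = "\<gamma> + \<delta>"
  have "(\<integral>x. x\<^sup>2 \<partial>\<pi>) = (\<integral>x. (\<integral>l. (clip x + l)\<^sup>2 \<partial>jump_law) \<partial>\<pi>)"
    by (rule integral_\<pi>[OF integrable_\<pi>_moments(2)])
  also have "\<dots> = (\<integral>x. (clip x)\<^sup>2 + 2 / decay\<^sup>2 \<partial>\<pi>)"
    using jump_law_moments by (simp add: power2_sum jump_law.prob_space[simplified])
  also have "\<dots> = (\<integral>x. (clip x)\<^sup>2 \<partial>\<pi>) + 2 / decay\<^sup>2"
    using integrable_reset(2) by (simp add: \<pi>.prob_space[simplified])
  finally have eq: "(\<integral>x. x\<^sup>2 - (clip x)\<^sup>2 \<partial>\<pi>) = 2 / decay\<^sup>2"
    using integrable_\<pi>_moments(2) integrable_reset(2) by simp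
  have "(\<integral>x. (?g\<^sup>2 - \<gamma>\<^sup>2) * indicator {?g<..} x + (?g\<^sup>2 - \<gamma>\<^sup>2) * indicator {..<- ?g} x \<partial>\<pi>)
      \<le> (\<integral>x. x\<^sup>2 - (clip x)\<^sup>2 \<partial>\<pi>)"
  proof (rule integral_mono)
    fix x
    have "?g\<^sup>2 \<le> x\<^sup>2" if "?g < \<bar>x\<bar>"
      using that \<gamma>_pos \<delta>_nonneg power_mono[of ?g "\<bar>x\<bar>" 2] by simp
    then show "(?g\<^sup>2 - \<gamma>\<^sup>2) * indicator {?g<..} x + (?g\<^sup>2 - \<gamma>\<^sup>2) * indicator {..<- ?g} x \<le> x\<^sup>2 - (clip x)\<^sup>2"
      using \<gamma>_pos \<delta>_nonneg by (auto simp: reset_def split: split_indicator)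
  qed (use integrable_\<pi>_moments(2) integrable_reset(2) in \<open>auto simp: \<pi>.emeasure_eq_measure\<close>)
  also have "(\<integral>x. (?g\<^sup>2 - \<gamma>\<^sup>2) * indicator {?g<..} x + (?g\<^sup>2 - \<gamma>\<^sup>2) * indicator {..<- ?g} x \<partial>\<pi>)
      = trade_prob \<gamma> \<delta> \<pi> * (?g\<^sup>2 - \<gamma>\<^sup>2)"
    by (subst Bochner_Integration.integral_add) (auto simp: trade_prob_def \<pi>.emeasure_eq_measure algebra_simps)
  finally show ?thesis unfolding eq .
qed

lemma trade_prob_eq: "trade_prob \<gamma> \<delta> \<pi> = 2 * measure \<pi> {\<gamma> + \<delta><..}"
  using tails_symmetric by (simp add: trade_prob_def)

end

section \<open>The arbitrage rate\<close>

text \<open>\<open>F w z\<close> is the profit from an arrival at log-price \<open>w\<close> (relative to the initial price) and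
  mispricing \<open>z\<close>.\<close>

locale profit_setting = mispricing_setting M B rate \<tau> \<sigma> \<gamma> \<delta> \<pi> z0
  for M :: "'a measure" and B :: "real \<Rightarrow> 'a \<Rightarrow> real" and rate :: real and \<tau> :: "nat \<Rightarrow> 'a \<Rightarrow> real"
    and \<sigma> \<gamma> \<delta> :: real and \<pi> :: "real measure" and z0 :: "'a \<Rightarrow> real" +
  fixes F :: "real \<Rightarrow> real \<Rightarrow> real" and C k :: real
  assumes F_nonneg: "0 \<le> F w z"
    and F_continuous: "continuous_on UNIV (\<lambda>p. F (fst p) (snd p))"
    and F_growth: "F w z \<le> C * exp (k * (\<bar>w\<bar> + \<bar>z\<bar>))"
    and C_nonneg: "0 \<le> C" and k_nonneg: "0 \<le> k"
begin

lemma measurable_F [measurable (raw)]: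
  "a \<in> borel_measurable N \<Longrightarrow> b \<in> borel_measurable N \<Longrightarrow> (\<lambda>n. F (a n) (b n)) \<in> borel_measurable N"
  by (rule borel_measurable_continuous_Pair[OF _ _ F_continuous])

text \<open>Two sample points occur: w drives the Brownian path and w' the arrivals. Keeping them
  apart allows the arrival times to be frozen; the actual gain is the diagonal w = w'.\<close>

definition gain :: "nat \<Rightarrow> real \<Rightarrow> 'a \<Rightarrow> 'a \<Rightarrow> real" where
  "gain j x w w' = F (\<sigma> * B (\<tau> (Suc j) w') w) (pre_arrival \<sigma> \<gamma> \<delta> (\<lambda>s. B s w) (\<lambda>i. \<tau> i w') x j)"

lemma gain_nonneg: "0 \<le> gain j x w w'"
  by (simp add: gain_def F_nonneg)

lemma measurable_gain [measurable (raw)]: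
  assumes [measurable]: "x \<in> borel_measurable N" "g \<in> N \<rightarrow>\<^sub>M arrival_algebra" "h \<in> N \<rightarrow>\<^sub>M path_algebra"
  shows "(\<lambda>n. gain j (x n) (h n) (g n)) \<in> borel_measurable N"
  unfolding gain_def by measurable

definition total_gain :: "real \<Rightarrow> real \<Rightarrow> 'a \<Rightarrow> real" where
  "total_gain T x w = (\<Sum>j<arrival_count (\<lambda>i. \<tau> i w) T. gain j x w w)"

lemma total_gain_nonneg: "0 \<le> total_gain T x w"
  by (simp add: total_gain_def sum_nonneg gain_nonneg)

lemma measurable_total_gain [measurable]:
  assumes T: "0 \<le> T"
  shows "(\<lambda>(x, w). total_gain T x w) \<in> borel_measurable (borel \<Otimes>\<^sub>M driver_algebra)"
proof -
  have [measurable]: "(\<lambda>p. snd p) \<in> borel \<Otimes>\<^sub>M driver_algebra \<rightarrow>\<^sub>M arrival_algebra"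
    "(\<lambda>p. snd p) \<in> borel \<Otimes>\<^sub>M driver_algebra \<rightarrow>\<^sub>M path_algebra"
    by (auto intro: measurable_compose[OF measurable_snd] measurable_driver_sources)
  have "(\<lambda>p. \<Sum>j<arrival_count (\<lambda>i. \<tau> i (snd p)) T. gain j (fst p) (snd p) (snd p))
      \<in> borel_measurable (borel \<Otimes>\<^sub>M driver_algebra)"
    by (rule measurable_compose_countable[where f="\<lambda>n p. \<Sum>j<n. gain j (fst p) (snd p) (snd p)"])
       (use T in measurable)
  then show ?thesis
    by (simp add: total_gain_def split_beta')
qed

lemma abs_path_le:
  assumes "w \<in> space M" "w' \<in> space M"
  shows "\<bar>B (\<tau> n w') w\<bar> \<le> (\<Sum>i<n. \<bar>B (\<tau> (Suc i) w') w - B (\<tau> i w') w\<bar>)"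
proof -
  have "B (\<tau> n w') w = (\<Sum>i<n. B (\<tau> (Suc i) w') w - B (\<tau> i w') w)"
    using sum_lessThan_telescope[of "\<lambda>i. B (\<tau> i w') w" n] \<tau>_0[OF assms(2)] B_0[OF assms(1)] by simp
  then show ?thesis using sum_abs by metis
qed

text \<open>The log-price and the mispricing are each bounded through the same sum of absolute
  increments, whence the factor 2 in the exponent.\<close>

lemma gain_le:
  assumes "w \<in> space M" "w' \<in> space M"
  shows "gain j x w w' \<le> C * exp (k * \<bar>x\<bar>)
    * exp (2 * k * \<sigma> * (\<Sum>i<Suc j. \<bar>B (\<tau> (Suc i) w') w - B (\<tau> i w') w\<bar>))"
proof -
  let ?S = "\<Sum>i<Suc j. \<bar>B (\<tau> (Suc i) w') w - B (\<tau> i w') w\<bar>"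
  let ?w = "\<sigma> * B (\<tau> (Suc j) w') w" and ?z = "pre_arrival \<sigma> \<gamma> \<delta> (\<lambda>s. B s w) (\<lambda>i. \<tau> i w') x j"
  have "\<bar>?w\<bar> \<le> \<sigma> * ?S"
    using abs_path_le[OF assms, of "Suc j"] \<sigma>_pos by (simp add: abs_mult del: sum.lessThan_Suc)
  moreover have "\<bar>?z\<bar> \<le> \<bar>x\<bar> + \<sigma> * ?S"
    using \<gamma>_pos \<delta>_nonneg \<sigma>_pos by (intro abs_pre_arrival_le) auto
  ultimately have "k * (\<bar>?w\<bar> + \<bar>?z\<bar>) \<le> k * (\<bar>x\<bar> + 2 * \<sigma> * ?S)"
    using k_nonneg by (intro mult_left_mono) auto
  also have "\<dots> = k * \<bar>x\<bar> + 2 * k * \<sigma> * ?S"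
    by (simp only: distrib_left mult_ac)
  finally have "exp (k * (\<bar>?w\<bar> + \<bar>?z\<bar>)) \<le> exp (k * \<bar>x\<bar>) * exp (2 * k * \<sigma> * ?S)"
    by (simp only: exp_add[symmetric] exp_le_cancel_iff)
  then have "C * exp (k * (\<bar>?w\<bar> + \<bar>?z\<bar>)) \<le> C * (exp (k * \<bar>x\<bar>) * exp (2 * k * \<sigma> * ?S))"
    using C_nonneg by (rule mult_left_mono)
  with F_growth[of ?w ?z] show ?thesis
    by (simp only: gain_def mult.assoc)
qed

lemma nn_integral_gain_le:
  assumes w': "w' \<in> space M"
  shows "(\<integral>\<^sup>+w. ennreal (gain j x w w') \<partial>M)
    \<le> ennreal (C * exp (k * \<bar>x\<bar>) * (2 ^ Suc j * exp (2 * k\<^sup>2 * \<sigma>\<^sup>2 * \<tau> (Suc j) w')))"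
proof -
  let ?E = "\<lambda>w. exp (2 * k * \<sigma> * (\<Sum>i<Suc j. \<bar>B (\<tau> (Suc i) w') w - B (\<tau> i w') w\<bar>))"
  have [simp]: "0 \<le> \<tau> i w'" for i using \<tau>_nonneg[OF w'] .
  have "(\<integral>\<^sup>+w. ennreal (gain j x w w') \<partial>M) \<le> (\<integral>\<^sup>+w. ennreal (C * exp (k * \<bar>x\<bar>)) * ennreal (?E w) \<partial>M)"
    using gain_le[OF _ w', of _ j x] C_nonneg
    by (intro nn_integral_mono) (simp add: ennreal_mult'[symmetric] ennreal_leI del: sum.lessThan_Suc)
  also have "\<dots> = ennreal (C * exp (k * \<bar>x\<bar>)) * (\<integral>\<^sup>+w. ennreal (?E w) \<partial>M)"
    by (rule nn_integral_cmult) measurable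
  also have "\<dots> \<le> ennreal (C * exp (k * \<bar>x\<bar>)) * ennreal (2 ^ Suc j * exp ((2 * k * \<sigma>)\<^sup>2 * (\<tau> (Suc j) w' - \<tau> 0 w') / 2))"
    using \<tau>_less_Suc[OF w'] by (intro mult_left_mono nn_integral_exp_increments_le) auto
  also have "\<dots> = ennreal (C * exp (k * \<bar>x\<bar>) * (2 ^ Suc j * exp ((2 * k * \<sigma>)\<^sup>2 * (\<tau> (Suc j) w' - \<tau> 0 w') / 2)))"
    using C_nonneg by (intro ennreal_mult[symmetric]) auto
  also have "(2 * k * \<sigma>)\<^sup>2 * (\<tau> (Suc j) w' - \<tau> 0 w') / 2 = 2 * k\<^sup>2 * \<sigma>\<^sup>2 * \<tau> (Suc j) w'"
    by (simp add: \<tau>_0[OF w'] power_mult_distrib)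
  finally show ?thesis .
qed

definition expected_gain :: "nat \<Rightarrow> real \<Rightarrow> real \<Rightarrow> ennreal" where
  "expected_gain j T x = (\<integral>\<^sup>+w. ennreal (gain j x w w) * indicator {..T} (\<tau> (Suc j) w) \<partial>M)"

lemma expected_gain_eq:
  "expected_gain j T x = (\<integral>\<^sup>+w'. (\<integral>\<^sup>+w. ennreal (gain j x w w') \<partial>M) * indicator {..T} (\<tau> (Suc j) w') \<partial>M)"
proof -
  have "expected_gain j T x = (\<integral>\<^sup>+w'. (\<integral>\<^sup>+w. ennreal (gain j x w w') * indicator {..T} (\<tau> (Suc j) w') \<partial>M) \<partial>M)"
    unfolding expected_gain_def by (rule nn_integral_path_arrival) measurable
  also have "\<dots> = (\<integral>\<^sup>+w'. (\<integral>\<^sup>+w. ennreal (gain j x w w') \<partial>M) * indicator {..T} (\<tau> (Suc j) w') \<partial>M)"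
  proof (intro nn_integral_cong nn_integral_multc)
    fix w' assume w': "w' \<in> space M"
    have [measurable]: "(\<lambda>w. w') \<in> M \<rightarrow>\<^sub>M arrival_algebra" using w' by simp
    show "(\<lambda>w. ennreal (gain j x w w')) \<in> borel_measurable M" by measurable
  qed
  finally show ?thesis .
qed

text \<open>The exponential is the value at time 1 of the variance factor in
  \<open>nn_integral_gain_le\<close>; horizons T <= 1 are considered.\<close>

definition gain_bound :: real where
  "gain_bound = C * exp (2 * k\<^sup>2 * \<sigma>\<^sup>2)"

lemma gain_bound_nonneg: "0 \<le> gain_bound"
  by (simp add: gain_bound_def C_nonneg)

text \<open>The Gaussian bound contributes one factor 2 per increment and the arrival probability
  one factor l T, so the gains decay geometrically in j for small T.\<close>

lemma expected_gain_le:
  assumes T: "0 \<le> T" "T \<le> 1"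
  shows "expected_gain j T x \<le> ennreal (gain_bound * exp (k * \<bar>x\<bar>) * (2 * rate * T) ^ Suc j)"
proof -
  let ?K = "gain_bound * exp (k * \<bar>x\<bar>) * 2 ^ Suc j"
  have K: "0 \<le> ?K" by (simp add: gain_bound_nonneg)
  have "expected_gain j T x \<le> (\<integral>\<^sup>+w'. ennreal ?K * indicator {w' \<in> space M. \<tau> (Suc j) w' \<le> T} w' \<partial>M)"
    unfolding expected_gain_eq
  proof (intro nn_integral_mono)
    fix w' assume w': "w' \<in> space M"
    show "(\<integral>\<^sup>+w. ennreal (gain j x w w') \<partial>M) * indicator {..T} (\<tau> (Suc j) w')
      \<le> ennreal ?K * indicator {w' \<in> space M. \<tau> (Suc j) w' \<le> T} w'"
    proof (cases "\<tau> (Suc j) w' \<le> T")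
      case True
      have "2 * k\<^sup>2 * \<sigma>\<^sup>2 * \<tau> (Suc j) w' \<le> 2 * k\<^sup>2 * \<sigma>\<^sup>2 * 1"
        using True T by (intro mult_left_mono) auto
      then have "C * exp (k * \<bar>x\<bar>) * (2 ^ Suc j * exp (2 * k\<^sup>2 * \<sigma>\<^sup>2 * \<tau> (Suc j) w'))
          \<le> C * exp (k * \<bar>x\<bar>) * (2 ^ Suc j * exp (2 * k\<^sup>2 * \<sigma>\<^sup>2))"
        using C_nonneg by (intro mult_left_mono) auto
      also have "\<dots> = ?K" by (simp add: gain_bound_def)
      finally have "(\<integral>\<^sup>+w. ennreal (gain j x w w') \<partial>M) \<le> ennreal ?K"
        by (rule order_trans[OF nn_integral_gain_le[OF w'] ennreal_leI])
      then show ?thesis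
        using True w' by simp
    qed simp
  qed
  also have "\<dots> = ennreal ?K * ennreal (prob {w' \<in> space M. \<tau> (Suc j) w' \<le> T})"
    by (subst nn_integral_cmult_indicator) (auto simp: emeasure_eq_measure)
  also have "\<dots> \<le> ennreal ?K * ennreal ((rate * T) ^ Suc j)"
    using prob_arrival_le[OF T(1), of "Suc j"] by (intro mult_left_mono ennreal_leI) auto
  also have "\<dots> = ennreal (?K * (rate * T) ^ Suc j)"
    using K by (simp only: ennreal_mult'[symmetric])
  also have "?K * (rate * T) ^ Suc j = gain_bound * exp (k * \<bar>x\<bar>) * (2 * rate * T) ^ Suc j"
    by (simp only: mult.assoc power_mult_distrib)
  finally show ?thesis .
qed

text \<open>The random number of summands is encoded by the indicators of
  \<open>\<tau> (Suc j) \<le> T\<close>, after which sum and integral may be exchanged.\<close>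

lemma nn_integral_total_gain:
  assumes T: "0 \<le> T"
  shows "(\<integral>\<^sup>+w. ennreal (total_gain T x w) \<partial>M) = (\<Sum>j. expected_gain j T x)"
proof -
  have "(\<integral>\<^sup>+w. ennreal (total_gain T x w) \<partial>M)
      = (\<integral>\<^sup>+w. (\<Sum>j. ennreal (gain j x w w) * indicator {..T} (\<tau> (Suc j) w)) \<partial>M)"
  proof (intro nn_integral_cong)
    fix w assume w: "w \<in> space M"
    let ?n = "arrival_count (\<lambda>i. \<tau> i w) T"
    have iff: "\<tau> (Suc j) w \<le> T \<longleftrightarrow> j < ?n" for j
      using le_arrival_count_\<tau>_iff[OF w T, of "Suc j"] by (simp add: Suc_le_eq)
    have "(\<Sum>j. ennreal (gain j x w w) * indicator {..T} (\<tau> (Suc j) w))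
       = (\<Sum>j<?n. ennreal (gain j x w w) * indicator {..T} (\<tau> (Suc j) w))"
      by (rule suminf_finite) (auto simp: iff split: split_indicator)
    also have "\<dots> = (\<Sum>j<?n. ennreal (gain j x w w))"
      by (intro sum.cong) (auto simp: iff split: split_indicator)
    also have "\<dots> = ennreal (total_gain T x w)"
      unfolding total_gain_def by (rule sum_ennreal) (simp add: gain_nonneg)
    finally show "ennreal (total_gain T x w) = (\<Sum>j. ennreal (gain j x w w) * indicator {..T} (\<tau> (Suc j) w))" ..
  qed
  also have "\<dots> = (\<Sum>j. expected_gain j T x)"
    unfolding expected_gain_def by (rule nn_integral_suminf) measurable
  finally show ?thesis .
qed

text \<open>The condition \<open>4 * rate * T \<le> 1\<close> makes the geometric ratio at most 1/2,
  so the series is at most twice its first term, which is of order T^2.\<close>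

lemma later_gains_le:
  assumes T: "0 \<le> T" "T \<le> 1" "4 * rate * T \<le> 1"
  shows "(\<Sum>j. expected_gain (Suc j) T x) \<le> ennreal (gain_bound * exp (k * \<bar>x\<bar>) * (2 * (2 * rate * T)\<^sup>2))"
proof -
  let ?K = "gain_bound * exp (k * \<bar>x\<bar>)" and ?q = "2 * rate * T"
  have K: "0 \<le> ?K" by (simp add: gain_bound_nonneg)
  have q: "0 \<le> ?q" "?q \<le> 1 / 2" using T rate_pos by auto
  have sums: "(\<lambda>j. ?K * ?q ^ Suc (Suc j)) sums (?K * ?q\<^sup>2 * (1 / (1 - ?q)))"
    using sums_mult[OF geometric_sums[of ?q], of "?K * ?q\<^sup>2"] q by (simp add: power2_eq_square mult.assoc)
  have "(\<Sum>j. expected_gain (Suc j) T x) \<le> (\<Sum>j. ennreal (?K * ?q ^ Suc (Suc j)))"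
    using T by (intro suminf_le expected_gain_le) auto
  also have "\<dots> = ennreal (\<Sum>j. ?K * ?q ^ Suc (Suc j))"
    by (rule suminf_ennreal2[OF mult_nonneg_nonneg[OF K zero_le_power[OF q(1)]] sums_summable[OF sums]])
  also have "(\<Sum>j. ?K * ?q ^ Suc (Suc j)) = ?K * ?q\<^sup>2 * (1 / (1 - ?q))"
    using sums by (simp add: sums_iff)
  also have "\<dots> \<le> ?K * ?q\<^sup>2 * 2"
  proof (rule mult_left_mono)
    show "1 / (1 - ?q) \<le> 2" using q by (simp add: pos_divide_le_eq)
  qed (use K in simp)
  finally show ?thesis by (simp add: ennreal_leI mult_ac)
qed

lemma total_gain_split:
  assumes T: "0 \<le> T"
  shows "(\<integral>\<^sup>+w. ennreal (total_gain T x w) \<partial>M) = expected_gain 0 T x + (\<Sum>j. expected_gain (Suc j) T x)"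
  unfolding nn_integral_total_gain[OF T]
  using suminf_offset[OF summableI, of "\<lambda>j. expected_gain j T x" 1] by simp

section \<open>The first arrival at small times\<close>

definition mean_gain :: "real \<Rightarrow> real \<Rightarrow> ennreal" where
  "mean_gain s x = (\<integral>\<^sup>+w. ennreal (F (\<sigma> * B s w) (x + \<sigma> * B s w)) \<partial>M)"

lemma expected_gain_0:
  "expected_gain 0 T x = (\<integral>\<^sup>+w'. mean_gain (\<tau> (Suc 0) w') x * indicator {..T} (\<tau> (Suc 0) w') \<partial>M)"
  unfolding expected_gain_eq mean_gain_def
proof (intro nn_integral_cong)
  fix w' assume w': "w' \<in> space M"
  have "(\<integral>\<^sup>+w. ennreal (gain 0 x w w') \<partial>M) = (\<integral>\<^sup>+w. ennreal (F (\<sigma> * B (\<tau> (Suc 0) w') w) (x + \<sigma> * B (\<tau> (Suc 0) w') w)) \<partial>M)"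
    by (intro nn_integral_cong) (simp add: gain_def pre_arrival_def \<tau>_0[OF w'] B_0)
  then show "(\<integral>\<^sup>+w. ennreal (gain 0 x w w') \<partial>M) * indicator {..T} (\<tau> (Suc 0) w')
    = (\<integral>\<^sup>+w. ennreal (F (\<sigma> * B (\<tau> (Suc 0) w') w) (x + \<sigma> * B (\<tau> (Suc 0) w') w)) \<partial>M)
      * indicator {..T} (\<tau> (Suc 0) w')"
    by simp
qed

abbreviation gain_at :: "real \<Rightarrow> real \<Rightarrow> real \<Rightarrow> real" where
  "gain_at s x v \<equiv> F (\<sigma> * (sqrt s * v)) (x + \<sigma> * (sqrt s * v))"

text \<open>Brownian scaling moves the dependence on s from the measure into the integrand. For s <=
  1 the bound is uniform in s, which prepares dominated convergence as s tends to 0.\<close>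

lemma mean_gain_eq:
  assumes s: "0 < s" "s \<le> 1"
  shows "mean_gain s x = ennreal (\<integral>v. std_normal_density v * gain_at s x v \<partial>lborel)"
    and "integrable lborel (\<lambda>v. std_normal_density v * gain_at s x v)"
    and "\<And>v. gain_at s x v \<le> C * exp (k * \<bar>x\<bar>) * exp (2 * k * \<sigma> * \<bar>v\<bar>)"
proof -
  let ?F = "\<lambda>v. gain_at s x v"
  show bound: "?F v \<le> C * exp (k * \<bar>x\<bar>) * exp (2 * k * \<sigma> * \<bar>v\<bar>)" for v
  proof -
    have "sqrt s * \<bar>v\<bar> \<le> 1 * \<bar>v\<bar>" using s by (intro mult_right_mono) auto
    then have "\<sigma> * (sqrt s * \<bar>v\<bar>) \<le> \<sigma> * \<bar>v\<bar>" using \<sigma>_pos by simp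
    moreover have "\<bar>\<sigma> * (sqrt s * v)\<bar> = \<sigma> * (sqrt s * \<bar>v\<bar>)" using \<sigma>_pos s by (simp add: abs_mult)
    ultimately have "\<bar>\<sigma> * (sqrt s * v)\<bar> + \<bar>x + \<sigma> * (sqrt s * v)\<bar> \<le> \<bar>x\<bar> + 2 * \<sigma> * \<bar>v\<bar>"
      by linarith
    then have "k * (\<bar>\<sigma> * (sqrt s * v)\<bar> + \<bar>x + \<sigma> * (sqrt s * v)\<bar>) \<le> k * (\<bar>x\<bar> + 2 * \<sigma> * \<bar>v\<bar>)"
      using k_nonneg by (rule mult_left_mono)
    also have "\<dots> = k * \<bar>x\<bar> + 2 * k * \<sigma> * \<bar>v\<bar>" by (simp add: algebra_simps)
    finally have "C * exp (k * (\<bar>\<sigma> * (sqrt s * v)\<bar> + \<bar>x + \<sigma> * (sqrt s * v)\<bar>)) \<le> C * (exp (k * \<bar>x\<bar>) * exp (2 * k * \<sigma> * \<bar>v\<bar>))"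
      using C_nonneg by (intro mult_left_mono) (simp_all only: exp_add[symmetric] exp_le_cancel_iff)
    with F_growth[of "\<sigma> * (sqrt s * v)" "x + \<sigma> * (sqrt s * v)"] show ?thesis by simp
  qed
  show int: "integrable lborel (\<lambda>v. std_normal_density v * ?F v)"
  proof (rule Bochner_Integration.integrable_bound)
    show "integrable lborel (\<lambda>v. C * exp (k * \<bar>x\<bar>) * (std_normal_density v * exp (2 * k * \<sigma> * \<bar>v\<bar>)))"
      using integrable_std_normal_exp[of "2 * k * \<sigma>"] by (rule integrable_mult_right)
    show "AE v in lborel. norm (std_normal_density v * ?F v) \<le> norm (C * exp (k * \<bar>x\<bar>) * (std_normal_density v * exp (2 * k * \<sigma> * \<bar>v\<bar>)))"
    proof (rule AE_I2)
      fix v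
      have "std_normal_density v * ?F v \<le> std_normal_density v * (C * exp (k * \<bar>x\<bar>) * exp (2 * k * \<sigma> * \<bar>v\<bar>))"
        by (intro mult_left_mono bound) simp
      then show "norm (std_normal_density v * ?F v) \<le> norm (C * exp (k * \<bar>x\<bar>) * (std_normal_density v * exp (2 * k * \<sigma> * \<bar>v\<bar>)))"
        using C_nonneg F_nonneg by (simp add: abs_mult mult_ac)
    qed
  qed measurable
  have "mean_gain s x = (\<integral>\<^sup>+w. ennreal (F (\<sigma> * (B s w - B 0 w)) (x + \<sigma> * (B s w - B 0 w))) \<partial>M)"
    unfolding mean_gain_def by (intro nn_integral_cong) (simp add: B_0)
  also have "\<dots> = (\<integral>\<^sup>+y. ennreal (normal_density 0 (sqrt s) y) * ennreal (F (\<sigma> * y) (x + \<sigma> * y)) \<partial>lborel)"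
    using nn_integral_increment[of 0 s "\<lambda>y. ennreal (F (\<sigma> * y) (x + \<sigma> * y))"] s by simp
  also have "\<dots> = ennreal \<bar>sqrt s\<bar> * (\<integral>\<^sup>+v. ennreal (normal_density 0 (sqrt s) (0 + sqrt s * v))
      * ennreal (F (\<sigma> * (0 + sqrt s * v)) (x + \<sigma> * (0 + sqrt s * v))) \<partial>lborel)"
    using s by (intro nn_integral_real_affine) auto
  also have "\<dots> = (\<integral>\<^sup>+v. ennreal \<bar>sqrt s\<bar> * (ennreal (normal_density 0 (sqrt s) (0 + sqrt s * v))
      * ennreal (F (\<sigma> * (0 + sqrt s * v)) (x + \<sigma> * (0 + sqrt s * v)))) \<partial>lborel)"
    by (rule nn_integral_cmult[symmetric]) measurable
  also have "\<dots> = (\<integral>\<^sup>+v. ennreal (std_normal_density v * ?F v) \<partial>lborel)"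
  proof (intro nn_integral_cong)
    fix v
    have "sqrt s * normal_density 0 (sqrt s) (sqrt s * v) = std_normal_density v"
      using s by (simp add: normal_density_def real_sqrt_mult power_mult_distrib)
    then have "ennreal (std_normal_density v) = ennreal (sqrt s) * ennreal (normal_density 0 (sqrt s) (sqrt s * v))"
      using s by (metis ennreal_mult normal_density_nonneg real_sqrt_ge_zero less_imp_le)
    then show "ennreal \<bar>sqrt s\<bar> * (ennreal (normal_density 0 (sqrt s) (0 + sqrt s * v))
      * ennreal (F (\<sigma> * (0 + sqrt s * v)) (x + \<sigma> * (0 + sqrt s * v)))) = ennreal (std_normal_density v * ?F v)"
      using s by (simp add: ennreal_mult' mult.assoc)
  qed
  also have "\<dots> = ennreal (\<integral>v. std_normal_density v * ?F v \<partial>lborel)"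
    using int F_nonneg by (intro nn_integral_eq_integral) auto
  finally show "mean_gain s x = ennreal (\<integral>v. std_normal_density v * ?F v \<partial>lborel)" .
qed

lemma tendsto_mean_gain:
  "((\<lambda>s. \<integral>v. std_normal_density v * gain_at s x v \<partial>lborel) \<longlongrightarrow> F 0 x) (at_right 0)"
proof (rule tendsto_at_right_sequentially[of 0 1])
  fix S :: "nat \<Rightarrow> real"
  assume S: "\<And>n. 0 < S n" "\<And>n. S n < 1" "S \<longlonglongrightarrow> 0"
  have "(\<lambda>n. \<integral>v. std_normal_density v * gain_at (S n) x v \<partial>lborel)
      \<longlonglongrightarrow> (\<integral>v. std_normal_density v * F 0 x \<partial>lborel)"
  proof (rule integral_dominated_convergence)
    show "integrable lborel (\<lambda>v. C * exp (k * \<bar>x\<bar>) * (std_normal_density v * exp (2 * k * \<sigma> * \<bar>v\<bar>)))"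
      using integrable_std_normal_exp[of "2 * k * \<sigma>"] by (rule integrable_mult_right)
    show "AE v in lborel. norm (std_normal_density v * gain_at (S n) x v)
        \<le> C * exp (k * \<bar>x\<bar>) * (std_normal_density v * exp (2 * k * \<sigma> * \<bar>v\<bar>))" for n
    proof (rule AE_I2)
      fix v
      have "std_normal_density v * gain_at (S n) x v
          \<le> std_normal_density v * (C * exp (k * \<bar>x\<bar>) * exp (2 * k * \<sigma> * \<bar>v\<bar>))"
        using S by (intro mult_left_mono mean_gain_eq(3)) (auto intro: less_imp_le)
      then show "norm (std_normal_density v * gain_at (S n) x v)
        \<le> C * exp (k * \<bar>x\<bar>) * (std_normal_density v * exp (2 * k * \<sigma> * \<bar>v\<bar>))"
        using F_nonneg by (simp add: abs_mult mult_ac)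
    qed
    show "AE v in lborel. (\<lambda>n. std_normal_density v * gain_at (S n) x v)
        \<longlonglongrightarrow> std_normal_density v * F 0 x"
    proof (rule AE_I2)
      fix v
      have "(\<lambda>n. (\<sigma> * (sqrt (S n) * v), x + \<sigma> * (sqrt (S n) * v))) \<longlonglongrightarrow> (\<sigma> * (sqrt 0 * v), x + \<sigma> * (sqrt 0 * v))"
        by (intro tendsto_intros S)
      from continuous_on_tendsto_compose[OF F_continuous this]
      show "(\<lambda>n. std_normal_density v * gain_at (S n) x v)
        \<longlonglongrightarrow> std_normal_density v * F 0 x"
        by (intro tendsto_mult tendsto_const) simp
    qed
  qed measurable
  then show "(\<lambda>n. \<integral>v. std_normal_density v * gain_at (S n) x v \<partial>lborel) \<longlonglongrightarrow> F 0 x"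
    by simp
qed simp

lemma expected_gain_0_bounds:
  assumes \<epsilon>: "0 < \<epsilon>"
  shows "\<forall>\<^sub>F T in at_right 0. ennreal ((F 0 x - \<epsilon>) * (1 - exp (- rate * T))) \<le> expected_gain 0 T x
    \<and> expected_gain 0 T x \<le> ennreal ((F 0 x + \<epsilon>) * (1 - exp (- rate * T)))"
proof -
  let ?H = "\<lambda>s. \<integral>v. std_normal_density v * gain_at s x v \<partial>lborel"
  have "\<forall>\<^sub>F s in at_right 0. dist (?H s) (F 0 x) < \<epsilon>"
    using tendsto_mean_gain \<epsilon> by (rule tendstoD)
  then obtain d where d: "0 < d" "\<And>s. 0 < s \<Longrightarrow> s < d \<Longrightarrow> dist (?H s) (F 0 x) < \<epsilon>"
    by (auto simp: eventually_at_right_field)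
  \<comment> \<open>The constant may be negative, as in the lower bound F 0 x - \<epsilon>; both
    sides are then 0 in \<open>ennreal\<close>.\<close>
  have arr: "(\<integral>\<^sup>+w'. ennreal c * indicator {..T} (\<tau> (Suc 0) w') \<partial>M) = ennreal (c * (1 - exp (- rate * T)))"
    if T: "0 \<le> T" for c T
  proof -
    have "(\<integral>\<^sup>+w'. ennreal c * indicator {..T} (\<tau> (Suc 0) w') \<partial>M)
      = (\<integral>\<^sup>+w'. ennreal c * indicator {w' \<in> space M. \<tau> (Suc 0) w' \<le> T} w' \<partial>M)"
      by (intro nn_integral_cong) (auto split: split_indicator)
    also have "\<dots> = ennreal c * ennreal (1 - exp (- rate * T))"
      using prob_first_arrival_le[OF T] by (subst nn_integral_cmult_indicator) (auto simp: emeasure_eq_measure)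
    also have "\<dots> = ennreal (c * (1 - exp (- rate * T)))"
      using T rate_pos by (intro ennreal_mult''[symmetric]) auto
    finally show ?thesis .
  qed
  have "\<forall>\<^sub>F T in at_right 0. T \<in> {0<..<min d 1}"
    using d by (intro eventually_at_right_real) auto
  then show ?thesis
  proof eventually_elim
    case (elim T)
    then have T: "0 \<le> T" "T < d" "T < 1" by auto
    have b: "ennreal (F 0 x - \<epsilon>) \<le> mean_gain (\<tau> (Suc 0) w') x \<and> mean_gain (\<tau> (Suc 0) w') x \<le> ennreal (F 0 x + \<epsilon>)"
      if "w' \<in> space M" "\<tau> (Suc 0) w' \<le> T" for w'
    proof -
      have "0 < \<tau> (Suc 0) w'" using \<tau>_less_Suc[OF that(1), of 0] \<tau>_0[OF that(1)] by simp
      with that T d(2)[of "\<tau> (Suc 0) w'"] mean_gain_eq(1)[of "\<tau> (Suc 0) w'" x]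
      show ?thesis by (auto simp: dist_real_def intro!: ennreal_leI)
    qed
    show ?case
      unfolding expected_gain_0 arr[OF T(1), symmetric]
      using b by (auto intro!: nn_integral_mono split: split_indicator)
  qed
qed

definition mean_total :: "real \<Rightarrow> real \<Rightarrow> real" where
  "mean_total T x = (\<integral>w. total_gain T x w \<partial>M)"

lemma nn_integral_total_gain_le:
  assumes T: "0 \<le> T" "T \<le> 1" "4 * rate * T \<le> 1"
  shows "(\<integral>\<^sup>+w. ennreal (total_gain T x w) \<partial>M) \<le> ennreal (4 * rate * gain_bound * exp (k * \<bar>x\<bar>) * T)"
proof -
  let ?K = "gain_bound * exp (k * \<bar>x\<bar>)" and ?q = "2 * rate * T"
  have K: "0 \<le> ?K" by (simp add: gain_bound_nonneg)
  have q: "0 \<le> ?q" "?q \<le> 1 / 2" using T rate_pos by auto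
  have "(\<integral>\<^sup>+w. ennreal (total_gain T x w) \<partial>M) \<le> ennreal (?K * ?q ^ Suc 0) + ennreal (?K * (2 * ?q\<^sup>2))"
    unfolding total_gain_split[OF T(1)] using T by (intro add_mono expected_gain_le later_gains_le) auto
  also have "\<dots> = ennreal (?K * ?q + ?K * (2 * ?q\<^sup>2))"
    using K q by (subst ennreal_plus) auto
  also have "\<dots> \<le> ennreal (?K * ?q + ?K * ?q)"
  proof (intro ennreal_leI add_left_mono mult_left_mono)
    have "2 * q\<^sup>2 \<le> q" if "0 \<le> q" "q \<le> 1 / 2" for q :: real
      using mult_left_mono[OF that(2,1)] by (simp add: power2_eq_square)
    from this[OF q] show "2 * ?q\<^sup>2 \<le> ?q" .
  qed (rule K)
  also have "?K * ?q + ?K * ?q = 4 * rate * gain_bound * exp (k * \<bar>x\<bar>) * T" by (simp add: algebra_simps)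
  finally show ?thesis .
qed

lemma ennreal_mean_total:
  assumes T: "0 \<le> T" "T \<le> 1" "4 * rate * T \<le> 1"
  shows "ennreal (mean_total T x) = (\<integral>\<^sup>+w. ennreal (total_gain T x w) \<partial>M)"
proof -
  have "(\<integral>\<^sup>+w. ennreal (total_gain T x w) \<partial>M) < \<infinity>"
    using le_less_trans[OF nn_integral_total_gain_le[OF T, of x] ennreal_less_top] by simp
  then have "integrable M (total_gain T x)"
    using T by (intro integrableI_nonneg) (auto simp: total_gain_nonneg)
  then show ?thesis
    unfolding mean_total_def by (intro nn_integral_eq_integral[symmetric]) (auto simp: total_gain_nonneg)
qed

lemma mean_total_nonneg: "0 \<le> mean_total T x"
  unfolding mean_total_def by (intro integral_nonneg_AE) (auto simp: total_gain_nonneg)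

lemma mean_total_le:
  assumes T: "0 \<le> T" "T \<le> 1" "4 * rate * T \<le> 1"
  shows "mean_total T x \<le> 4 * rate * gain_bound * exp (k * \<bar>x\<bar>) * T"
  using nn_integral_total_gain_le[OF T, of x] rate_pos gain_bound_nonneg T
  unfolding ennreal_mean_total[OF T, symmetric] by (subst (asm) ennreal_le_iff) auto

lemma eventually_small_time: "\<forall>\<^sub>F T in at_right 0. 0 < T \<and> T \<le> 1 \<and> 4 * rate * T \<le> 1"
proof -
  have "\<forall>\<^sub>F T in at_right 0. T \<in> {0<..<min 1 (1 / (4 * rate))}"
    using rate_pos by (intro eventually_at_right_real) auto
  then show ?thesis
    by eventually_elim (use rate_pos in \<open>auto simp: field_simps\<close>)
qed

text \<open>The first arrival contributes F 0 x, up to \<epsilon>, times 1 - exp(-l T), which is l T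
  to first order. The later arrivals contribute O(T^2) and vanish after division by T.\<close>

lemma tendsto_mean_total:
  "((\<lambda>T. mean_total T x / T) \<longlongrightarrow> rate * F 0 x) (at_right 0)"
proof (rule tendstoI)
  fix e :: real assume e: "0 < e"
  define \<epsilon> where "\<epsilon> = e / (2 * rate)"
  have \<epsilon>: "0 < \<epsilon>" using e rate_pos by (simp add: \<epsilon>_def)
  have re: "rate * \<epsilon> = e / 2" using rate_pos by (simp add: \<epsilon>_def)
  let ?p = "\<lambda>T. 1 - exp (- rate * T)" and ?K = "gain_bound * exp (k * \<bar>x\<bar>)"
  have "((\<lambda>T. ?p T) has_real_derivative rate) (at 0)"
    by (auto intro!: derivative_eq_intros)
  then have "((\<lambda>T. ?p T / T) \<longlongrightarrow> rate) (at 0)"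
    by (simp add: has_field_derivative_iff)
  then have p: "((\<lambda>T. ?p T / T) \<longlongrightarrow> rate) (at_right 0)"
    by (rule filterlim_mono) (auto simp: at_le)
  have "((\<lambda>T. (F 0 x - \<epsilon>) * (?p T / T)) \<longlongrightarrow> (F 0 x - \<epsilon>) * rate) (at_right 0)"
    by (intro tendsto_intros p)
  then have lo: "\<forall>\<^sub>F T in at_right 0. rate * F 0 x - e < (F 0 x - \<epsilon>) * (?p T / T)"
    by (rule order_tendstoD) (use e re in \<open>simp add: algebra_simps\<close>)
  have "((\<lambda>T. (F 0 x + \<epsilon>) * (?p T / T) + ?K * (8 * rate\<^sup>2 * T)) \<longlongrightarrow> (F 0 x + \<epsilon>) * rate + ?K * (8 * rate\<^sup>2 * 0)) (at_right 0)"
    by (intro tendsto_intros p)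
  then have hi: "\<forall>\<^sub>F T in at_right 0. (F 0 x + \<epsilon>) * (?p T / T) + ?K * (8 * rate\<^sup>2 * T) < rate * F 0 x + e"
    by (rule order_tendstoD) (use e re in \<open>simp add: algebra_simps\<close>)
  show "\<forall>\<^sub>F T in at_right 0. dist (mean_total T x / T) (rate * F 0 x) < e"
    using lo hi expected_gain_0_bounds[OF \<epsilon>, of x] eventually_small_time
  proof eventually_elim
    case (elim T)
    then have T: "0 \<le> T" "T \<le> 1" "4 * rate * T \<le> 1" "0 < T" by auto
    have pT: "0 \<le> ?p T" using T rate_pos by simp
    have K: "0 \<le> ?K" by (simp add: gain_bound_nonneg)
    have tot: "ennreal (mean_total T x) = expected_gain 0 T x + (\<Sum>j. expected_gain (Suc j) T x)"
      unfolding ennreal_mean_total[OF T(1-3)] total_gain_split[OF T(1)] ..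
    have "ennreal ((F 0 x - \<epsilon>) * ?p T) \<le> ennreal (mean_total T x)"
      unfolding tot using elim by (auto intro: add_increasing2)
    then have l: "(F 0 x - \<epsilon>) * ?p T \<le> mean_total T x"
      by (subst (asm) ennreal_le_iff2) (use mean_total_nonneg[of T x] in auto)
    have "ennreal (mean_total T x) \<le> ennreal ((F 0 x + \<epsilon>) * ?p T) + ennreal (?K * (2 * (2 * rate * T)\<^sup>2))"
      unfolding tot using elim T by (intro add_mono later_gains_le) auto
    also have "\<dots> = ennreal ((F 0 x + \<epsilon>) * ?p T + ?K * (2 * (2 * rate * T)\<^sup>2))"
      using K pT F_nonneg[of 0 x] \<epsilon> by (subst ennreal_plus) auto
    finally have u: "mean_total T x \<le> (F 0 x + \<epsilon>) * ?p T + ?K * (2 * (2 * rate * T)\<^sup>2)"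
      using K pT F_nonneg[of 0 x] \<epsilon> by (subst (asm) ennreal_le_iff) auto
    have "(F 0 x - \<epsilon>) * (?p T / T) \<le> mean_total T x / T"
      using divide_right_mono[OF l T(1)] by simp
    moreover have "mean_total T x / T \<le> (F 0 x + \<epsilon>) * (?p T / T) + ?K * (8 * rate\<^sup>2 * T)"
    proof -
      have "mean_total T x / T \<le> ((F 0 x + \<epsilon>) * ?p T + ?K * (2 * (2 * rate * T)\<^sup>2)) / T"
        using u T by (intro divide_right_mono) auto
      also have "\<dots> = (F 0 x + \<epsilon>) * (?p T / T) + ?K * (8 * rate\<^sup>2 * T)"
        using T by (simp add: add_divide_distrib power2_eq_square)
      finally show ?thesis .
    qed
    ultimately show ?case using elim by (simp add: dist_real_def abs_less_iff)
  qed
qed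

lemma measurable_mean_total [measurable]:
  assumes T: "0 \<le> T"
  shows "mean_total T \<in> borel_measurable \<pi>"
proof -
  have "(\<lambda>p. (fst p, snd p)) \<in> \<pi> \<Otimes>\<^sub>M M \<rightarrow>\<^sub>M borel \<Otimes>\<^sub>M driver_algebra" by measurable
  from measurable_compose[OF this measurable_total_gain[OF T]]
  have "(\<lambda>(x, w). total_gain T x w) \<in> borel_measurable (\<pi> \<Otimes>\<^sub>M M)" by (simp add: split_beta')
  then show ?thesis
    unfolding mean_total_def[abs_def] by (rule borel_measurable_lebesgue_integral)
qed

lemma integral_total_gain:
  assumes T: "0 \<le> T" "T \<le> 1" "4 * rate * T \<le> 1"
  shows "(\<integral>w. total_gain T (z0 w) w \<partial>M) = (\<integral>x. mean_total T x \<partial>\<pi>)"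
proof -
  have "(\<lambda>w. (z0 w, w)) \<in> M \<rightarrow>\<^sub>M borel \<Otimes>\<^sub>M driver_algebra" by measurable
  from measurable_compose[OF this measurable_total_gain[OF T(1)]]
  have meas: "(\<lambda>w. total_gain T (z0 w) w) \<in> borel_measurable M" by simp
  have "(\<lambda>(x, w). ennreal (total_gain T x w)) \<in> borel_measurable (borel \<Otimes>\<^sub>M driver_algebra)"
    using measurable_compose[OF measurable_total_gain[OF T(1)] measurable_ennreal] by (simp add: split_beta')
  then have "(\<integral>\<^sup>+w. ennreal (total_gain T (z0 w) w) \<partial>M) = (\<integral>\<^sup>+x. (\<integral>\<^sup>+w. ennreal (total_gain T x w) \<partial>M) \<partial>\<pi>)"
    by (rule nn_integral_start_driver)
  also have "\<dots> = (\<integral>\<^sup>+x. ennreal (mean_total T x) \<partial>\<pi>)"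
    by (simp add: ennreal_mean_total[OF T])
  finally show ?thesis
    using T meas by (simp add: integral_eq_nn_integral total_gain_nonneg mean_total_nonneg)
qed

text \<open>The tails of \<open>\<pi>\<close> have to be lighter than the growth of the profit.\<close>

lemma tendsto_total_gain:
  assumes k: "k < decay"
  shows "((\<lambda>T. (\<integral>w. total_gain T (z0 w) w \<partial>M) / T) \<longlongrightarrow> rate * (\<integral>x. F 0 x \<partial>\<pi>)) (at_right 0)"
proof -
  obtain d where d: "0 < d" "\<And>T. 0 < T \<Longrightarrow> T < d \<Longrightarrow> T \<le> 1 \<and> 4 * rate * T \<le> 1"
    using eventually_small_time by (auto simp: eventually_at_right_field)
  show ?thesis
  proof (rule tendsto_at_right_sequentially[OF d(1)])
    fix S :: "nat \<Rightarrow> real"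
    assume S: "\<And>n. 0 < S n" "\<And>n. S n < d" "S \<longlonglongrightarrow> 0"
    have small: "0 \<le> S n" "S n \<le> 1" "4 * rate * S n \<le> 1" for n
      using S(1,2)[of n] d(2)[of "S n"] by auto
    have "(\<lambda>n. \<integral>x. mean_total (S n) x / S n \<partial>\<pi>) \<longlonglongrightarrow> (\<integral>x. rate * F 0 x \<partial>\<pi>)"
    proof (rule integral_dominated_convergence)
      show "integrable \<pi> (\<lambda>x. 4 * rate * gain_bound * exp (k * \<bar>x\<bar>))"
        using integrable_\<pi>_exp[OF k_nonneg k] by (rule integrable_mult_right)
      show "AE x in \<pi>. norm (mean_total (S n) x / S n) \<le> 4 * rate * gain_bound * exp (k * \<bar>x\<bar>)" for n
      proof (rule AE_I2)
        fix x
        have "mean_total (S n) x / S n \<le> 4 * rate * gain_bound * exp (k * \<bar>x\<bar>)"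
          using mean_total_le[OF small[of n], of x] S(1)[of n] by (simp add: pos_divide_le_eq)
        then show "norm (mean_total (S n) x / S n) \<le> 4 * rate * gain_bound * exp (k * \<bar>x\<bar>)"
          using mean_total_nonneg[of "S n" x] S(1)[of n] by simp
      qed
      have "filterlim S (at_right 0) sequentially"
        by (rule tendsto_imp_filterlim_at_right[OF S(3)]) (use S(1) in simp)
      then show "AE x in \<pi>. (\<lambda>n. mean_total (S n) x / S n) \<longlonglongrightarrow> rate * F 0 x"
        using filterlim_compose[OF tendsto_mean_total] by blast
    qed (use small in measurable)
    then show "(\<lambda>n. (\<integral>w. total_gain (S n) (z0 w) w \<partial>M) / S n) \<longlonglongrightarrow> rate * (\<integral>x. F 0 x \<partial>\<pi>)"
      unfolding integral_total_gain[OF small] by simp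
  qed
qed

end

text \<open>On \<open>u \<ge> 0\<close> this agrees with \<open>mean_profit\<close>, but its measurability is immediate.\<close>

definition tail_profit ::
    "(real \<Rightarrow> real) \<Rightarrow> (real \<Rightarrow> real) \<Rightarrow> real \<Rightarrow> real \<Rightarrow> real \<Rightarrow> real \<Rightarrow> real" where
  "tail_profit xs ys \<gamma> \<delta> P u = (profit xs ys \<gamma> \<delta> P (\<gamma> + \<delta> + u) + profit xs ys \<gamma> \<delta> P (- (\<gamma> + \<delta>) - u)) / 2"

lemma tail_profit_eq:
  assumes "0 < \<gamma>" "0 \<le> \<delta>" "0 \<le> u"
  shows "tail_profit xs ys \<gamma> \<delta> P u = mean_profit xs ys \<gamma> \<delta> P u"
proof -
  have zero: "profit_minus xs ys \<gamma> \<delta> P (u + (\<gamma> + \<delta>)) = 0" "profit_plus xs ys \<gamma> \<delta> P (- u - (\<gamma> + \<delta>)) = 0"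
    using assms by (auto simp: profit_plus_def profit_minus_def)
  have args: "\<gamma> + \<delta> + u = u + (\<gamma> + \<delta>)" "- (\<gamma> + \<delta>) - u = - u - (\<gamma> + \<delta>)" by auto
  show ?thesis
    unfolding tail_profit_def mean_profit_def profit_def args zero by simp
qed

lemma profit_eq_tails:
  assumes "0 < \<gamma>" "0 \<le> \<delta>"
  shows "profit xs ys \<gamma> \<delta> P x
    = profit xs ys \<gamma> \<delta> P x * indicator {\<gamma> + \<delta><..} x + profit xs ys \<gamma> \<delta> P x * indicator {..<- (\<gamma> + \<delta>)} x"
  using assms by (auto simp: profit_def profit_plus_def profit_minus_def split: split_indicator)

lemma (in pool) measurable_profit_at [measurable]:
  "0 < P \<Longrightarrow> profit xs ys \<gamma> \<delta> P \<in> borel_measurable borel"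
  by (rule borel_measurable_profit) auto

lemma (in pool) measurable_tail_profit [measurable]:
  assumes P: "0 < P"
  shows "tail_profit xs ys \<gamma> \<delta> P \<in> borel_measurable borel"
proof -
  note [measurable] = measurable_profit_at[OF P]
  show ?thesis unfolding tail_profit_def[abs_def] by measurable
qed

text \<open>The profit vanishes between the thresholds and both tails carry the mass
  \<open>trade_prob\<close> / 2. The two exponential averages therefore combine into one average of
  the symmetrised profit.\<close>

lemma (in mispricing_setting) integral_\<pi>_profit:
  assumes "pool f L xs ys" and P: "0 < P"
  shows "(\<integral>x. profit xs ys \<gamma> \<delta> P x \<partial>\<pi>)
    = trade_prob \<gamma> \<delta> \<pi> * (\<integral>u. exponential_density decay u * tail_profit xs ys \<gamma> \<delta> P u \<partial>lborel)"
proof -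
  interpret pool f L xs ys by fact
  let ?A = "profit xs ys \<gamma> \<delta> P" and ?e = "exponential_density decay"
  let ?p = "measure \<pi> {\<gamma> + \<delta><..}"
  note [measurable] = measurable_profit_at[OF P] measurable_tail_profit[OF P]
  have nn: "0 \<le> ?A x" for x using profit_nonneg[OF P \<delta>_nonneg] .
  have tail_nn: "0 \<le> tail_profit xs ys \<gamma> \<delta> P u" for u by (simp add: tail_profit_def nn)
  have "(\<integral>\<^sup>+x. ennreal (?A x) \<partial>\<pi>) = (\<integral>\<^sup>+x. ennreal (?A x) * indicator {\<gamma> + \<delta><..} x
      + ennreal (?A x) * indicator {..<- (\<gamma> + \<delta>)} x \<partial>\<pi>)"
  proof (intro nn_integral_cong)
    fix x
    show "ennreal (?A x) = ennreal (?A x) * indicator {\<gamma> + \<delta><..} x + ennreal (?A x) * indicator {..<- (\<gamma> + \<delta>)} x"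
      using profit_eq_tails[OF \<gamma>_pos \<delta>_nonneg, of xs ys P x] \<gamma>_pos \<delta>_nonneg by (auto split: split_indicator)
  qed
  also have "\<dots> = (\<integral>\<^sup>+x. ennreal (?A x) * indicator {\<gamma> + \<delta><..} x \<partial>\<pi>)
      + (\<integral>\<^sup>+x. ennreal (?A x) * indicator {..<- (\<gamma> + \<delta>)} x \<partial>\<pi>)"
    by (rule nn_integral_add) measurable
  also have "\<dots> = ennreal ?p * (\<integral>\<^sup>+u. ennreal (?e u) * ennreal (?A (\<gamma> + \<delta> + u)) \<partial>lborel)
      + ennreal ?p * (\<integral>\<^sup>+u. ennreal (?e u) * ennreal (?A (- (\<gamma> + \<delta>) - u)) \<partial>lborel)"
  proof -
    have hm: "(\<lambda>x. ennreal (?A x)) \<in> borel_measurable borel" by measurable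
    show ?thesis
      unfolding nn_integral_\<pi>_tails[OF hm] \<pi>.emeasure_eq_measure tails_symmetric ..
  qed
  also have "\<dots> = ennreal ?p * (\<integral>\<^sup>+u. ennreal (?e u) * ennreal (?A (\<gamma> + \<delta> + u))
      + ennreal (?e u) * ennreal (?A (- (\<gamma> + \<delta>) - u)) \<partial>lborel)"
    by (simp add: nn_integral_add distrib_left)
  also have "(\<lambda>u. ennreal (?e u) * ennreal (?A (\<gamma> + \<delta> + u)) + ennreal (?e u) * ennreal (?A (- (\<gamma> + \<delta>) - u)))
      = (\<lambda>u. ennreal 2 * ennreal (?e u * tail_profit xs ys \<gamma> \<delta> P u))"
    using nn exponential_density_nonneg[OF decay_pos] tail_nn
    by (auto simp: fun_eq_iff tail_profit_def ennreal_mult[symmetric] ennreal_plus[symmetric] distrib_left[symmetric]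
        simp del: ennreal_plus ennreal_numeral)
  also have "(\<integral>\<^sup>+u. ennreal 2 * ennreal (?e u * tail_profit xs ys \<gamma> \<delta> P u) \<partial>lborel)
      = ennreal 2 * (\<integral>\<^sup>+u. ennreal (?e u * tail_profit xs ys \<gamma> \<delta> P u) \<partial>lborel)"
    by (rule nn_integral_cmult) measurable
  \<comment> \<open>An infinite value is sent to 0 by \<open>enn2real\<close>, which is also the
    Bochner integral of a nonnegative non-integrable function, so the two conventions agree.\<close>
  finally have "enn2real (\<integral>\<^sup>+x. ennreal (?A x) \<partial>\<pi>)
      = ?p * (2 * enn2real (\<integral>\<^sup>+u. ennreal (?e u * tail_profit xs ys \<gamma> \<delta> P u) \<partial>lborel))"
    by (simp add: enn2real_mult)
  then show ?thesis
    using nn tail_nn exponential_density_nonneg[OF decay_pos]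
    by (simp add: integral_eq_nn_integral trade_prob_eq)
qed

text \<open>Drift \<sigma>^2 / 2 cancels the Ito correction, so the price is P exp(\<sigma> B) and
  each summand of \<open>arb\<close> is a \<open>gain\<close>. The bound on k makes the exponential
  growth of the profit integrable against the tails of \<open>\<pi>\<close>.\<close>

lemma arb_rate_eq:
  assumes "pool f L xs ys" "mispricing_setting M B rate \<tau> \<sigma> \<gamma> \<delta> \<pi> z0" and P: "0 < P"
    and C: "0 \<le> C" "0 \<le> k" "\<And>w z. profit xs ys \<gamma> \<delta> (P * exp w) z \<le> C * exp (k * (\<bar>w\<bar> + \<bar>z\<bar>))"
    and k: "k < sqrt (2 * rate) / \<sigma>"
  shows "arb_rate xs ys \<sigma> \<gamma> \<delta> P M B \<tau> z0
    = rate * (trade_prob \<gamma> \<delta> \<pi>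
      * (\<integral>u. exponential_density (sqrt (2 * rate) / \<sigma>) u * tail_profit xs ys \<gamma> \<delta> P u \<partial>lborel))"
proof -
  interpret pool f L xs ys by fact
  interpret mispricing_setting M B rate \<tau> \<sigma> \<gamma> \<delta> \<pi> z0 by fact
  interpret profit_setting M B rate \<tau> \<sigma> \<gamma> \<delta> \<pi> z0 "\<lambda>w z. profit xs ys \<gamma> \<delta> (P * exp w) z" C k
  proof
    show "0 \<le> profit xs ys \<gamma> \<delta> (P * exp w) z" for w z
      using P \<delta>_nonneg by (intro profit_nonneg) auto
    show "continuous_on UNIV (\<lambda>p :: real \<times> real. profit xs ys \<gamma> \<delta> (P * exp (fst p)) (snd p))"
      using P by (intro continuous_on_profit continuous_intros) auto
  qed (use C in auto)
  have arb: "arb xs ys \<sigma> \<gamma> \<delta> P (\<lambda>t. B t w) (\<lambda>i. \<tau> i w) x T = total_gain T x w"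
    if w: "w \<in> space M" for w x T
  proof -
    have "Lim (at_left (\<tau> (Suc j) w)) (mispricing \<sigma> \<gamma> \<delta> (\<lambda>s. B s w) (\<lambda>i. \<tau> i w) x)
        = pre_arrival \<sigma> \<gamma> \<delta> (\<lambda>s. B s w) (\<lambda>i. \<tau> i w) x j" for j
      using \<tau>_strict_mono[OF w] \<tau>_0[OF w] B_continuous[OF w] by (rule Lim_at_left_mispricing)
    then show ?thesis
      by (simp add: arb_def total_gain_def gain_def price_def geometric_path_def sum.atLeast1_atMost_eq)
  qed
  have "((\<lambda>T. (\<integral>w. total_gain T (z0 w) w \<partial>M) / T)
      \<longlongrightarrow> rate * (\<integral>x. profit xs ys \<gamma> \<delta> (P * exp 0) x \<partial>\<pi>)) (at_right 0)"
    using k by (intro tendsto_total_gain) (simp add: decay_def)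
  moreover have "(\<integral>w. arb xs ys \<sigma> \<gamma> \<delta> P (\<lambda>t. B t w) (\<lambda>i. \<tau> i w) (z0 w) T \<partial>M)
      = (\<integral>w. total_gain T (z0 w) w \<partial>M)" for T
    by (intro Bochner_Integration.integral_cong) (auto simp: arb)
  ultimately have "arb_rate xs ys \<sigma> \<gamma> \<delta> P M B \<tau> z0 = rate * (\<integral>x. profit xs ys \<gamma> \<delta> P x \<partial>\<pi>)"
    unfolding arb_rate_def by (intro tendsto_Lim) simp_all
  then show ?thesis
    using integral_\<pi>_profit[OF assms(1) P] by (simp add: decay_def)
qed

text \<open>Each arrival rate l has its own measure, driving processes and invariant law, linked
  only by the common parameters. The expansion is guarded by \<delta> > 0 because the estimate
  \<open>trade_prob\<close> = O(1 / l) depends on it.\<close>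

theorem theorem6:
  fixes f :: "real \<Rightarrow> real \<Rightarrow> real" and L \<sigma> \<gamma> \<delta> P :: real
    and xs ys :: "real \<Rightarrow> real"
    and M :: "real \<Rightarrow> 'a measure"
    and B :: "real \<Rightarrow> real \<Rightarrow> 'a \<Rightarrow> real"
    and \<tau> :: "real \<Rightarrow> nat \<Rightarrow> 'a \<Rightarrow> real"
    and \<pi> :: "real \<Rightarrow> real measure"
    and z0 :: "real \<Rightarrow> 'a \<Rightarrow> real"
  assumes "\<sigma> > 0" and "\<gamma> > 0" and "\<delta> \<ge> 0" and "P > 0"
    and "pool f L xs ys"
    and "\<And>l. l > 0 \<Longrightarrow> mispricing_model (M l) (B l) l (\<tau> l) \<sigma> \<gamma> \<delta> (\<pi> l) (z0 l)"
    and "\<And>l t. l > 0 \<Longrightarrow> t \<ge> 0 \<Longrightarrow>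
      (\<integral>\<^sup>+ \<omega>. (\<integral>\<^sup>+ s \<in> {0..t}.
         ennreal ((xs (price \<sigma> P (\<lambda>u. B l u \<omega>) s))\<^sup>2 * (price \<sigma> P (\<lambda>u. B l u \<omega>) s)\<^sup>2) \<partial>lborel) \<partial>M l) < \<infinity>"
    and "\<And>Q. Q > 0 \<Longrightarrow> \<exists>D A\<^sub>0 c.
      (\<forall>x\<ge>0. (mean_profit xs ys \<gamma> \<delta> Q has_real_derivative D x) (at x within {0..})) \<and>
      continuous_on {0..} D \<and> (\<forall>x\<ge>0. D x \<le> A\<^sub>0 * exp (c * x))"
  shows "(\<forall>Q>0. gas_plus xs ys \<gamma> \<delta> Q \<ge> 0 \<and> gas_minus xs ys \<gamma> \<delta> Q \<ge> 0) \<and>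
    (\<forall>Q>0. \<forall>z. profit_plus xs ys \<gamma> \<delta> Q z \<ge> 0 \<and> profit_minus xs ys \<gamma> \<delta> Q z \<ge> 0) \<and>
    (\<forall>Q>0. \<forall>x\<ge>0. mean_profit xs ys \<gamma> \<delta> Q x \<ge> 0) \<and>
    (\<delta> > 0 \<longrightarrow> (\<lambda>l. arb_rate xs ys \<sigma> \<gamma> \<delta> P (M l) (B l) (\<tau> l) (z0 l)
         - \<sigma>\<^sup>2 * P / 2
           * ((deriv ys (P * exp (- \<gamma> - \<delta>)) + exp (\<gamma> + \<delta>) * deriv ys (P * exp (\<gamma> + \<delta>))) / 2)
           * (1 - exp (- \<delta>)) * (sqrt (2 * l) / \<sigma>) * trade_prob \<gamma> \<delta> (\<pi> l))
      \<in> o[at_top](\<lambda>l. sqrt (inverse l)))"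
proof -
  interpret pool f L xs ys by fact
  have setting: "mispricing_setting (M l) (B l) l (\<tau> l) \<sigma> \<gamma> \<delta> (\<pi> l) (z0 l)" if "0 < l" for l
    using assms(1-3) assms(6)[OF that] that
    by (intro mispricing_setting.intro mispricing_setting_axioms.intro)
  have growth: "\<exists>A\<ge>0. \<exists>c\<ge>0. \<forall>x\<ge>0. mean_profit xs ys \<gamma> \<delta> Q x \<le> A * x * exp (c * x)" if "0 < Q" for Q
    using assms(8)[OF that] mean_profit_growth[of xs ys \<gamma> \<delta> Q] by blast
  \<comment> \<open>The growth condition enters twice: at price 1, to bound the profit at the random
    arrival prices, and at P, to dominate the limit of the exponential average.\<close>
  obtain A1 c1 where "0 \<le> A1" "0 \<le> c1" "\<forall>x\<ge>0. mean_profit xs ys \<gamma> \<delta> 1 x \<le> A1 * x * exp (c1 * x)"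
    using growth[of 1] by auto
  then obtain K k1 where "0 \<le> K" "0 \<le> k1" "\<forall>u. xs (exp u) + ys (exp u) \<le> K * exp (k1 * \<bar>u\<bar>)"
    using reserves_growth assms(2,3) by (metis less_imp_le)
  then obtain C k where C: "0 \<le> C" "0 \<le> k" "\<And>w z. profit xs ys \<gamma> \<delta> (P * exp w) z \<le> C * exp (k * (\<bar>w\<bar> + \<bar>z\<bar>))"
    using profit_growth[OF _ _ _ assms(4)] by metis
  obtain A c where A: "0 \<le> A" "0 \<le> c" "\<And>x. 0 \<le> x \<Longrightarrow> mean_profit xs ys \<gamma> \<delta> P x \<le> A * x * exp (c * x)"
    using growth[OF assms(4)] by blast
  have "(\<lambda>l. arb_rate xs ys \<sigma> \<gamma> \<delta> P (M l) (B l) (\<tau> l) (z0 l)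
         - \<sigma>\<^sup>2 * P / 2
           * ((deriv ys (P * exp (- \<gamma> - \<delta>)) + exp (\<gamma> + \<delta>) * deriv ys (P * exp (\<gamma> + \<delta>))) / 2)
           * (1 - exp (- \<delta>)) * (sqrt (2 * l) / \<sigma>) * trade_prob \<gamma> \<delta> (\<pi> l))
      \<in> o[at_top](\<lambda>l. sqrt (inverse l))" (is "?err \<in> _") if \<delta>: "0 < \<delta>"
  proof (rule smalloI_tendsto)
    let ?\<theta> = "\<lambda>l. sqrt (2 * l) / \<sigma>"
    define a where "a = P * (deriv ys (P * exp (- \<gamma> - \<delta>)) + exp (\<gamma> + \<delta>) * deriv ys (P * exp (\<gamma> + \<delta>))) / 2 * (1 - exp (- \<delta>))"
    define J where "J \<theta> = \<theta> * (\<integral>u. exponential_density \<theta> u * tail_profit xs ys \<gamma> \<delta> P u \<partial>lborel)" for \<theta>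
    define \<kappa> where "\<kappa> = (\<gamma> + \<delta>)\<^sup>2 - \<gamma>\<^sup>2"
    have \<kappa>: "0 < \<kappa>"
      using \<delta> assms(2) by (simp add: \<kappa>_def power2_sum add_pos_pos)
    have J: "(J \<longlongrightarrow> a) at_top"
      unfolding J_def[abs_def]
    proof (rule tendsto_exponential_average[where A=A and c=c])
      show "(tail_profit xs ys \<gamma> \<delta> P has_real_derivative a) (at 0 within {0..})"
        unfolding a_def
        by (rule has_field_derivative_transform_within[OF has_derivative_mean_profit_0[OF assms(4)] zero_less_one])
           (use assms(2,3) in \<open>auto simp: tail_profit_eq\<close>)
      show "\<bar>tail_profit xs ys \<gamma> \<delta> P x\<bar> \<le> A * x * exp (c * x)" if "0 \<le> x" for x
        using that A(3) mean_profit_nonneg[OF assms(4,3)] assms(2,3) by (simp add: tail_profit_eq)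
      show "tail_profit xs ys \<gamma> \<delta> P 0 = 0"
        using tail_profit_eq[OF assms(2,3), of 0] by simp
    qed (use assms(4) A in auto)
    have \<theta>: "filterlim ?\<theta> at_top at_top"
      unfolding divide_inverse using assms(1)
      by (intro filterlim_at_top_mult_tendsto_pos[OF tendsto_const] filterlim_compose[OF sqrt_at_top]
          filterlim_tendsto_pos_mult_at_top[OF tendsto_const _ filterlim_ident]) auto
    \<comment> \<open>The constant arises from \<open>\<sigma>\<^sup>2 / 2 * \<theta> * (2 /
      (\<theta>\<^sup>2 * \<kappa>)) * sqrt l\<close> with sqrt l = \<sigma> \<theta> / sqrt 2: all
      powers of \<theta> cancel.\<close>
    have lim: "((\<lambda>l. \<sigma> ^ 3 / (\<kappa> * sqrt 2) * \<bar>J (?\<theta> l) - a\<bar>) \<longlongrightarrow> \<sigma> ^ 3 / (\<kappa> * sqrt 2) * \<bar>a - a\<bar>) at_top"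
      by (intro tendsto_intros filterlim_compose[OF J \<theta>])
    show "((\<lambda>l. ?err l / sqrt (inverse l)) \<longlongrightarrow> 0) at_top"
    proof (rule Lim_null_comparison)
      show "((\<lambda>l. \<sigma> ^ 3 / (\<kappa> * sqrt 2) * \<bar>J (?\<theta> l) - a\<bar>) \<longlongrightarrow> 0) at_top"
        using lim by simp
      \<comment> \<open>For large l the parameter \<theta> exceeds the growth exponent k, as
        \<open>arb_rate_eq\<close> demands.\<close>
      show "\<forall>\<^sub>F l in at_top. norm (?err l / sqrt (inverse l)) \<le> \<sigma> ^ 3 / (\<kappa> * sqrt 2) * \<bar>J (?\<theta> l) - a\<bar>"
        using eventually_gt_at_top[of 0] filterlim_at_top_dense[THEN iffD1, OF \<theta>, rule_format, of k]
      proof eventually_elim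
        case (elim l)
        define \<theta>0 where "\<theta>0 = ?\<theta> l"
        define p where "p = trade_prob \<gamma> \<delta> (\<pi> l)"
        interpret S: mispricing_setting "M l" "B l" l "\<tau> l" \<sigma> \<gamma> \<delta> "\<pi> l" "z0 l"
          by (rule setting) (use elim in auto)
        have \<theta>0: "0 < \<theta>0" using elim assms(1) by (simp add: \<theta>0_def)
        \<comment> \<open>Expressing l through \<theta> turns l * p times the average into
          \<open>\<sigma>\<^sup>2 / 2 * \<theta> * p * J \<theta>\<close>, so that the main term
          differs only by a in place of J.\<close>
        have l: "l = \<sigma>\<^sup>2 * \<theta>0\<^sup>2 / 2" using elim assms(1) by (simp add: \<theta>0_def power_divide)
        have p: "0 \<le> p" "p \<le> 2 / (\<theta>0\<^sup>2 * \<kappa>)"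
        proof -
          show "0 \<le> p" by (simp add: p_def trade_prob_def)
          have "p * \<kappa> \<le> 2 / \<theta>0\<^sup>2"
            using S.trade_prob_le by (simp add: p_def \<kappa>_def \<theta>0_def S.decay_def)
          then show "p \<le> 2 / (\<theta>0\<^sup>2 * \<kappa>)" using \<kappa> \<theta>0 by (simp add: field_simps)
        qed
        have "?err l = \<sigma>\<^sup>2 / 2 * \<theta>0 * p * (J \<theta>0 - a)"
        proof -
          have "arb_rate xs ys \<sigma> \<gamma> \<delta> P (M l) (B l) (\<tau> l) (z0 l)
            = l * (p * (\<integral>u. exponential_density \<theta>0 u * tail_profit xs ys \<gamma> \<delta> P u \<partial>lborel))"
            unfolding p_def \<theta>0_def
            by (rule arb_rate_eq[OF assms(5) setting assms(4) C]) (use elim in auto)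
          also have "\<dots> = \<sigma>\<^sup>2 / 2 * \<theta>0 * p * J \<theta>0"
            unfolding J_def by (subst l) (simp add: power2_eq_square)
          moreover have "s / 2 * t * q * j - s * P / 2 * (d / 2) * e * t * q = s / 2 * t * q * (j - P * d / 2 * e)"
            for s t q j d e :: real
            by (simp add: field_simps)
          ultimately show ?thesis
            unfolding a_def p_def[symmetric] \<theta>0_def[symmetric] by (simp only:)
        qed
        then have "norm (?err l / sqrt (inverse l)) = norm (\<sigma>\<^sup>2 / 2 * \<theta>0 * p * (J \<theta>0 - a) / sqrt (inverse l))"
          by (simp only:)
        also have "\<dots> = \<sigma>\<^sup>2 / 2 * \<theta>0 * p * \<bar>J \<theta>0 - a\<bar> * sqrt l"
        proof -
          have "X / sqrt (inverse l) = X * sqrt l" for X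
            by (simp only: real_sqrt_inverse divide_inverse inverse_inverse_eq)
          then show ?thesis
            using \<theta>0 p(1) elim by (simp add: abs_mult)
        qed
        also have "\<dots> \<le> \<sigma>\<^sup>2 / 2 * \<theta>0 * (2 / (\<theta>0\<^sup>2 * \<kappa>)) * \<bar>J \<theta>0 - a\<bar> * sqrt l"
          using \<theta>0 p(2) elim by (intro mult_right_mono mult_left_mono) auto
        also have "\<dots> = \<sigma> ^ 3 / (\<kappa> * sqrt 2) * \<bar>J \<theta>0 - a\<bar>"
        proof -
          have "sqrt l = \<sigma> * \<theta>0 / sqrt 2" using elim assms(1) by (simp add: \<theta>0_def real_sqrt_mult)
          then show ?thesis
            using \<theta>0 by (simp add: power2_eq_square power3_eq_cube)
        qed
        finally show ?case by (simp add: \<theta>0_def)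
      qed
    qed
    show "\<forall>\<^sub>F l in at_top. sqrt (inverse l) \<noteq> (0 :: real)"
      using eventually_gt_at_top[of 0] by eventually_elim simp
  qed
  then show ?thesis
    using gas_nonneg[OF _ assms(3)] profit_parts_nonneg[OF _ assms(3)] mean_profit_nonneg[OF _ assms(3)]
    by blast
qed

end
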